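(* Let $\mathcal{B}\xrightarrow{u}\mathcal{C}\xrightarrow{v}\mathcal{D}\xrightarrow{+1}\mathcal{B}[1]$ be a distinguished triangle in $D(X)$, let $\mathcal{F},\mathcal{G}$ be objects of $D(X)$, and let $p$ be an integer. (1) Let $\tau\in \mathrm{Ext}^p(\mathcal{F},\mathcal{D})$. The image of $\tau$ under the connecting homomorphism $\mathrm{Ext}^p(\mathcal{F},\mathcal{D})\to \mathrm{Ext}^{p+1}(\mathcal{F},\mathcal{B})$ is the obstruction to lifting $\tau$ to $\mathcal{C}$: there exists $\tilde\tau\in\mathrm{Ext}^p(\mathcal{F},\mathcal{C})$ mapping to $\tau$ under the map induced by $v$ if and only if this image is zero. (2) Let $\rho\in\mathrm{Ext}^p(\mathcal{B},\mathcal{G})$. The image of $\rho$ under the connecting homomorphism $\mathrm{Ext}^p(\mathcal{B},\mathcal{G})\to \mathrm{Ext}^{p+1}(\mathcal{D},\mathcal{G})$ is the obstruction to extending $\rho$ to $\mathcal{C}$: there exists $\tilde\rho\in\mathrm{Ext}^p(\mathcal{C},\mathcal{G})$ mapping to $\rho$ under the map induced by $u$ if and only if this image is zero.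
   Context: $X$ is a compact Kähler manifold of dimension $n$, and $D(X)$ is the bounded derived category of coherent sheaves on $X$. For objects $\mathcal{F},\mathcal{G}$ of $D(X)$, $\mathrm{Ext}^k(\mathcal{F},\mathcal{G})=\mathrm{Hom}_{D(X)}(\mathcal{F},\mathcal{G}[k])$ (the space of "strings with ghost number $k$" from $\mathcal{F}$ to $\mathcal{G}$). The connecting homomorphisms are those of the long exact sequences obtained by applying the cohomological functors $\mathrm{Hom}_{D(X)}(\mathcal{F},\cdot)$ and $\mathrm{Hom}_{D(X)}(\cdot,\mathcal{G})$ to the triangle. *)

theory Defs
  imports "HOL-Analysis.Analysis" "HOL-Algebra.Module"
begin

section \<open>Complex manifolds and Kaehler metrics\<close>

text \<open>
  To let the dimension \<open>n\<close> be an arbitrary natural number (zero included), \<open>\<complex>\<^sup>n\<close> is the set of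
  sequences vanishing from index \<open>n\<close> on; the type \<open>nat \<Rightarrow> complex\<close> carries the product topology,
  which induces the Euclidean one on this set.
\<close>

definition cspace :: "nat \<Rightarrow> (nat \<Rightarrow> complex) set" where
  "cspace n = {z. \<forall>i\<ge>n. z i = 0}"

definition cnorm :: "nat \<Rightarrow> (nat \<Rightarrow> complex) \<Rightarrow> real" where
  "cnorm n z = L2_set (\<lambda>i. cmod (z i)) {..<n}"

text \<open>Complex (Frechet) differentiability in \<open>n\<close> variables: there is a complex linear form \<open>a\<close>
  with \<open>f w - f z - a (w - z) = o(|w - z|)\<close>.\<close>

definition cdifferentiable :: "nat \<Rightarrow> ((nat \<Rightarrow> complex) \<Rightarrow> complex) \<Rightarrow> (nat \<Rightarrow> complex) \<Rightarrow> bool" where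
  "cdifferentiable n f z \<longleftrightarrow>
     (\<exists>a. ((\<lambda>w. (f w - f z - (\<Sum>i<n. a i * (w i - z i))) / of_real (cnorm n (\<lambda>i. w i - z i)))
        \<longlongrightarrow> 0) (at z within cspace n))"

text \<open>Real partial derivatives: \<open>c = 1\<close> is the direction of the real part of the \<open>i\<close>-th
  coordinate, \<open>c = \<i>\<close> that of its imaginary part.\<close>

definition rline :: "nat \<Rightarrow> complex \<Rightarrow> (nat \<Rightarrow> complex) \<Rightarrow> real \<Rightarrow> (nat \<Rightarrow> complex)" where
  "rline i c z t = z(i := z i + of_real t * c)"

definition rpartial ::
  "nat \<Rightarrow> complex \<Rightarrow> ((nat \<Rightarrow> complex) \<Rightarrow> complex) \<Rightarrow> (nat \<Rightarrow> complex) \<Rightarrow> complex" where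
  "rpartial i c f z = vector_derivative (\<lambda>t. f (rline i c z t)) (at 0)"

primrec Ck_on ::
  "nat \<Rightarrow> nat \<Rightarrow> (nat \<Rightarrow> complex) set \<Rightarrow> ((nat \<Rightarrow> complex) \<Rightarrow> complex) \<Rightarrow> bool" where
  "Ck_on n 0 V f \<longleftrightarrow> continuous_on V f"
| "Ck_on n (Suc k) V f \<longleftrightarrow> continuous_on V f \<and>
     (\<forall>i<n. \<forall>c\<in>{1, \<i>}. (\<forall>z\<in>V. (\<lambda>t. f (rline i c z t)) differentiable (at 0)) \<and>
        Ck_on n k V (rpartial i c f))"

definition smooth_on ::
  "nat \<Rightarrow> (nat \<Rightarrow> complex) set \<Rightarrow> ((nat \<Rightarrow> complex) \<Rightarrow> complex) \<Rightarrow> bool" where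
  "smooth_on n V f \<longleftrightarrow> (\<forall>k. Ck_on n k V f)"

text \<open>The Wirtinger derivative \<open>\<partial>f/\<partial>z\<^sub>i\<close>.\<close>

definition wirtinger ::
  "nat \<Rightarrow> ((nat \<Rightarrow> complex) \<Rightarrow> complex) \<Rightarrow> (nat \<Rightarrow> complex) \<Rightarrow> complex" where
  "wirtinger i f z = (rpartial i 1 f z - \<i> * rpartial i \<i> f z) / 2"

record 'x cmanifold =
  points :: "'x topology"
  cdim :: nat
  atlas :: "('x set \<times> ('x \<Rightarrow> nat \<Rightarrow> complex)) set"

definition complex_manifold :: "'x cmanifold \<Rightarrow> bool" where
  "complex_manifold X \<longleftrightarrow>
     Hausdorff_space (points X) \<and>
     (\<exists>\<B>. countable \<B> \<and> (\<forall>V\<in>\<B>. openin (points X) V) \<and>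
        (\<forall>U x. openin (points X) U \<and> x \<in> U \<longrightarrow> (\<exists>V\<in>\<B>. x \<in> V \<and> V \<subseteq> U))) \<and>
     \<Union> (fst ` atlas X) = topspace (points X) \<and>
     (\<forall>(U, \<phi>) \<in> atlas X. openin (points X) U \<and>
        openin (top_of_set (cspace (cdim X))) (\<phi> ` U) \<and>
        homeomorphic_map (subtopology (points X) U) (top_of_set (\<phi> ` U)) \<phi>) \<and>
     (\<forall>(U, \<phi>) \<in> atlas X. \<forall>(V, \<psi>) \<in> atlas X. \<forall>x \<in> U \<inter> V. \<forall>k < cdim X.
        cdifferentiable (cdim X) (\<lambda>z. \<psi> (inv_into U \<phi> z) k) (\<phi> x))"

text \<open>
  A Kaehler metric is given in every chart by a positive definite Hermitian matrix \<open>h\<^sub>i\<^sub>j\<close> of smooth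
  functions transforming as \<open>\<Sum> h\<^sub>i\<^sub>j dz\<^sub>i \<otimes> cnj dz\<^sub>j\<close>.  The fundamental form
  \<open>\<i>/2 \<Sum> h\<^sub>i\<^sub>j dz\<^sub>i \<and> cnj dz\<^sub>j\<close> is closed iff \<open>\<partial>h\<^sub>i\<^sub>j/\<partial>z\<^sub>k = \<partial>h\<^sub>k\<^sub>j/\<partial>z\<^sub>i\<close>: this is the vanishing of the
  (2,1)-component of its exterior derivative, and the (1,2)-component is conjugate to that one.
\<close>

definition kaehler_metric ::
  "'x cmanifold \<Rightarrow>
   (('x set \<times> ('x \<Rightarrow> nat \<Rightarrow> complex)) \<Rightarrow> nat \<Rightarrow> nat \<Rightarrow> (nat \<Rightarrow> complex) \<Rightarrow> complex) \<Rightarrow> bool" where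
  "kaehler_metric X h \<longleftrightarrow>
     (\<forall>(U, \<phi>) \<in> atlas X.
        (\<forall>i < cdim X. \<forall>j < cdim X. smooth_on (cdim X) (\<phi> ` U) (h (U, \<phi>) i j)) \<and>
        (\<forall>z \<in> \<phi> ` U. \<forall>i < cdim X. \<forall>j < cdim X. h (U, \<phi>) j i z = cnj (h (U, \<phi>) i j z)) \<and>
        (\<forall>z \<in> \<phi> ` U. \<forall>\<xi>. (\<exists>i < cdim X. \<xi> i \<noteq> 0) \<longrightarrow>
           0 < Re (\<Sum>i < cdim X. \<Sum>j < cdim X. h (U, \<phi>) i j z * \<xi> i * cnj (\<xi> j))) \<and>
        (\<forall>z \<in> \<phi> ` U. \<forall>i < cdim X. \<forall>j < cdim X. \<forall>k < cdim X.
           wirtinger k (h (U, \<phi>) i j) z = wirtinger i (h (U, \<phi>) k j) z)) \<and>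
     (\<forall>(U, \<phi>) \<in> atlas X. \<forall>(V, \<psi>) \<in> atlas X. \<forall>x \<in> U \<inter> V. \<forall>i < cdim X. \<forall>j < cdim X.
        h (U, \<phi>) i j (\<phi> x) =
          (\<Sum>k < cdim X. \<Sum>l < cdim X.
             wirtinger i (\<lambda>z. \<psi> (inv_into U \<phi> z) k) (\<phi> x) *
             cnj (wirtinger j (\<lambda>z. \<psi> (inv_into U \<phi> z) l) (\<phi> x)) *
             h (V, \<psi>) k l (\<psi> x)))"

definition compact_kaehler_manifold :: "'x cmanifold \<Rightarrow> bool" where
  "compact_kaehler_manifold X \<longleftrightarrow>
     complex_manifold X \<and> compact_space (points X) \<and> (\<exists>h. kaehler_metric X h)"


section \<open>The structure sheaf and coherent sheaves\<close>

text \<open>Functions on \<open>U\<close> are normalised to be \<^term>\<open>undefined\<close> outside \<open>U\<close>, so that the restriction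
  from \<open>U\<close> to \<open>V\<close> is \<^term>\<open>\<lambda>f. restrict f V\<close>.\<close>

definition hol :: "'x cmanifold \<Rightarrow> 'x set \<Rightarrow> ('x \<Rightarrow> complex) ring" where
  "hol X U =
     \<lparr>carrier = {f \<in> extensional U. \<forall>(W, \<phi>) \<in> atlas X. \<forall>x \<in> U \<inter> W.
                   cdifferentiable (cdim X) (\<lambda>z. f (inv_into W \<phi> z)) (\<phi> x)},
      mult = (\<lambda>f g. \<lambda>x\<in>U. f x * g x), one = (\<lambda>x\<in>U. 1),
      zero = (\<lambda>x\<in>U. 0), add = (\<lambda>f g. \<lambda>x\<in>U. f x + g x)\<rparr>"

text \<open>\<open>sect F U\<close> is the module of sections over \<open>U\<close>, \<open>rmap F U V\<close> the restriction map; only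
  open sets \<open>U\<close> and \<open>V \<subseteq> U\<close> matter.\<close>

record ('x, 's) omod =
  sect :: "'x set \<Rightarrow> ('x \<Rightarrow> complex, 's) module"
  rmap :: "'x set \<Rightarrow> 'x set \<Rightarrow> 's \<Rightarrow> 's"

definition presheaf_of_modules :: "'x cmanifold \<Rightarrow> ('x, 's) omod \<Rightarrow> bool" where
  "presheaf_of_modules X F \<longleftrightarrow>
     (\<forall>U. openin (points X) U \<longrightarrow> Module.module (hol X U) (sect F U)) \<and>
     (\<forall>U V. openin (points X) U \<and> openin (points X) V \<and> V \<subseteq> U \<longrightarrow>
        (\<forall>s \<in> carrier (sect F U). rmap F U V s \<in> carrier (sect F V)) \<and>
        (\<forall>s \<in> carrier (sect F U). \<forall>t \<in> carrier (sect F U).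
           rmap F U V (s \<oplus>\<^bsub>sect F U\<^esub> t) = rmap F U V s \<oplus>\<^bsub>sect F V\<^esub> rmap F U V t) \<and>
        (\<forall>a \<in> carrier (hol X U). \<forall>s \<in> carrier (sect F U).
           rmap F U V (a \<odot>\<^bsub>sect F U\<^esub> s) = restrict a V \<odot>\<^bsub>sect F V\<^esub> rmap F U V s)) \<and>
     (\<forall>U. openin (points X) U \<longrightarrow> (\<forall>s \<in> carrier (sect F U). rmap F U U s = s)) \<and>
     (\<forall>U V W. openin (points X) U \<and> openin (points X) V \<and> openin (points X) W \<and> W \<subseteq> V \<and> V \<subseteq> U \<longrightarrow>
        (\<forall>s \<in> carrier (sect F U). rmap F V W (rmap F U V s) = rmap F U W s))"

definition sheaf_of_modules :: "'x cmanifold \<Rightarrow> ('x, 's) omod \<Rightarrow> bool" where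
  "sheaf_of_modules X F \<longleftrightarrow> presheaf_of_modules X F \<and>
     (\<forall>\<U>. (\<forall>V\<in>\<U>. openin (points X) V) \<longrightarrow>
        (\<forall>s \<in> carrier (sect F (\<Union>\<U>)). \<forall>t \<in> carrier (sect F (\<Union>\<U>)).
           (\<forall>V\<in>\<U>. rmap F (\<Union>\<U>) V s = rmap F (\<Union>\<U>) V t) \<longrightarrow> s = t) \<and>
        (\<forall>\<sigma>. (\<forall>V\<in>\<U>. \<sigma> V \<in> carrier (sect F V)) \<and>
             (\<forall>V\<in>\<U>. \<forall>W\<in>\<U>. rmap F V (V \<inter> W) (\<sigma> V) = rmap F W (V \<inter> W) (\<sigma> W)) \<longrightarrow>
             (\<exists>s \<in> carrier (sect F (\<Union>\<U>)). \<forall>V\<in>\<U>. rmap F (\<Union>\<U>) V s = \<sigma> V)))"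

text \<open>The sections \<open>s 0, \<dots>, s (m-1)\<close> over \<open>U\<close> generate the restriction of \<open>F\<close> to \<open>U\<close>.\<close>

definition generates ::
  "'x cmanifold \<Rightarrow> ('x, 's) omod \<Rightarrow> 'x set \<Rightarrow> nat \<Rightarrow> (nat \<Rightarrow> 's) \<Rightarrow> bool" where
  "generates X F U m s \<longleftrightarrow> (\<forall>j<m. s j \<in> carrier (sect F U)) \<and>
     (\<forall>V. openin (points X) V \<and> V \<subseteq> U \<longrightarrow> (\<forall>t \<in> carrier (sect F V). \<forall>y\<in>V.
        \<exists>W a. openin (points X) W \<and> y \<in> W \<and> W \<subseteq> V \<and> (\<forall>j<m. a j \<in> carrier (hol X W)) \<and>
          rmap F V W t = (\<Oplus>\<^bsub>sect F W\<^esub> j \<in> {..<m}. a j \<odot>\<^bsub>sect F W\<^esub> rmap F U W (s j))))"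

definition finite_type :: "'x cmanifold \<Rightarrow> ('x, 's) omod \<Rightarrow> bool" where
  "finite_type X F \<longleftrightarrow> (\<forall>x \<in> topspace (points X). \<exists>U m s.
     openin (points X) U \<and> x \<in> U \<and> generates X F U m s)"

text \<open>Sections over \<open>V\<close> of the kernel of the morphism \<open>\<O>\<^sub>U\<^sup>m \<rightarrow> F\<^sub>U\<close> given by \<open>s 0, \<dots>, s (m-1)\<close>.\<close>

definition relations ::
  "'x cmanifold \<Rightarrow> ('x, 's) omod \<Rightarrow> 'x set \<Rightarrow> nat \<Rightarrow> (nat \<Rightarrow> 's) \<Rightarrow> 'x set
     \<Rightarrow> (nat \<Rightarrow> 'x \<Rightarrow> complex) set" where
  "relations X F U m s V = {a. (\<forall>j<m. a j \<in> carrier (hol X V)) \<and>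
     (\<Oplus>\<^bsub>sect F V\<^esub> j \<in> {..<m}. a j \<odot>\<^bsub>sect F V\<^esub> rmap F U V (s j)) = \<zero>\<^bsub>sect F V\<^esub>}"

definition relations_finite_type ::
  "'x cmanifold \<Rightarrow> ('x, 's) omod \<Rightarrow> 'x set \<Rightarrow> nat \<Rightarrow> (nat \<Rightarrow> 's) \<Rightarrow> bool" where
  "relations_finite_type X F U m s \<longleftrightarrow>
     (\<forall>x\<in>U. \<exists>V (k::nat) r. openin (points X) V \<and> x \<in> V \<and> V \<subseteq> U \<and>
        (\<forall>l<k. r l \<in> relations X F U m s V) \<and>
        (\<forall>W. openin (points X) W \<and> W \<subseteq> V \<longrightarrow> (\<forall>a \<in> relations X F U m s W. \<forall>y\<in>W.
           \<exists>W' b. openin (points X) W' \<and> y \<in> W' \<and> W' \<subseteq> W \<and> (\<forall>l<k. b l \<in> carrier (hol X W')) \<and>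
             (\<forall>j<m. restrict (a j) W' =
                (\<Oplus>\<^bsub>hol X W'\<^esub> l \<in> {..<k}. b l \<otimes>\<^bsub>hol X W'\<^esub> restrict (r l j) W')))))"

definition coherent_sheaf :: "'x cmanifold \<Rightarrow> ('x, 's) omod \<Rightarrow> bool" where
  "coherent_sheaf X F \<longleftrightarrow> sheaf_of_modules X F \<and> finite_type X F \<and>
     (\<forall>U m s. openin (points X) U \<and> (\<forall>j<m. s j \<in> carrier (sect F U)) \<longrightarrow>
        relations_finite_type X F U m s)"

text \<open>Morphisms are families of maps indexed by open sets.  Their values outside the carriers are
  irrelevant; hence equality of morphisms below always means equality on sections.\<close>

definition sheaf_hom ::
  "'x cmanifold \<Rightarrow> ('x, 's) omod \<Rightarrow> ('x, 's) omod \<Rightarrow> ('x set \<Rightarrow> 's \<Rightarrow> 's) \<Rightarrow> bool" where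
  "sheaf_hom X F G \<phi> \<longleftrightarrow>
     (\<forall>U. openin (points X) U \<longrightarrow>
        (\<forall>s \<in> carrier (sect F U). \<phi> U s \<in> carrier (sect G U)) \<and>
        (\<forall>s \<in> carrier (sect F U). \<forall>t \<in> carrier (sect F U).
           \<phi> U (s \<oplus>\<^bsub>sect F U\<^esub> t) = \<phi> U s \<oplus>\<^bsub>sect G U\<^esub> \<phi> U t) \<and>
        (\<forall>a \<in> carrier (hol X U). \<forall>s \<in> carrier (sect F U).
           \<phi> U (a \<odot>\<^bsub>sect F U\<^esub> s) = a \<odot>\<^bsub>sect G U\<^esub> \<phi> U s)) \<and>
     (\<forall>U V. openin (points X) U \<and> openin (points X) V \<and> V \<subseteq> U \<longrightarrow>
        (\<forall>s \<in> carrier (sect F U). rmap G U V (\<phi> U s) = \<phi> V (rmap F U V s)))"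

text \<open>
  All sheaves take their sections in one type \<open>'s\<close>, which serves as the universe.  Direct sums
  need an injection \<open>'s \<times> 's \<rightarrow> 's\<close>; one exists as soon as \<open>'s\<close> is infinite.  (If \<open>'s\<close> admits an
  injection from \<open>'x \<Rightarrow> complex\<close>, every coherent sheaf on a manifold with point type \<open>'x\<close> has an
  isomorphic copy with sections in \<open>'s\<close>: its stalks have at most the cardinality of the
  continuum, and a section is determined by its germs.)
\<close>

definition pair_code :: "'s \<times> 's \<Rightarrow> 's" where
  "pair_code = (SOME e. inj e)"

definition spair :: "'s \<Rightarrow> 's \<Rightarrow> 's" where "spair a b = pair_code (a, b)"
definition sfst :: "'s \<Rightarrow> 's" where "sfst s = fst (inv_into UNIV pair_code s)"
definition ssnd :: "'s \<Rightarrow> 's" where "ssnd s = snd (inv_into UNIV pair_code s)"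

text \<open>The fields \<open>mult\<close> and \<open>one\<close> are inherited from rings and carry no meaning for modules.\<close>

definition direct_sum :: "('x, 's) omod \<Rightarrow> ('x, 's) omod \<Rightarrow> ('x, 's) omod" where
  "direct_sum F G =
     \<lparr>sect = (\<lambda>U. \<lparr>carrier = {spair a b | a b. a \<in> carrier (sect F U) \<and> b \<in> carrier (sect G U)},
                   mult = undefined, one = undefined,
                   zero = spair \<zero>\<^bsub>sect F U\<^esub> \<zero>\<^bsub>sect G U\<^esub>,
                   add = (\<lambda>s t. spair (sfst s \<oplus>\<^bsub>sect F U\<^esub> sfst t) (ssnd s \<oplus>\<^bsub>sect G U\<^esub> ssnd t)),
                   smult = (\<lambda>a s. spair (a \<odot>\<^bsub>sect F U\<^esub> sfst s) (a \<odot>\<^bsub>sect G U\<^esub> ssnd s))\<rparr>),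
      rmap = (\<lambda>U V s. spair (rmap F U V (sfst s)) (rmap G U V (ssnd s)))\<rparr>"


section \<open>Bounded complexes of coherent sheaves\<close>

type_synonym ('x, 's) cmap = "int \<Rightarrow> 'x set \<Rightarrow> 's \<Rightarrow> 's"

record ('x, 's) cplx =
  cob :: "int \<Rightarrow> ('x, 's) omod"
  cdiff :: "('x, 's) cmap"

definition Dob :: "'x cmanifold \<Rightarrow> ('x, 's) cplx set" where
  "Dob X = {A.
     (\<forall>i. coherent_sheaf X (cob A i) \<and> sheaf_hom X (cob A i) (cob A (i + 1)) (cdiff A i)) \<and>
     (\<forall>i U. openin (points X) U \<longrightarrow> (\<forall>s \<in> carrier (sect (cob A i) U).
        cdiff A (i + 1) U (cdiff A i U s) = \<zero>\<^bsub>sect (cob A (i + 2)) U\<^esub>)) \<and>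
     (\<exists>N. \<forall>i U. N < \<bar>i\<bar> \<and> openin (points X) U \<longrightarrow>
        carrier (sect (cob A i) U) = {\<zero>\<^bsub>sect (cob A i) U\<^esub>})}"

definition chain_map ::
  "'x cmanifold \<Rightarrow> ('x, 's) cplx \<Rightarrow> ('x, 's) cplx \<Rightarrow> ('x, 's) cmap \<Rightarrow> bool" where
  "chain_map X A B f \<longleftrightarrow>
     (\<forall>i. sheaf_hom X (cob A i) (cob B i) (f i)) \<and>
     (\<forall>i U. openin (points X) U \<longrightarrow> (\<forall>s \<in> carrier (sect (cob A i) U).
        cdiff B i U (f i U s) = f (i + 1) U (cdiff A i U s)))"

definition cid :: "('x, 's) cmap" where
  "cid = (\<lambda>i U s. s)"

definition czero :: "('x, 's) cplx \<Rightarrow> ('x, 's) cmap" where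
  "czero B = (\<lambda>i U s. \<zero>\<^bsub>sect (cob B i) U\<^esub>)"

definition ccomp :: "('x, 's) cmap \<Rightarrow> ('x, 's) cmap \<Rightarrow> ('x, 's) cmap" where
  "ccomp g f = (\<lambda>i U s. g i U (f i U s))"

definition homotopic ::
  "'x cmanifold \<Rightarrow> ('x, 's) cplx \<Rightarrow> ('x, 's) cplx \<Rightarrow> ('x, 's) cmap \<Rightarrow> ('x, 's) cmap \<Rightarrow> bool" where
  "homotopic X A B f g \<longleftrightarrow>
     (\<exists>h. (\<forall>i. sheaf_hom X (cob A i) (cob B (i - 1)) (h i)) \<and>
       (\<forall>i U. openin (points X) U \<longrightarrow> (\<forall>s \<in> carrier (sect (cob A i) U).
          f i U s = g i U s \<oplus>\<^bsub>sect (cob B i) U\<^esub>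
            (cdiff B (i - 1) U (h i U s) \<oplus>\<^bsub>sect (cob B i) U\<^esub> h (i + 1) U (cdiff A i U s)))))"

text \<open>
  \<open>cohomology_stalk X A i x\<close> is the stalk at \<open>x\<close> of the \<open>i\<close>-th cohomology sheaf, i.e. the colimit
  of \<open>ker d\<^sup>i / im d\<^sup>i\<^sup>-\<^sup>1\<close> over the open neighbourhoods of \<open>x\<close>, consisting of classes of
  cocycles \<open>(U, s)\<close>.
\<close>

definition cocycles_at :: "'x cmanifold \<Rightarrow> ('x, 's) cplx \<Rightarrow> int \<Rightarrow> 'x \<Rightarrow> ('x set \<times> 's) set" where
  "cocycles_at X A i x = {(U, s). openin (points X) U \<and> x \<in> U \<and> s \<in> carrier (sect (cob A i) U) \<and>
     cdiff A i U s = \<zero>\<^bsub>sect (cob A (i + 1)) U\<^esub>}"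

definition cohomologous_at ::
  "'x cmanifold \<Rightarrow> ('x, 's) cplx \<Rightarrow> int \<Rightarrow> 'x \<Rightarrow> (('x set \<times> 's) \<times> ('x set \<times> 's)) set" where
  "cohomologous_at X A i x = {((U, s), (V, t)).
     (U, s) \<in> cocycles_at X A i x \<and> (V, t) \<in> cocycles_at X A i x \<and>
     (\<exists>W r. openin (points X) W \<and> x \<in> W \<and> W \<subseteq> U \<inter> V \<and> r \<in> carrier (sect (cob A (i - 1)) W) \<and>
        rmap (cob A i) U W s \<ominus>\<^bsub>sect (cob A i) W\<^esub> rmap (cob A i) V W t = cdiff A (i - 1) W r)}"

definition cohomology_stalk :: "'x cmanifold \<Rightarrow> ('x, 's) cplx \<Rightarrow> int \<Rightarrow> 'x \<Rightarrow> ('x set \<times> 's) set set" where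
  "cohomology_stalk X A i x = cocycles_at X A i x // cohomologous_at X A i x"

definition cohomology_map ::
  "'x cmanifold \<Rightarrow> ('x, 's) cplx \<Rightarrow> ('x, 's) cmap \<Rightarrow> int \<Rightarrow> 'x
     \<Rightarrow> ('x set \<times> 's) set \<Rightarrow> ('x set \<times> 's) set" where
  "cohomology_map X B f i x c = cohomologous_at X B i x `` {(U, f i U s) | U s. (U, s) \<in> c}"

definition quasi_iso ::
  "'x cmanifold \<Rightarrow> ('x, 's) cplx \<Rightarrow> ('x, 's) cplx \<Rightarrow> ('x, 's) cmap \<Rightarrow> bool" where
  "quasi_iso X A B f \<longleftrightarrow> chain_map X A B f \<and>
     (\<forall>i. \<forall>x \<in> topspace (points X).
        bij_betw (cohomology_map X B f i x) (cohomology_stalk X A i x) (cohomology_stalk X B i x))"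

text \<open>\<open>shift n A\<close> is \<open>A[n]\<close>, with differential multiplied by \<open>(-1)\<^sup>n\<close>.\<close>

definition shift :: "int \<Rightarrow> ('x, 's) cplx \<Rightarrow> ('x, 's) cplx" where
  "shift n A =
     \<lparr>cob = (\<lambda>i. cob A (i + n)),
      cdiff = (\<lambda>i U s. if even n then cdiff A (i + n) U s
                       else \<ominus>\<^bsub>sect (cob A (i + n + 1)) U\<^esub> cdiff A (i + n) U s)\<rparr>"

definition shift_map :: "int \<Rightarrow> ('x, 's) cmap \<Rightarrow> ('x, 's) cmap" where
  "shift_map n f = (\<lambda>i. f (i + n))"

text \<open>The mapping cone \<open>A[1] \<oplus> B\<close> of \<open>f : A \<rightarrow> B\<close>, with \<open>d(a, b) = (-da, f a + db)\<close>, the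
  inclusion of \<open>B\<close> and the projection to \<open>A[1]\<close>.\<close>

definition cone :: "('x, 's) cplx \<Rightarrow> ('x, 's) cplx \<Rightarrow> ('x, 's) cmap \<Rightarrow> ('x, 's) cplx" where
  "cone A B f =
     \<lparr>cob = (\<lambda>i. direct_sum (cob A (i + 1)) (cob B i)),
      cdiff = (\<lambda>i U s. spair (\<ominus>\<^bsub>sect (cob A (i + 2)) U\<^esub> cdiff A (i + 1) U (sfst s))
                             (f (i + 1) U (sfst s) \<oplus>\<^bsub>sect (cob B (i + 1)) U\<^esub> cdiff B i U (ssnd s)))\<rparr>"

definition cone_incl :: "('x, 's) cplx \<Rightarrow> ('x, 's) cmap" where
  "cone_incl A = (\<lambda>i U b. spair \<zero>\<^bsub>sect (cob A (i + 1)) U\<^esub> b)"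

definition cone_proj :: "('x, 's) cmap" where
  "cone_proj = (\<lambda>i U s. sfst s)"


section \<open>The bounded derived category\<close>

text \<open>
  A morphism \<open>A \<rightarrow> B\<close> of \<open>D(X)\<close> is a class of roofs \<open>A \<leftarrow> Z \<rightarrow> B\<close>, given as \<open>(Z, s, f)\<close> with \<open>s\<close> a
  quasi-isomorphism; two roofs are equivalent if a third one dominates both up to homotopy.
  A roof does not record its source and target, so these are passed explicitly.
\<close>

type_synonym ('x, 's) roof = "('x, 's) cplx \<times> ('x, 's) cmap \<times> ('x, 's) cmap"

definition roofs :: "'x cmanifold \<Rightarrow> ('x, 's) cplx \<Rightarrow> ('x, 's) cplx \<Rightarrow> ('x, 's) roof set" where
  "roofs X A B = {(Z, s, f). Z \<in> Dob X \<and> quasi_iso X Z A s \<and> chain_map X Z B f}"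

definition roof_equiv ::
  "'x cmanifold \<Rightarrow> ('x, 's) cplx \<Rightarrow> ('x, 's) cplx \<Rightarrow> (('x, 's) roof \<times> ('x, 's) roof) set" where
  "roof_equiv X A B = {((Z, s, f), (Z', s', f')).
     (Z, s, f) \<in> roofs X A B \<and> (Z', s', f') \<in> roofs X A B \<and>
     (\<exists>Y a b. Y \<in> Dob X \<and> chain_map X Y Z a \<and> chain_map X Y Z' b \<and>
        quasi_iso X Y A (ccomp s a) \<and>
        homotopic X Y A (ccomp s a) (ccomp s' b) \<and>
        homotopic X Y B (ccomp f a) (ccomp f' b))}"

definition DHom :: "'x cmanifold \<Rightarrow> ('x, 's) cplx \<Rightarrow> ('x, 's) cplx \<Rightarrow> ('x, 's) roof set set" where
  "DHom X A B = roofs X A B // roof_equiv X A B"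

text \<open>The image in \<open>D(X)\<close> of a chain map.\<close>

definition Dloc ::
  "'x cmanifold \<Rightarrow> ('x, 's) cplx \<Rightarrow> ('x, 's) cplx \<Rightarrow> ('x, 's) cmap \<Rightarrow> ('x, 's) roof set" where
  "Dloc X A B f = roof_equiv X A B `` {(A, cid, f)}"

definition Did :: "'x cmanifold \<Rightarrow> ('x, 's) cplx \<Rightarrow> ('x, 's) roof set" where
  "Did X A = Dloc X A A cid"

definition Dzero :: "'x cmanifold \<Rightarrow> ('x, 's) cplx \<Rightarrow> ('x, 's) cplx \<Rightarrow> ('x, 's) roof set" where
  "Dzero X A B = Dloc X A B (czero B)"

text \<open>\<open>Dcomp X A B C \<psi> \<phi>\<close> is the composite of \<open>\<phi> : A \<rightarrow> B\<close> and \<open>\<psi> : B \<rightarrow> C\<close>: the class of the roofs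
  obtained by completing representatives to a homotopy commutative square \<open>f a \<simeq> t b\<close> over \<open>B\<close>
  with \<open>a\<close> a quasi-isomorphism.\<close>

definition Dcomp ::
  "'x cmanifold \<Rightarrow> ('x, 's) cplx \<Rightarrow> ('x, 's) cplx \<Rightarrow> ('x, 's) cplx
     \<Rightarrow> ('x, 's) roof set \<Rightarrow> ('x, 's) roof set \<Rightarrow> ('x, 's) roof set" where
  "Dcomp X A B C \<psi> \<phi> = {R. \<exists>Z s f W t g Y a b.
     (Z, s, f) \<in> \<phi> \<and> (W, t, g) \<in> \<psi> \<and> Y \<in> Dob X \<and>
     quasi_iso X Y Z a \<and> chain_map X Y W b \<and> homotopic X Y B (ccomp f a) (ccomp t b) \<and>
     ((Y, ccomp s a, ccomp g b), R) \<in> roof_equiv X A C}"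

text \<open>The shift functor on morphisms: \<open>Dshift X n A B \<phi>\<close> is \<open>\<phi>[n] : A[n] \<rightarrow> B[n]\<close>.\<close>

definition Dshift ::
  "'x cmanifold \<Rightarrow> int \<Rightarrow> ('x, 's) cplx \<Rightarrow> ('x, 's) cplx \<Rightarrow> ('x, 's) roof set \<Rightarrow> ('x, 's) roof set" where
  "Dshift X n A B \<phi> = {R. \<exists>Z s f. (Z, s, f) \<in> \<phi> \<and>
     ((shift n Z, shift_map n s, shift_map n f), R) \<in> roof_equiv X (shift n A) (shift n B)}"

definition Diso :: "'x cmanifold \<Rightarrow> ('x, 's) cplx \<Rightarrow> ('x, 's) cplx \<Rightarrow> ('x, 's) roof set \<Rightarrow> bool" where
  "Diso X A B \<phi> \<longleftrightarrow> \<phi> \<in> DHom X A B \<and>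
     (\<exists>\<psi> \<in> DHom X B A. Dcomp X A B A \<psi> \<phi> = Did X A \<and> Dcomp X B A B \<phi> \<psi> = Did X B)"

text \<open>A triangle is distinguished if it is isomorphic in \<open>D(X)\<close> to a mapping cone triangle.\<close>

definition distinguished ::
  "'x cmanifold \<Rightarrow> ('x, 's) cplx \<Rightarrow> ('x, 's) cplx \<Rightarrow> ('x, 's) cplx
     \<Rightarrow> ('x, 's) roof set \<Rightarrow> ('x, 's) roof set \<Rightarrow> ('x, 's) roof set \<Rightarrow> bool" where
  "distinguished X B C D u v w \<longleftrightarrow>
     B \<in> Dob X \<and> C \<in> Dob X \<and> D \<in> Dob X \<and>
     u \<in> DHom X B C \<and> v \<in> DHom X C D \<and> w \<in> DHom X D (shift 1 B) \<and>
     (\<exists>A A' f \<alpha> \<beta> \<gamma>. A \<in> Dob X \<and> A' \<in> Dob X \<and> chain_map X A A' f \<and>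
        Diso X B A \<alpha> \<and> Diso X C A' \<beta> \<and> Diso X D (cone A A' f) \<gamma> \<and>
        Dcomp X B C A' \<beta> u = Dcomp X B A A' (Dloc X A A' f) \<alpha> \<and>
        Dcomp X C D (cone A A' f) \<gamma> v =
          Dcomp X C A' (cone A A' f) (Dloc X A' (cone A A' f) (cone_incl A)) \<beta> \<and>
        Dcomp X D (shift 1 B) (shift 1 A) (Dshift X 1 B A \<alpha>) w =
          Dcomp X D (cone A A' f) (shift 1 A) (Dloc X (cone A A' f) (shift 1 A) cone_proj) \<gamma>)"

definition Ext :: "'x cmanifold \<Rightarrow> int \<Rightarrow> ('x, 's) cplx \<Rightarrow> ('x, 's) cplx \<Rightarrow> ('x, 's) roof set set" where
  "Ext X k F G = DHom X F (shift k G)"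

definition Ext_zero :: "'x cmanifold \<Rightarrow> int \<Rightarrow> ('x, 's) cplx \<Rightarrow> ('x, 's) cplx \<Rightarrow> ('x, 's) roof set" where
  "Ext_zero X k F G = Dzero X F (shift k G)"

text \<open>\<open>Ext\<^sup>p(F, B) \<rightarrow> Ext\<^sup>p(F, C)\<close> for \<open>v : B \<rightarrow> C\<close>, and \<open>Ext\<^sup>p(C, G) \<rightarrow> Ext\<^sup>p(B, G)\<close> for \<open>u : B \<rightarrow> C\<close>.\<close>

definition Ext_push ::
  "'x cmanifold \<Rightarrow> int \<Rightarrow> ('x, 's) cplx \<Rightarrow> ('x, 's) cplx \<Rightarrow> ('x, 's) cplx
     \<Rightarrow> ('x, 's) roof set \<Rightarrow> ('x, 's) roof set \<Rightarrow> ('x, 's) roof set" where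
  "Ext_push X p F B C v \<tau> = Dcomp X F (shift p B) (shift p C) (Dshift X p B C v) \<tau>"

definition Ext_pull ::
  "'x cmanifold \<Rightarrow> int \<Rightarrow> ('x, 's) cplx \<Rightarrow> ('x, 's) cplx \<Rightarrow> ('x, 's) cplx
     \<Rightarrow> ('x, 's) roof set \<Rightarrow> ('x, 's) roof set \<Rightarrow> ('x, 's) roof set" where
  "Ext_pull X p B C G u \<rho> = Dcomp X B C (shift p G) \<rho> u"

text \<open>
  The connecting homomorphisms induced by \<open>w : D \<rightarrow> B[1]\<close>: \<open>\<tau> \<mapsto> w[p] \<circ> \<tau>\<close> and \<open>\<rho> \<mapsto> \<rho>[1] \<circ> w\<close>.
  Up to irrelevant values outside the sections, \<open>B[1][p]\<close> and \<open>G[p][1]\<close> are \<open>B[p+1]\<close> and \<open>G[p+1]\<close>,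
  so the corresponding sets of morphisms coincide.
\<close>

definition Ext_connecting_covariant ::
  "'x cmanifold \<Rightarrow> int \<Rightarrow> ('x, 's) cplx \<Rightarrow> ('x, 's) cplx \<Rightarrow> ('x, 's) cplx
     \<Rightarrow> ('x, 's) roof set \<Rightarrow> ('x, 's) roof set \<Rightarrow> ('x, 's) roof set" where
  "Ext_connecting_covariant X p F D B w \<tau> =
     Dcomp X F (shift p D) (shift (p + 1) B) (Dshift X p D (shift 1 B) w) \<tau>"

definition Ext_connecting_contravariant ::
  "'x cmanifold \<Rightarrow> int \<Rightarrow> ('x, 's) cplx \<Rightarrow> ('x, 's) cplx \<Rightarrow> ('x, 's) cplx
     \<Rightarrow> ('x, 's) roof set \<Rightarrow> ('x, 's) roof set \<Rightarrow> ('x, 's) roof set" where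
  "Ext_connecting_contravariant X p D B G w \<rho> =
     Dcomp X D (shift 1 B) (shift (p + 1) G) (Dshift X 1 B (shift p G) \<rho>) w"

end

theory Submission
  imports Defs
begin

text \<open>
  Morphisms of \<open>D(X)\<close> are left roofs, and both statements are first proved on roofs for the triangle of
  a mapping cone of \<open>f : A \<rightarrow> A'\<close>; isomorphisms in \<open>D(X)\<close> then transport them to any distinguished
  triangle.

  A roof into the cone whose projection to \<open>A[1]\<close> vanishes has, after refining its denominator, a
  null-homotopic projection; subtracting the null-homotopy makes it factor through \<open>A'\<close>.

  For the second statement let \<open>\<rho> = g s\<inverse>\<close> with \<open>s : Z \<rightarrow> A\<close>.  Replacing the cone of \<open>f\<close> by the
  quasi-isomorphic cone \<open>E\<close> of \<open>f s\<close>, the vanishing of \<open>\<rho>[1] \<circ> w\<close> gives a quasi-isomorphism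
  \<open>a = (a\<^sub>1, a\<^sub>2) : Y \<rightarrow> E\<close> and a null-homotopy \<open>h\<close> of \<open>g a\<^sub>1\<close>.  On \<open>W = Y \<oplus> Z\<close> with differential
  \<open>(y, z) \<mapsto> (dy, a\<^sub>1 y + dz)\<close> the map \<open>(y, z) \<mapsto> a\<^sub>2 y - f s z\<close> is a quasi-isomorphism to \<open>A'\<close>, and
  \<open>(y, z) \<mapsto> h y - g z\<close> represents the extension of \<open>\<rho>\<close>.

  The calculus of fractions needs direct sums of coherent sheaves to be coherent, and a handy test for
  quasi-isomorphisms, namely exactness of the mapping cone on stalks.
\<close>

section \<open>Abelian groups and modules\<close>

text \<open>Nothing is drawn from a general theory of triangulated categories: only the two
  exactness statements in question are proved, each at a single term. Two obstacles shape the work.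
  Quasi-isomorphy is a condition on stalks, so a primitive of a cocycle exists only near a point;
  sections are chased through shrinking neighbourhoods, and global maps come from building new
  complexes rather than from choosing primitives. And left roofs are asymmetric: composing with a
  chain map at the target changes the numerator alone, so a lift requires no more than a refinement
  of the given denominator, whereas an extension along f requires a denominator with target A',
  which is not given at all.

  The complex W supplies it. Its origin is the rotated triangle: up to quasi-isomorphism, A' is the
  homotopy fibre of the projection from the cone of f to A[1]. With Y in place of the cone and Z in
  place of A, this fibre is the twisted sum of Y and Z along \<open>a\<^sub>1\<close>, which is W.
  The null-homotopy h is exactly the datum that extends -g from Z to W.\<close>

definition addhom where
  "addhom M N h \<longleftrightarrow> abelian_group M \<and> abelian_group N \<and>
     (\<forall>x\<in>carrier M. h x \<in> carrier N) \<and>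
     (\<forall>x\<in>carrier M. \<forall>y\<in>carrier M. h (x \<oplus>\<^bsub>M\<^esub> y) = h x \<oplus>\<^bsub>N\<^esub> h y)"

context
  fixes M :: "('a, 'm) ring_scheme" and N :: "('b, 'n) ring_scheme" and h
  assumes h: "addhom M N h"
begin

interpretation M: abelian_group M using h by (simp add: addhom_def)
interpretation N: abelian_group N using h by (simp add: addhom_def)

lemma addhom_closed: "x \<in> carrier M \<Longrightarrow> h x \<in> carrier N"
  using h by (simp add: addhom_def)

lemma addhom_add: "x \<in> carrier M \<Longrightarrow> y \<in> carrier M \<Longrightarrow> h (x \<oplus>\<^bsub>M\<^esub> y) = h x \<oplus>\<^bsub>N\<^esub> h y"
  using h by (simp add: addhom_def)

lemma addhom_zero: "h \<zero>\<^bsub>M\<^esub> = \<zero>\<^bsub>N\<^esub>"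
proof -
  have "h \<zero>\<^bsub>M\<^esub> \<oplus>\<^bsub>N\<^esub> h \<zero>\<^bsub>M\<^esub> = h \<zero>\<^bsub>M\<^esub>"
    using addhom_add[of "\<zero>\<^bsub>M\<^esub>" "\<zero>\<^bsub>M\<^esub>"] by simp
  then show ?thesis using addhom_closed[OF M.zero_closed] by simp
qed

lemma addhom_neg: "x \<in> carrier M \<Longrightarrow> h (\<ominus>\<^bsub>M\<^esub> x) = \<ominus>\<^bsub>N\<^esub> h x"
proof -
  assume x: "x \<in> carrier M"
  have "h (\<ominus>\<^bsub>M\<^esub> x) \<oplus>\<^bsub>N\<^esub> h x = \<zero>\<^bsub>N\<^esub>"
    using addhom_add[of "\<ominus>\<^bsub>M\<^esub> x" x] x by (simp add: M.l_neg addhom_zero)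
  then show ?thesis using N.minus_equality addhom_closed x by (metis M.a_inv_closed)
qed

lemma addhom_finsum:
  "(\<And>j. j < (m::nat) \<Longrightarrow> f j \<in> carrier M) \<Longrightarrow>
     h (\<Oplus>\<^bsub>M\<^esub>j\<in>{..<m}. f j) = (\<Oplus>\<^bsub>N\<^esub>j\<in>{..<m}. h (f j))"
proof (induction m)
  case 0
  then show ?case by (simp add: addhom_zero)
next
  case (Suc m)
  have *: "f \<in> {..<m} \<rightarrow> carrier M" "f m \<in> carrier M" using Suc.prems by auto
  then have "(\<lambda>j. h (f j)) \<in> {..<m} \<rightarrow> carrier N" "h (f m) \<in> carrier N"
    by (auto intro: addhom_closed)
  with * Suc show ?case
    by (simp add: lessThan_Suc M.finsum_insert N.finsum_insert M.finsum_closed addhom_add)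
qed

end

lemma (in abelian_group) finsum_swap:
  assumes "\<And>i j. i < (m::nat) \<Longrightarrow> j < (k::nat) \<Longrightarrow> f i j \<in> carrier G"
  shows "(\<Oplus>i\<in>{..<m}. \<Oplus>j\<in>{..<k}. f i j) = (\<Oplus>j\<in>{..<k}. \<Oplus>i\<in>{..<m}. f i j)"
  using assms
proof (induction m)
  case 0
  then show ?case by (simp add: add.finprod_one_eqI)
next
  case (Suc m)
  have 1: "(\<lambda>i. \<Oplus>j\<in>{..<k}. f i j) \<in> {..<m} \<rightarrow> carrier G" "(\<Oplus>j\<in>{..<k}. f m j) \<in> carrier G"
    using Suc.prems by (auto intro!: finsum_closed)
  have 2: "(\<lambda>j. \<Oplus>i\<in>{..<m}. f i j) \<in> {..<k} \<rightarrow> carrier G" "(\<lambda>j. f m j) \<in> {..<k} \<rightarrow> carrier G"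
    using Suc.prems by (auto intro!: finsum_closed)
  have 3: "(\<Oplus>i\<in>{..<Suc m}. f i j) = f m j \<oplus> (\<Oplus>i\<in>{..<m}. f i j)" if "j < k" for j
    using Suc.prems that by (subst lessThan_Suc, subst finsum_insert) auto
  have "(\<Oplus>j\<in>{..<k}. \<Oplus>i\<in>{..<Suc m}. f i j) = (\<Oplus>j\<in>{..<k}. f m j \<oplus> (\<Oplus>i\<in>{..<m}. f i j))"
    by (rule finsum_cong') (use 2 in \<open>auto simp: 3 Pi_def\<close>)
  also have "\<dots> = (\<Oplus>j\<in>{..<k}. f m j) \<oplus> (\<Oplus>j\<in>{..<k}. \<Oplus>i\<in>{..<m}. f i j)"
    by (rule finsum_addf) (use 2 in auto)
  finally show ?case using 1 Suc by (simp add: lessThan_Suc finsum_insert)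
qed

text \<open>In the term order used by ordered rewriting \<open>x\<close> always precedes \<open>\<ominus> x\<close>, but other
  summands may come between the two; hence one cancellation rule per distance.\<close>

context abelian_group
begin

lemma cancel_apart:
  "\<lbrakk>x \<in> carrier G; a \<in> carrier G\<rbrakk> \<Longrightarrow> x \<oplus> (a \<oplus> \<ominus> x) = a"
  "\<lbrakk>x \<in> carrier G; a \<in> carrier G; y \<in> carrier G\<rbrakk> \<Longrightarrow> x \<oplus> (a \<oplus> (\<ominus> x \<oplus> y)) = a \<oplus> y"
  "\<lbrakk>x \<in> carrier G; a \<in> carrier G; b \<in> carrier G\<rbrakk> \<Longrightarrow> x \<oplus> (a \<oplus> (b \<oplus> \<ominus> x)) = a \<oplus> b"
  "\<lbrakk>x \<in> carrier G; a \<in> carrier G; b \<in> carrier G; y \<in> carrier G\<rbrakk> \<Longrightarrow> x \<oplus> (a \<oplus> (b \<oplus> (\<ominus> x \<oplus> y))) = a \<oplus> (b \<oplus> y)"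
  "\<lbrakk>x \<in> carrier G; a \<in> carrier G; b \<in> carrier G; c \<in> carrier G\<rbrakk> \<Longrightarrow> x \<oplus> (a \<oplus> (b \<oplus> (c \<oplus> \<ominus> x))) = a \<oplus> (b \<oplus> c)"
  "\<lbrakk>x \<in> carrier G; a \<in> carrier G; b \<in> carrier G; c \<in> carrier G; y \<in> carrier G\<rbrakk> \<Longrightarrow> x \<oplus> (a \<oplus> (b \<oplus> (c \<oplus> (\<ominus> x \<oplus> y)))) = a \<oplus> (b \<oplus> (c \<oplus> y))"
  "\<lbrakk>x \<in> carrier G; a \<in> carrier G; b \<in> carrier G; c \<in> carrier G; d \<in> carrier G\<rbrakk> \<Longrightarrow> x \<oplus> (a \<oplus> (b \<oplus> (c \<oplus> (d \<oplus> \<ominus> x)))) = a \<oplus> (b \<oplus> (c \<oplus> d))"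
  "\<lbrakk>x \<in> carrier G; a \<in> carrier G; b \<in> carrier G; c \<in> carrier G; d \<in> carrier G; y \<in> carrier G\<rbrakk> \<Longrightarrow> x \<oplus> (a \<oplus> (b \<oplus> (c \<oplus> (d \<oplus> (\<ominus> x \<oplus> y))))) = a \<oplus> (b \<oplus> (c \<oplus> (d \<oplus> y)))"
proof -
  have *: "x \<oplus> (z \<oplus> \<ominus> x) = z" if "x \<in> carrier G" "z \<in> carrier G" for x z
    using that by (metis a_comm a_inv_closed add.m_closed r_neg1 r_neg2)
  show "\<lbrakk>x \<in> carrier G; a \<in> carrier G\<rbrakk> \<Longrightarrow> x \<oplus> (a \<oplus> \<ominus> x) = a"
    by (rule *)
  show "\<lbrakk>x \<in> carrier G; a \<in> carrier G; y \<in> carrier G\<rbrakk> \<Longrightarrow> x \<oplus> (a \<oplus> (\<ominus> x \<oplus> y)) = a \<oplus> y"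
    using *[of x "a \<oplus> y"] by (simp add: a_ac)
  show "\<lbrakk>x \<in> carrier G; a \<in> carrier G; b \<in> carrier G\<rbrakk> \<Longrightarrow> x \<oplus> (a \<oplus> (b \<oplus> \<ominus> x)) = a \<oplus> b"
    using *[of x "a \<oplus> b"] by (simp add: a_ac)
  show "\<lbrakk>x \<in> carrier G; a \<in> carrier G; b \<in> carrier G; y \<in> carrier G\<rbrakk> \<Longrightarrow> x \<oplus> (a \<oplus> (b \<oplus> (\<ominus> x \<oplus> y))) = a \<oplus> (b \<oplus> y)"
    using *[of x "a \<oplus> (b \<oplus> y)"] by (simp add: a_ac)
  show "\<lbrakk>x \<in> carrier G; a \<in> carrier G; b \<in> carrier G; c \<in> carrier G\<rbrakk> \<Longrightarrow> x \<oplus> (a \<oplus> (b \<oplus> (c \<oplus> \<ominus> x))) = a \<oplus> (b \<oplus> c)"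
    using *[of x "a \<oplus> (b \<oplus> c)"] by (simp add: a_ac)
  show "\<lbrakk>x \<in> carrier G; a \<in> carrier G; b \<in> carrier G; c \<in> carrier G; y \<in> carrier G\<rbrakk> \<Longrightarrow> x \<oplus> (a \<oplus> (b \<oplus> (c \<oplus> (\<ominus> x \<oplus> y)))) = a \<oplus> (b \<oplus> (c \<oplus> y))"
    using *[of x "a \<oplus> (b \<oplus> (c \<oplus> y))"] by (simp add: a_ac)
  show "\<lbrakk>x \<in> carrier G; a \<in> carrier G; b \<in> carrier G; c \<in> carrier G; d \<in> carrier G\<rbrakk> \<Longrightarrow> x \<oplus> (a \<oplus> (b \<oplus> (c \<oplus> (d \<oplus> \<ominus> x)))) = a \<oplus> (b \<oplus> (c \<oplus> d))"
    using *[of x "a \<oplus> (b \<oplus> (c \<oplus> d))"] by (simp add: a_ac)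
  show "\<lbrakk>x \<in> carrier G; a \<in> carrier G; b \<in> carrier G; c \<in> carrier G; d \<in> carrier G; y \<in> carrier G\<rbrakk> \<Longrightarrow> x \<oplus> (a \<oplus> (b \<oplus> (c \<oplus> (d \<oplus> (\<ominus> x \<oplus> y))))) = a \<oplus> (b \<oplus> (c \<oplus> (d \<oplus> y)))"
    using *[of x "a \<oplus> (b \<oplus> (c \<oplus> (d \<oplus> y)))"] by (simp add: a_ac)
qed

lemmas group_normalize = a_minus_def a_ac minus_add r_neg r_neg1 r_neg2 cancel_apart

end

text \<open>Associativity of the product of a row \<open>b\<close>, a matrix \<open>r\<close> and a
  column \<open>x\<close> of module elements. It lets a combination of relations, applied to
  generators, be read as a combination of the values of those relations.\<close>

lemma (in module) finsum_smult_swap: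
  assumes "\<And>l. l < (k::nat) \<Longrightarrow> b l \<in> carrier R"
    and "\<And>l j. l < k \<Longrightarrow> j < (m::nat) \<Longrightarrow> r l j \<in> carrier R"
    and "\<And>j. j < m \<Longrightarrow> x j \<in> carrier M"
  shows "(\<Oplus>\<^bsub>M\<^esub>j\<in>{..<m}. (\<Oplus>\<^bsub>R\<^esub>l\<in>{..<k}. b l \<otimes>\<^bsub>R\<^esub> r l j) \<odot>\<^bsub>M\<^esub> x j)
    = (\<Oplus>\<^bsub>M\<^esub>l\<in>{..<k}. b l \<odot>\<^bsub>M\<^esub> (\<Oplus>\<^bsub>M\<^esub>j\<in>{..<m}. r l j \<odot>\<^bsub>M\<^esub> x j))"
proof -
  have ah: "addhom R M (\<lambda>a. a \<odot>\<^bsub>M\<^esub> y)" if "y \<in> carrier M" for y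
    using that by (auto simp: addhom_def smult_l_distr R.abelian_group_axioms M.abelian_group_axioms)
  have ah2: "addhom M M (\<lambda>y. a \<odot>\<^bsub>M\<^esub> y)" if "a \<in> carrier R" for a
    using that by (auto simp: addhom_def smult_r_distr M.abelian_group_axioms)
  have "(\<Oplus>\<^bsub>M\<^esub>j\<in>{..<m}. (\<Oplus>\<^bsub>R\<^esub>l\<in>{..<k}. b l \<otimes>\<^bsub>R\<^esub> r l j) \<odot>\<^bsub>M\<^esub> x j) =
      (\<Oplus>\<^bsub>M\<^esub>j\<in>{..<m}. \<Oplus>\<^bsub>M\<^esub>l\<in>{..<k}. b l \<odot>\<^bsub>M\<^esub> (r l j \<odot>\<^bsub>M\<^esub> x j))"
  proof (rule M.finsum_cong')
    fix j assume "j \<in> {..<m}"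
    then show "(\<Oplus>\<^bsub>R\<^esub>l\<in>{..<k}. b l \<otimes>\<^bsub>R\<^esub> r l j) \<odot>\<^bsub>M\<^esub> x j = (\<Oplus>\<^bsub>M\<^esub>l\<in>{..<k}. b l \<odot>\<^bsub>M\<^esub> (r l j \<odot>\<^bsub>M\<^esub> x j))"
      using assms by (subst addhom_finsum[OF ah]) (auto intro!: M.finsum_cong' simp: smult_assoc1)
  qed (use assms in \<open>auto intro!: M.finsum_closed\<close>)
  also have "\<dots> = (\<Oplus>\<^bsub>M\<^esub>l\<in>{..<k}. \<Oplus>\<^bsub>M\<^esub>j\<in>{..<m}. b l \<odot>\<^bsub>M\<^esub> (r l j \<odot>\<^bsub>M\<^esub> x j))"
    using assms by (intro M.finsum_swap) auto
  also have "\<dots> = (\<Oplus>\<^bsub>M\<^esub>l\<in>{..<k}. b l \<odot>\<^bsub>M\<^esub> (\<Oplus>\<^bsub>M\<^esub>j\<in>{..<m}. r l j \<odot>\<^bsub>M\<^esub> x j))"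
    using assms by (intro M.finsum_cong') (auto intro!: M.finsum_closed simp: addhom_finsum[OF ah2])
  finally show ?thesis .
qed

text \<open>An infinite type is equinumerous with its square, so an injection exists and the choice
  operator in \<open>pair_code\<close> returns one.\<close>

lemma infinite_imp_inj_pair_code:
  assumes "infinite (UNIV :: 's set)"
  shows "inj (pair_code :: 's \<times> 's \<Rightarrow> 's)"
proof -
  obtain e :: "'s \<times> 's \<Rightarrow> 's" where "bij_betw e UNIV UNIV"
    using card_of_Times_same_infinite[OF assms] unfolding card_of_ordIso[symmetric]
    by (metis UNIV_Times_UNIV)
  then have "inj e" by (simp add: bij_betw_def)
  then show ?thesis unfolding pair_code_def by (rule someI[of inj])
qed

text \<open>The parameter \<open>pc\<close> only serves to make the type of sections a parameter of the locale.\<close>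

locale coherent_sheaves =
  fixes X :: "'x cmanifold" and pc :: "'s \<times> 's \<Rightarrow> 's"
  assumes manifold: "complex_manifold X" and pc: "pair_code = pc" "inj pc"
begin

abbreviation "opn \<equiv> openin (points X)"
abbreviation psh :: "('x, 's) omod \<Rightarrow> bool" where "psh \<equiv> presheaf_of_modules X"
abbreviation coh :: "('x, 's) omod \<Rightarrow> bool" where "coh \<equiv> coherent_sheaf X"

section \<open>Holomorphic functions\<close>

text \<open>Differentiability is local, but the restricted function is \<open>undefined\<close> off
  \<open>V\<close>, so the two difference quotients agree only near \<open>\<phi> x\<close>. A chart
  is a homeomorphism onto an open subset of \<open>cspace\<close>; hence the image of
  \<open>W \<inter> V\<close> is a neighbourhood there and the limit carries over.\<close>

lemma hol_restrict:
  assumes U: "opn U" and V: "opn V" "V \<subseteq> U" and f: "f \<in> carrier (hol X U)"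
  shows "restrict f V \<in> carrier (hol X V)"
proof -
  have "cdifferentiable (cdim X) (\<lambda>z. restrict f V (inv_into W \<phi> z)) (\<phi> x)"
    if W: "(W, \<phi>) \<in> atlas X" and x: "x \<in> V" "x \<in> W" for W \<phi> x
  proof -
    have o: "opn W" "openin (top_of_set (cspace (cdim X))) (\<phi> ` W)"
      "homeomorphic_map (subtopology (points X) W) (top_of_set (\<phi> ` W)) \<phi>"
      using manifold W unfolding complex_manifold_def by blast+
    have sub: "W \<subseteq> topspace (points X)" using o(1) openin_subset by blast
    have inj: "inj_on \<phi> W"
      using o(3) sub by (auto simp: homeomorphic_map_def quotient_map_def Int_absorb1)
    have "openin (subtopology (points X) W) (W \<inter> V)"
      using V(1) by (auto simp: openin_subtopology_Int2)
    then have "openin (top_of_set (\<phi> ` W)) (\<phi> ` (W \<inter> V))"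
      using o(3) homeomorphic_imp_open_map open_map_def by blast
    then have "openin (top_of_set (cspace (cdim X))) (\<phi> ` (W \<inter> V))"
      using o(2) openin_trans by blast
    then obtain T where T: "open T" "\<phi> ` (W \<inter> V) = cspace (cdim X) \<inter> T"
      by (auto simp: openin_open)
    have eq: "restrict f V (inv_into W \<phi> z) = f (inv_into W \<phi> z)" if "z \<in> cspace (cdim X)" "z \<in> T" for z
    proof -
      have "z \<in> \<phi> ` (W \<inter> V)" using T that by blast
      then have "inv_into W \<phi> z \<in> V" using inj by (auto simp: inv_into_f_f)
      then show ?thesis by simp
    qed
    have xT: "\<phi> x \<in> T" "\<phi> x \<in> cspace (cdim X)" using T x by blast+
    have "cdifferentiable (cdim X) (\<lambda>z. f (inv_into W \<phi> z)) (\<phi> x)"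
      using f W x V(2) unfolding hol_def by fastforce
    then obtain a where lim:
      "((\<lambda>w. (f (inv_into W \<phi> w) - f (inv_into W \<phi> (\<phi> x)) - (\<Sum>i<cdim X. a i * (w i - \<phi> x i))) /
         of_real (cnorm (cdim X) (\<lambda>i. w i - \<phi> x i))) \<longlongrightarrow> 0) (at (\<phi> x) within cspace (cdim X))"
      unfolding cdifferentiable_def by blast
    have "eventually (\<lambda>w. w \<in> T \<and> w \<in> cspace (cdim X)) (at (\<phi> x) within cspace (cdim X))"
      using T(1) xT by (auto simp: eventually_at_topological)
    then have
      "((\<lambda>w. (restrict f V (inv_into W \<phi> w) - restrict f V (inv_into W \<phi> (\<phi> x)) -
          (\<Sum>i<cdim X. a i * (w i - \<phi> x i))) /
         of_real (cnorm (cdim X) (\<lambda>i. w i - \<phi> x i))) \<longlongrightarrow> 0) (at (\<phi> x) within cspace (cdim X))"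
      by (intro Lim_transform_eventually[OF lim]) (auto elim!: eventually_mono simp: eq xT simp del: restrict_apply)
    then show ?thesis unfolding cdifferentiable_def by blast
  qed
  then show ?thesis by (auto simp: hol_def)
qed

text \<open>Reduces sums in the ring record to pointwise sums of complex numbers, so that identities
  between relations can be checked by ordinary arithmetic at each point.\<close>

lemma hol_finsum:
  assumes "cring (hol X W)" "\<And>l. l < (k::nat) \<Longrightarrow> f l \<in> carrier (hol X W)"
  shows "(\<Oplus>\<^bsub>hol X W\<^esub>l\<in>{..<k}. f l) = (\<lambda>x\<in>W. \<Sum>l<k. f l x)"
  using assms(2)
proof (induction k)
  interpret cring "hol X W" by fact
  {
    case 0
    have "\<zero>\<^bsub>hol X W\<^esub> = (\<lambda>x\<in>W. 0)" by (simp add: hol_def)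
    then show ?case by simp
  next
    case (Suc k)
    have "f \<in> {..<k} \<rightarrow> carrier (hol X W)" "f k \<in> carrier (hol X W)" using Suc.prems by auto
    then have "(\<Oplus>\<^bsub>hol X W\<^esub>l\<in>{..<Suc k}. f l) = f k \<oplus>\<^bsub>hol X W\<^esub> (\<Oplus>\<^bsub>hol X W\<^esub>l\<in>{..<k}. f l)"
      by (simp add: lessThan_Suc finsum_insert)
    also have "(\<Oplus>\<^bsub>hol X W\<^esub>l\<in>{..<k}. f l) = (\<lambda>x\<in>W. \<Sum>l<k. f l x)"
      by (rule Suc.IH) (simp add: Suc.prems)
    also have "f k \<oplus>\<^bsub>hol X W\<^esub> \<dots> = (\<lambda>x\<in>W. \<Sum>l<Suc k. f l x)"
      by (auto simp: hol_def fun_eq_iff add.commute)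
    finally show ?case .
  }
qed

lemma hol_mult: "f \<otimes>\<^bsub>hol X W\<^esub> g = (\<lambda>x\<in>W. f x * g x)"
  by (simp add: hol_def)

section \<open>Presheaves of modules\<close>

lemma psh_module: "psh F \<Longrightarrow> opn U \<Longrightarrow> Module.module (hol X U) (sect F U)"
  by (simp add: presheaf_of_modules_def)

lemma psh_group: "psh F \<Longrightarrow> opn U \<Longrightarrow> abelian_group (sect F U)"
  using psh_module module.axioms by blast

lemma psh_monoid: "psh F \<Longrightarrow> opn U \<Longrightarrow> abelian_monoid (sect F U)"
  using psh_group abelian_group.axioms(1) by blast

lemma psh_cring: "psh F \<Longrightarrow> opn U \<Longrightarrow> cring (hol X U)"
  using psh_module module.axioms by blast

lemma psh_rmap_addhom:
  "psh F \<Longrightarrow> opn U \<Longrightarrow> opn V \<Longrightarrow> V \<subseteq> U \<Longrightarrow> addhom (sect F U) (sect F V) (rmap F U V)"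
  unfolding addhom_def by (intro conjI psh_group) (auto simp: presheaf_of_modules_def)

lemma psh_smult_addhom:
  assumes "psh F" "opn U" "a \<in> carrier (hol X U)"
  shows "addhom (sect F U) (sect F U) (smult (sect F U) a)"
proof -
  interpret Module.module "hol X U" "sect F U" using assms psh_module by blast
  show ?thesis using assms by (auto simp: addhom_def smult_r_distr M.abelian_group_axioms)
qed

lemma psh_rmap_smult:
  "psh F \<Longrightarrow> opn U \<Longrightarrow> opn V \<Longrightarrow> V \<subseteq> U \<Longrightarrow> a \<in> carrier (hol X U) \<Longrightarrow> s \<in> carrier (sect F U) \<Longrightarrow>
     rmap F U V (a \<odot>\<^bsub>sect F U\<^esub> s) = restrict a V \<odot>\<^bsub>sect F V\<^esub> rmap F U V s"
  by (simp add: presheaf_of_modules_def)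

lemma psh_rmap_id: "psh F \<Longrightarrow> opn U \<Longrightarrow> s \<in> carrier (sect F U) \<Longrightarrow> rmap F U U s = s"
  by (simp add: presheaf_of_modules_def)

lemma psh_rmap_comp:
  "psh F \<Longrightarrow> opn U \<Longrightarrow> opn V \<Longrightarrow> opn W \<Longrightarrow> W \<subseteq> V \<Longrightarrow> V \<subseteq> U \<Longrightarrow> s \<in> carrier (sect F U) \<Longrightarrow>
     rmap F V W (rmap F U V s) = rmap F U W s"
  by (simp add: presheaf_of_modules_def)

lemma psh_smult_closed: "psh F \<Longrightarrow> opn U \<Longrightarrow> a \<in> carrier (hol X U) \<Longrightarrow> s \<in> carrier (sect F U) \<Longrightarrow>
   a \<odot>\<^bsub>sect F U\<^esub> s \<in> carrier (sect F U)"
  by (rule module.smult_closed[OF psh_module])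

lemma psh_rmap_closed: "psh F \<Longrightarrow> opn U \<Longrightarrow> opn V \<Longrightarrow> V \<subseteq> U \<Longrightarrow> s \<in> carrier (sect F U) \<Longrightarrow>
   rmap F U V s \<in> carrier (sect F V)"
  by (simp add: presheaf_of_modules_def)

lemma psh_finsum_closed:
  assumes "psh F" "opn U" "\<And>j. j < (m::nat) \<Longrightarrow> f j \<in> carrier (sect F U)"
  shows "(\<Oplus>\<^bsub>sect F U\<^esub>j\<in>{..<m}. f j) \<in> carrier (sect F U)"
proof -
  interpret abelian_monoid "sect F U" using assms psh_monoid by simp
  show ?thesis by (rule finsum_closed) (simp add: assms(3))
qed

lemma psh_finsum_cong:
  assumes "psh F" "opn U" "\<And>j. j < (m::nat) \<Longrightarrow> g j \<in> carrier (sect F U)"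
    "\<And>j. j < (m::nat) \<Longrightarrow> f j = g j"
  shows "(\<Oplus>\<^bsub>sect F U\<^esub>j\<in>{..<m}. f j) = (\<Oplus>\<^bsub>sect F U\<^esub>j\<in>{..<m}. g j)"
proof -
  interpret abelian_monoid "sect F U" using assms psh_monoid by simp
  show ?thesis by (rule finsum_cong') (simp_all add: assms(3,4))
qed

text \<open>Semilinearity of restriction combined with its transitivity: the sections
  \<open>s j\<close> end up restricted directly from \<open>U\<close>, the shape used in
  \<open>generates\<close> and \<open>relations\<close>.\<close>

lemma psh_rmap_lincomb:
  assumes "psh F" "opn U" "opn V" "opn W" "V \<subseteq> U" "W \<subseteq> V"
    and "\<And>j. j < m \<Longrightarrow> a j \<in> carrier (hol X V)" "\<And>j. j < (m::nat) \<Longrightarrow> s j \<in> carrier (sect F U)"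
  shows "rmap F V W (\<Oplus>\<^bsub>sect F V\<^esub>j\<in>{..<m}. a j \<odot>\<^bsub>sect F V\<^esub> rmap F U V (s j)) =
     (\<Oplus>\<^bsub>sect F W\<^esub>j\<in>{..<m}. restrict (a j) W \<odot>\<^bsub>sect F W\<^esub> rmap F U W (s j))"
proof -
  have "rmap F V W (\<Oplus>\<^bsub>sect F V\<^esub>j\<in>{..<m}. a j \<odot>\<^bsub>sect F V\<^esub> rmap F U V (s j)) =
    (\<Oplus>\<^bsub>sect F W\<^esub>j\<in>{..<m}. rmap F V W (a j \<odot>\<^bsub>sect F V\<^esub> rmap F U V (s j)))"
    using assms by (intro addhom_finsum psh_rmap_addhom psh_smult_closed psh_rmap_closed[of F U V]) auto
  also have "\<dots> = (\<Oplus>\<^bsub>sect F W\<^esub>j\<in>{..<m}. restrict (a j) W \<odot>\<^bsub>sect F W\<^esub> rmap F U W (s j))"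
    using assms by (intro psh_finsum_cong)
      (auto simp: psh_rmap_smult psh_rmap_closed psh_rmap_comp intro!: psh_smult_closed psh_rmap_closed[of F U W]
        hol_restrict[of V W])
  finally show ?thesis .
qed

lemma coh_psh: "coh F \<Longrightarrow> psh F"
  by (simp add: coherent_sheaf_def sheaf_of_modules_def)

section \<open>Direct sums\<close>

lemma sfst_spair [simp]: "sfst (spair a b :: 's) = a"
  and ssnd_spair [simp]: "ssnd (spair a b :: 's) = b"
  using pc by (simp_all add: sfst_def ssnd_def spair_def)

lemma spair_eq_iff [simp]: "(spair a b :: 's) = spair c d \<longleftrightarrow> a = c \<and> b = d"
  by (metis sfst_spair ssnd_spair)

abbreviation dsum :: "('x, 's) omod \<Rightarrow> ('x, 's) omod \<Rightarrow> ('x, 's) omod" where "dsum \<equiv> direct_sum"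

lemma dsum_simps [simp]:
  "spair a b \<in> carrier (sect (dsum F G) U) \<longleftrightarrow> a \<in> carrier (sect F U) \<and> b \<in> carrier (sect G U)"
  "\<zero>\<^bsub>sect (dsum F G) U\<^esub> = spair \<zero>\<^bsub>sect F U\<^esub> \<zero>\<^bsub>sect G U\<^esub>"
  "s \<oplus>\<^bsub>sect (dsum F G) U\<^esub> t = spair (sfst s \<oplus>\<^bsub>sect F U\<^esub> sfst t) (ssnd s \<oplus>\<^bsub>sect G U\<^esub> ssnd t)"
  "c \<odot>\<^bsub>sect (dsum F G) U\<^esub> s = spair (c \<odot>\<^bsub>sect F U\<^esub> sfst s) (c \<odot>\<^bsub>sect G U\<^esub> ssnd s)"
  "rmap (dsum F G) U V s = spair (rmap F U V (sfst s)) (rmap G U V (ssnd s))"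
  by (auto simp: direct_sum_def)

lemma dsum_carrier:
  "s \<in> carrier (sect (dsum F G) U) \<longleftrightarrow>
     sfst s \<in> carrier (sect F U) \<and> ssnd s \<in> carrier (sect G U) \<and> spair (sfst s) (ssnd s) = s"
  by (auto simp: direct_sum_def) (metis)

lemma dsumE:
  assumes "s \<in> carrier (sect (dsum F G) U)"
  obtains a b where "s = spair a b" "a \<in> carrier (sect F U)" "b \<in> carrier (sect G U)"
  using assms by (auto simp: direct_sum_def)

lemma dsum_module:
  assumes F: "psh F" and G: "psh G" and U: "opn U"
  shows "Module.module (hol X U) (sect (dsum F G) U)"
proof -
  interpret F: Module.module "hol X U" "sect F U" using F U psh_module by blast
  interpret G: Module.module "hol X U" "sect G U" using G U psh_module by blast
  show ?thesis
  proof (rule moduleI)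
    show "abelian_group (sect (dsum F G) U)"
    proof (rule abelian_groupI)
      fix s assume "s \<in> carrier (sect (dsum F G) U)"
      then show "\<exists>t\<in>carrier (sect (dsum F G) U). t \<oplus>\<^bsub>sect (dsum F G) U\<^esub> s = \<zero>\<^bsub>sect (dsum F G) U\<^esub>"
        by (intro bexI[of _ "spair (\<ominus>\<^bsub>sect F U\<^esub> sfst s) (\<ominus>\<^bsub>sect G U\<^esub> ssnd s)"])
          (auto elim!: dsumE simp: F.M.l_neg G.M.l_neg)
    qed (auto elim!: dsumE simp: F.M.a_ac G.M.a_ac)
  qed (auto elim!: dsumE simp: F.R.cring_axioms F.smult_l_distr G.smult_l_distr F.smult_r_distr
      G.smult_r_distr F.smult_assoc1 G.smult_assoc1)
qed

lemma dsum_psh: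
  assumes F: "psh F" and G: "psh G"
  shows "psh (dsum F G)"
proof -
  have "rmap (dsum F G) U V (c \<odot>\<^bsub>sect (dsum F G) U\<^esub> s) = restrict c V \<odot>\<^bsub>sect (dsum F G) V\<^esub> rmap (dsum F G) U V s"
    if "opn U" "opn V" "V \<subseteq> U" "c \<in> carrier (hol X U)" "s \<in> carrier (sect (dsum F G) U)" for U V c s
    using that F G by (auto elim!: dsumE simp: psh_rmap_smult)
  then show ?thesis
    unfolding presheaf_of_modules_def using F G
    by (auto elim!: dsumE simp del: dsum_simps(4) simp: dsum_module psh_rmap_closed psh_rmap_id psh_rmap_comp
      addhom_add[OF psh_rmap_addhom])
qed

lemma dsum_neg [simp]:
  assumes "psh F" "psh G" "opn U" "a \<in> carrier (sect F U)" "b \<in> carrier (sect G U)"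
  shows "\<ominus>\<^bsub>sect (dsum F G) U\<^esub> spair a b = spair (\<ominus>\<^bsub>sect F U\<^esub> a) (\<ominus>\<^bsub>sect G U\<^esub> b)"
proof -
  interpret F: abelian_group "sect F U" using assms psh_group by blast
  interpret G: abelian_group "sect G U" using assms psh_group by blast
  interpret D: abelian_group "sect (dsum F G) U" using assms psh_group dsum_psh by blast
  show ?thesis by (rule D.minus_equality) (use assms in \<open>auto simp: F.l_neg G.l_neg\<close>)
qed

lemma sfst_addhom: "psh F \<Longrightarrow> psh G \<Longrightarrow> opn U \<Longrightarrow> addhom (sect (dsum F G) U) (sect F U) sfst"
  and ssnd_addhom: "psh F \<Longrightarrow> psh G \<Longrightarrow> opn U \<Longrightarrow> addhom (sect (dsum F G) U) (sect G U) ssnd"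
  by (auto simp: addhom_def psh_group dsum_psh elim!: dsumE)

lemma dsum_finsum:
  assumes "psh F" "psh G" "opn U" "\<And>j. j < (m::nat) \<Longrightarrow> f j \<in> carrier (sect (dsum F G) U)"
  shows "(\<Oplus>\<^bsub>sect (dsum F G) U\<^esub>j\<in>{..<m}. f j) =
     spair (\<Oplus>\<^bsub>sect F U\<^esub>j\<in>{..<m}. sfst (f j)) (\<Oplus>\<^bsub>sect G U\<^esub>j\<in>{..<m}. ssnd (f j))"
proof -
  have "(\<Oplus>\<^bsub>sect (dsum F G) U\<^esub>j\<in>{..<m}. f j) \<in> carrier (sect (dsum F G) U)"
    using assms by (intro psh_finsum_closed dsum_psh)
  then show ?thesis
    using addhom_finsum[OF sfst_addhom[OF assms(1-3)], of m f]
      addhom_finsum[OF ssnd_addhom[OF assms(1-3)], of m f] assms(4)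
    by (auto elim!: dsumE)
qed

lemma sheaf_glue:
  assumes "sheaf_of_modules X F" "\<And>V. V \<in> \<U> \<Longrightarrow> opn V" "\<And>V. V \<in> \<U> \<Longrightarrow> \<sigma> V \<in> carrier (sect F V)"
    and "\<And>V W. V \<in> \<U> \<Longrightarrow> W \<in> \<U> \<Longrightarrow> rmap F V (V \<inter> W) (\<sigma> V) = rmap F W (V \<inter> W) (\<sigma> W)"
  obtains s where "s \<in> carrier (sect F (\<Union>\<U>))" "\<And>V. V \<in> \<U> \<Longrightarrow> rmap F (\<Union>\<U>) V s = \<sigma> V"
proof -
  have "\<exists>s \<in> carrier (sect F (\<Union>\<U>)). \<forall>V\<in>\<U>. rmap F (\<Union>\<U>) V s = \<sigma> V"
    by (rule sheaf_of_modules_def[THEN iffD1, OF assms(1), THEN conjunct2, THEN spec[of _ \<U>],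
          THEN mp, THEN conjunct2, THEN spec[of _ \<sigma>], THEN mp]) (blast intro: assms)+
  with that show ?thesis by blast
qed

lemma dsum_sheaf:
  assumes F: "sheaf_of_modules X F" and G: "sheaf_of_modules X G"
  shows "sheaf_of_modules X (dsum F G)"
  unfolding sheaf_of_modules_def
proof (intro conjI allI impI ballI)
  show "psh (dsum F G)" using F G dsum_psh sheaf_of_modules_def by blast
next
  fix \<U> s t
  assume U: "\<forall>V\<in>\<U>. opn V" and st: "s \<in> carrier (sect (dsum F G) (\<Union>\<U>))" "t \<in> carrier (sect (dsum F G) (\<Union>\<U>))"
    and eq: "\<forall>V\<in>\<U>. rmap (dsum F G) (\<Union>\<U>) V s = rmap (dsum F G) (\<Union>\<U>) V t"
  obtain s1 s2 t1 t2 where *: "s = spair s1 s2" "t = spair t1 t2"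
    "s1 \<in> carrier (sect F (\<Union>\<U>))" "s2 \<in> carrier (sect G (\<Union>\<U>))"
    "t1 \<in> carrier (sect F (\<Union>\<U>))" "t2 \<in> carrier (sect G (\<Union>\<U>))"
    using st by (auto elim!: dsumE)
  have "s1 = t1" "s2 = t2"
    using F G U eq * unfolding sheaf_of_modules_def by simp_all
  with * show "s = t" by simp
next
  fix \<U> \<sigma>
  assume U: "\<forall>V\<in>\<U>. opn V" and \<sigma>: "(\<forall>V\<in>\<U>. \<sigma> V \<in> carrier (sect (dsum F G) V)) \<and>
     (\<forall>V\<in>\<U>. \<forall>W\<in>\<U>. rmap (dsum F G) V (V \<inter> W) (\<sigma> V) = rmap (dsum F G) W (V \<inter> W) (\<sigma> W))"
  have 1: "sfst (\<sigma> V) \<in> carrier (sect F V)" "ssnd (\<sigma> V) \<in> carrier (sect G V)"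
    "spair (sfst (\<sigma> V)) (ssnd (\<sigma> V)) = \<sigma> V" if "V \<in> \<U>" for V
    using \<sigma> that by (auto simp: dsum_carrier)
  have 2: "rmap F V (V \<inter> W) (sfst (\<sigma> V)) = rmap F W (V \<inter> W) (sfst (\<sigma> W))"
     "rmap G V (V \<inter> W) (ssnd (\<sigma> V)) = rmap G W (V \<inter> W) (ssnd (\<sigma> W))" if "V \<in> \<U>" "W \<in> \<U>" for V W
    using \<sigma> that by auto
  obtain s where s: "s \<in> carrier (sect F (\<Union>\<U>))" "\<And>V. V \<in> \<U> \<Longrightarrow> rmap F (\<Union>\<U>) V s = sfst (\<sigma> V)"
    using sheaf_glue[of F \<U> "\<lambda>V. sfst (\<sigma> V)", OF F] U 1 2 by blast
  obtain t where t: "t \<in> carrier (sect G (\<Union>\<U>))" "\<And>V. V \<in> \<U> \<Longrightarrow> rmap G (\<Union>\<U>) V t = ssnd (\<sigma> V)"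
    using sheaf_glue[of G \<U> "\<lambda>V. ssnd (\<sigma> V)", OF G] U 1 2 by blast
  show "\<exists>s \<in> carrier (sect (dsum F G) (\<Union>\<U>)). \<forall>V\<in>\<U>. rmap (dsum F G) (\<Union>\<U>) V s = \<sigma> V"
    using s t 1 by (intro bexI[of _ "spair s t"]) auto
qed

text \<open>Serves the concatenation of two generating families; the difference \<open>j - m\<close>
  re-indexes the second one from zero.\<close>

lemma finsum_append:
  assumes "abelian_monoid M" "\<And>j. j < (m::nat) \<Longrightarrow> f j \<in> carrier M"
    "\<And>j. j < (k::nat) \<Longrightarrow> g j \<in> carrier M"
  shows "(\<Oplus>\<^bsub>M\<^esub>j\<in>{..<m + k}. if j < m then f j else g (j - m)) =
     (\<Oplus>\<^bsub>M\<^esub>j\<in>{..<m}. f j) \<oplus>\<^bsub>M\<^esub> (\<Oplus>\<^bsub>M\<^esub>j\<in>{..<k}. g j)"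
  using assms(3)
proof (induction k)
  interpret abelian_monoid M by fact
  have f: "(\<Oplus>\<^bsub>M\<^esub>j\<in>{..<m}. f j) \<in> carrier M" by (rule finsum_closed) (simp add: assms)
  {
    case 0
    have "(\<Oplus>\<^bsub>M\<^esub>j\<in>{..<m}. if j < m then f j else g (j - m)) = (\<Oplus>\<^bsub>M\<^esub>j\<in>{..<m}. f j)"
      by (rule finsum_cong') (simp_all add: assms)
    then show ?case using f by simp
  next
    case (Suc k)
    have g: "(\<Oplus>\<^bsub>M\<^esub>j\<in>{..<k}. g j) \<in> carrier M" "g k \<in> carrier M" "g \<in> {..<k} \<rightarrow> carrier M"
      using Suc.prems by (auto intro!: finsum_closed)
    have *: "{..<m + Suc k} = insert (m + k) {..<m + k}" by auto
    have "(\<Oplus>\<^bsub>M\<^esub>j\<in>{..<m + Suc k}. if j < m then f j else g (j - m)) =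
       g k \<oplus>\<^bsub>M\<^esub> (\<Oplus>\<^bsub>M\<^esub>j\<in>{..<m + k}. if j < m then f j else g (j - m))"
      unfolding * using Suc.prems by (subst finsum_insert) (auto simp: assms)
    then show ?case using f g Suc by (simp add: lessThan_Suc finsum_insert a_ac)
  }
qed

section \<open>Direct sums of sheaves of finite type\<close>

lemma generatesE:
  assumes "generates X F U m s" "opn V" "V \<subseteq> U" "t \<in> carrier (sect F V)" "y \<in> V"
  obtains W a where "opn W" "y \<in> W" "W \<subseteq> V" "\<And>j. j < m \<Longrightarrow> a j \<in> carrier (hol X W)"
    "rmap F V W t = (\<Oplus>\<^bsub>sect F W\<^esub> j \<in> {..<m}. a j \<odot>\<^bsub>sect F W\<^esub> rmap F U W (s j))"
proof -
  have "\<exists>W a. opn W \<and> y \<in> W \<and> W \<subseteq> V \<and> (\<forall>j<m. a j \<in> carrier (hol X W)) \<and>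
      rmap F V W t = (\<Oplus>\<^bsub>sect F W\<^esub> j \<in> {..<m}. a j \<odot>\<^bsub>sect F W\<^esub> rmap F U W (s j))"
    using assms by (simp add: generates_def)
  with that show ?thesis by auto
qed

text \<open>The generators of each summand, padded with zeros, are joined into one family.
  Generation is local, so everything is restricted to the intersection of the two neighbourhoods on
  which the summands are generated.\<close>

lemma dsum_finite_type:
  assumes F: "psh F" "finite_type X F" and G: "psh G" "finite_type X G"
  shows "finite_type X (dsum F G)"
  unfolding finite_type_def
proof
  fix x assume "x \<in> topspace (points X)"
  then obtain U1 m s U2 k t where
    1: "opn U1" "x \<in> U1" "generates X F U1 m s" and 2: "opn U2" "x \<in> U2" "generates X G U2 k t"
    using F(2) G(2) unfolding finite_type_def by metis
  define U where "U = U1 \<inter> U2"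
  define r where "r j = (if j < m then spair (rmap F U1 U (s j)) \<zero>\<^bsub>sect G U\<^esub>
    else spair \<zero>\<^bsub>sect F U\<^esub> (rmap G U2 U (t (j - m))))" for j
  have U: "opn U" "x \<in> U" "U \<subseteq> U1" "U \<subseteq> U2" using 1 2 by (auto simp: U_def)
  have s: "s j \<in> carrier (sect F U1)" if "j < m" for j using 1 that by (simp add: generates_def)
  have t: "t j \<in> carrier (sect G U2)" if "j < k" for j using 2 that by (simp add: generates_def)
  interpret FU: abelian_group "sect F U" using F U psh_group by blast
  interpret GU: abelian_group "sect G U" using G U psh_group by blast
  have "generates X (dsum F G) U (m + k) r"
    unfolding generates_def
  proof (intro conjI allI impI ballI)
    fix j assume "j < m + k"
    then show "r j \<in> carrier (sect (dsum F G) U)"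
      using s t U 1 2 F G by (auto simp: r_def intro!: psh_rmap_closed)
  next
    fix V w y assume V: "opn V \<and> V \<subseteq> U" and w: "w \<in> carrier (sect (dsum F G) V)" and y: "y \<in> V"
    obtain w1 w2 where w12: "w = spair w1 w2" "w1 \<in> carrier (sect F V)" "w2 \<in> carrier (sect G V)"
      using w by (rule dsumE)
    obtain W1 a where
      W1: "opn W1" "y \<in> W1" "W1 \<subseteq> V" "\<And>j. j < m \<Longrightarrow> a j \<in> carrier (hol X W1)"
        "rmap F V W1 w1 = (\<Oplus>\<^bsub>sect F W1\<^esub> j \<in> {..<m}. a j \<odot>\<^bsub>sect F W1\<^esub> rmap F U1 W1 (s j))"
      using generatesE[OF 1(3) _ _ w12(2) y] V U by blast
    obtain W2 b where
      W2: "opn W2" "y \<in> W2" "W2 \<subseteq> V" "\<And>j. j < k \<Longrightarrow> b j \<in> carrier (hol X W2)"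
        "rmap G V W2 w2 = (\<Oplus>\<^bsub>sect G W2\<^esub> j \<in> {..<k}. b j \<odot>\<^bsub>sect G W2\<^esub> rmap G U2 W2 (t j))"
      using generatesE[OF 2(3) _ _ w12(3) y] V U by blast
    \<comment> \<open>The two summands yield their coefficients on different neighbourhoods of
      \<open>y\<close>; both are cut down to the intersection.\<close>
    define W where "W = W1 \<inter> W2"
    define c where "c j = (if j < m then restrict (a j) W else restrict (b (j - m)) W)" for j
    have W: "opn W" "y \<in> W" "W \<subseteq> V" "W \<subseteq> W1" "W \<subseteq> W2" "W \<subseteq> U" "W \<subseteq> U1" "W \<subseteq> U2"
      "W1 \<subseteq> U1" "W2 \<subseteq> U2" using W1 W2 V U by (auto simp: W_def)
    have a: "restrict (a j) W \<in> carrier (hol X W)" if "j < m" for j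
      using W1 W that hol_restrict by blast
    have b: "restrict (b j) W \<in> carrier (hol X W)" if "j < k" for j
      using W2 W that hol_restrict by blast
    have c: "c j \<in> carrier (hol X W)" if "j < m + k" for j
      using a b that by (simp add: c_def)
    interpret FW: Module.module "hol X W" "sect F W" using F W psh_module by blast
    interpret GW: Module.module "hol X W" "sect G W" using G W psh_module by blast
    have sW: "rmap F U1 W (s j) \<in> carrier (sect F W)" "rmap F U W (rmap F U1 U (s j)) = rmap F U1 W (s j)"
      if "j < m" for j using that s W U F 1 by (auto intro!: psh_rmap_closed psh_rmap_comp)
    have tW: "rmap G U2 W (t j) \<in> carrier (sect G W)" "rmap G U W (rmap G U2 U (t j)) = rmap G U2 W (t j)"
      if "j < k" for j using that t W U G 2 by (auto intro!: psh_rmap_closed psh_rmap_comp)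
    have z: "rmap F U W \<zero>\<^bsub>sect F U\<^esub> = \<zero>\<^bsub>sect F W\<^esub>" "rmap G U W \<zero>\<^bsub>sect G U\<^esub> = \<zero>\<^bsub>sect G W\<^esub>"
      using U W F G by (auto intro!: addhom_zero[OF psh_rmap_addhom])
    let ?t = "\<lambda>j. c j \<odot>\<^bsub>sect (dsum F G) W\<^esub> rmap (dsum F G) U W (r j)"
    have tj: "?t j = (if j < m then spair (restrict (a j) W \<odot>\<^bsub>sect F W\<^esub> rmap F U1 W (s j)) \<zero>\<^bsub>sect G W\<^esub>
       else spair \<zero>\<^bsub>sect F W\<^esub> (restrict (b (j - m)) W \<odot>\<^bsub>sect G W\<^esub> rmap G U2 W (t (j - m))))" (is "_ = ?u j")
      if "j < m + k" for j
      using that a b sW tW by (auto simp: c_def r_def z)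
    have uj: "?u j \<in> carrier (sect (dsum F G) W)" if "j < m + k" for j
      using that a[of j] b[of "j - m"] sW[of j] tW[of "j - m"]
      by (auto simp del: restrict_apply intro!: FW.smult_closed GW.smult_closed)
    interpret DW: abelian_group "sect (dsum F G) W" using F G W dsum_psh psh_group by blast
    have e1: "rmap F W1 W (rmap F V W1 w1) = rmap F V W w1" "rmap F V W w1 \<in> carrier (sect F W)"
      using F(1) W W1(1,3) V w12 by (auto intro!: psh_rmap_comp psh_rmap_closed[of F V W])
    have e2: "rmap G W2 W (rmap G V W2 w2) = rmap G V W w2" "rmap G V W w2 \<in> carrier (sect G W)"
      using G(1) W W2(1,3) V w12 by (auto intro!: psh_rmap_comp psh_rmap_closed[of G V W])
    have "(\<Oplus>\<^bsub>sect (dsum F G) W\<^esub>j\<in>{..<m + k}. ?t j) = (\<Oplus>\<^bsub>sect (dsum F G) W\<^esub>j\<in>{..<m + k}. ?u j)"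
      by (rule psh_finsum_cong[OF dsum_psh[OF F(1) G(1)] W(1) uj tj])
    also have "\<dots> = (\<Oplus>\<^bsub>sect (dsum F G) W\<^esub>j\<in>{..<m}. spair (restrict (a j) W \<odot>\<^bsub>sect F W\<^esub> rmap F U1 W (s j)) \<zero>\<^bsub>sect G W\<^esub>) \<oplus>\<^bsub>sect (dsum F G) W\<^esub>
       (\<Oplus>\<^bsub>sect (dsum F G) W\<^esub>j\<in>{..<k}. spair \<zero>\<^bsub>sect F W\<^esub> (restrict (b j) W \<odot>\<^bsub>sect G W\<^esub> rmap G U2 W (t j)))"
      by (rule finsum_append[OF DW.abelian_monoid_axioms])
        (use a b sW tW in \<open>auto simp del: restrict_apply intro!: FW.smult_closed GW.smult_closed\<close>)
    also have "(\<Oplus>\<^bsub>sect (dsum F G) W\<^esub>j\<in>{..<m}. spair (restrict (a j) W \<odot>\<^bsub>sect F W\<^esub> rmap F U1 W (s j)) \<zero>\<^bsub>sect G W\<^esub>)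
      = spair (rmap F W1 W (rmap F V W1 w1)) \<zero>\<^bsub>sect G W\<^esub>"
      unfolding W1(5) using F G W W1 1 a sW s
      by (subst dsum_finsum) (auto simp: psh_rmap_lincomb GW.M.add.finprod_one_eqI)
    also have "(\<Oplus>\<^bsub>sect (dsum F G) W\<^esub>j\<in>{..<k}. spair \<zero>\<^bsub>sect F W\<^esub> (restrict (b j) W \<odot>\<^bsub>sect G W\<^esub> rmap G U2 W (t j)))
      = spair \<zero>\<^bsub>sect F W\<^esub> (rmap G W2 W (rmap G V W2 w2))"
      unfolding W2(5) using F G W W2 2 b tW t
      by (subst dsum_finsum) (auto simp: psh_rmap_lincomb FW.M.add.finprod_one_eqI)
    finally have "(\<Oplus>\<^bsub>sect (dsum F G) W\<^esub>j\<in>{..<m + k}. ?t j) = rmap (dsum F G) V W w"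
      using e1 e2 by (simp add: w12(1) del: restrict_apply)
    with W c show "\<exists>W a. opn W \<and> y \<in> W \<and> W \<subseteq> V \<and> (\<forall>j<m + k. a j \<in> carrier (hol X W)) \<and>
       rmap (dsum F G) V W w = (\<Oplus>\<^bsub>sect (dsum F G) W\<^esub>j\<in>{..<m + k}. a j \<odot>\<^bsub>sect (dsum F G) W\<^esub> rmap (dsum F G) U W (r j))"
      by (intro exI[of _ W] exI[of _ c]) simp
  qed
  with U show "\<exists>U m s. opn U \<and> x \<in> U \<and> generates X (dsum F G) U m s" by blast
qed

section \<open>Coherence of direct sums\<close>

lemma coh_relations_finite_type:
  "coh F \<Longrightarrow> opn U \<Longrightarrow> (\<And>j. j < m \<Longrightarrow> s j \<in> carrier (sect F U)) \<Longrightarrow> relations_finite_type X F U m s"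
  by (simp add: coherent_sheaf_def)

text \<open>The generation clause of \<open>relations_finite_type\<close>, split off so that its
  deep quantifier nest stays folded while witnesses are passed around.\<close>

definition generate_relations ::
  "('x, 's) omod \<Rightarrow> 'x set \<Rightarrow> nat \<Rightarrow> (nat \<Rightarrow> 's) \<Rightarrow> 'x set \<Rightarrow> nat \<Rightarrow> (nat \<Rightarrow> nat \<Rightarrow> 'x \<Rightarrow> complex) \<Rightarrow> bool" where
  "generate_relations F U m s V k r \<longleftrightarrow>
     (\<forall>W. opn W \<and> W \<subseteq> V \<longrightarrow> (\<forall>a \<in> relations X F U m s W. \<forall>y\<in>W.
        \<exists>W' b. opn W' \<and> y \<in> W' \<and> W' \<subseteq> W \<and> (\<forall>l<k. b l \<in> carrier (hol X W')) \<and>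
          (\<forall>j<m. restrict (a j) W' =
             (\<Oplus>\<^bsub>hol X W'\<^esub> l \<in> {..<k}. b l \<otimes>\<^bsub>hol X W'\<^esub> restrict (r l j) W'))))"

lemma relations_finite_type_iff:
  "relations_finite_type X F U m s \<longleftrightarrow> (\<forall>x\<in>U. \<exists>V k r. opn V \<and> x \<in> V \<and> V \<subseteq> U \<and>
     (\<forall>l<k. r l \<in> relations X F U m s V) \<and> generate_relations F U m s V k r)"
  by (simp only: relations_finite_type_def generate_relations_def)

lemma generate_relationsE:
  assumes "generate_relations F U m s V k r" "opn W" "W \<subseteq> V" "a \<in> relations X F U m s W" "y \<in> W"
  obtains W' b where "opn W'" "y \<in> W'" "W' \<subseteq> W" "\<forall>l<k. b l \<in> carrier (hol X W')"
    "\<forall>j<m. restrict (a j) W' =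
       (\<Oplus>\<^bsub>hol X W'\<^esub> l \<in> {..<k}. b l \<otimes>\<^bsub>hol X W'\<^esub> restrict (r l j) W')"
proof -
  have "\<exists>W' b. opn W' \<and> y \<in> W' \<and> W' \<subseteq> W \<and> (\<forall>l<k. b l \<in> carrier (hol X W')) \<and>
      (\<forall>j<m. restrict (a j) W' =
         (\<Oplus>\<^bsub>hol X W'\<^esub> l \<in> {..<k}. b l \<otimes>\<^bsub>hol X W'\<^esub> restrict (r l j) W'))"
    by (rule assms(1)[unfolded generate_relations_def, THEN spec[of _ W], THEN mp, THEN bspec[of _ _ a],
        THEN bspec[of _ _ y]]) (use assms in auto)
  with that show ?thesis by auto
qed

text \<open>Linear combinations in the direct sum are formed componentwise, so one vanishes exactly
  if both of its components do.\<close>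

lemma dsum_relations:
  assumes F: "psh F" and G: "psh G" and U: "opn U" "opn V" "V \<subseteq> U"
    and s: "\<And>j. j < m \<Longrightarrow> s j \<in> carrier (sect (dsum F G) U)"
  shows "relations X (dsum F G) U m s V =
    relations X F U m (\<lambda>j. sfst (s j)) V \<inter> relations X G U m (\<lambda>j. ssnd (s j)) V"
proof -
  have "(\<Oplus>\<^bsub>sect (dsum F G) V\<^esub> j \<in> {..<m}. a j \<odot>\<^bsub>sect (dsum F G) V\<^esub> rmap (dsum F G) U V (s j)) =
     spair (\<Oplus>\<^bsub>sect F V\<^esub> j \<in> {..<m}. a j \<odot>\<^bsub>sect F V\<^esub> rmap F U V (sfst (s j)))
       (\<Oplus>\<^bsub>sect G V\<^esub> j \<in> {..<m}. a j \<odot>\<^bsub>sect G V\<^esub> rmap G U V (ssnd (s j)))"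
    if "\<forall>j<m. a j \<in> carrier (hol X V)" for a
    using that F G U s
    by (subst dsum_finsum) (auto simp: dsum_carrier intro!: psh_smult_closed psh_rmap_closed[of _ U V])
  then show ?thesis unfolding relations_def by auto
qed

text \<open>Relations between the generators of the relations in \<open>F\<close>, evaluated in \<open>G\<close>, generate the
  common relations.\<close>

lemma dsum_coherent:
  assumes F: "coh F" and G: "coh G"
  shows "coh (dsum F G)"
proof -
  note pF = coh_psh[OF F] and pG = coh_psh[OF G]
  have "relations_finite_type X (dsum F G) U m s"
    if U: "opn U" and s: "\<And>j. j < m \<Longrightarrow> s j \<in> carrier (sect (dsum F G) U)" for U m s
    unfolding relations_finite_type_iff
  proof
    fix x assume x: "x \<in> U"
    define s1 where "s1 j = sfst (s j)" for j
    define s2 where "s2 j = ssnd (s j)" for j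
    have s1: "s1 j \<in> carrier (sect F U)" and s2: "s2 j \<in> carrier (sect G U)" if "j < m" for j
      using s[OF that] by (auto simp: dsum_carrier s1_def s2_def)
    have rel: "relations X (dsum F G) U m s V = relations X F U m s1 V \<inter> relations X G U m s2 V"
      if "opn V" "V \<subseteq> U" for V
      unfolding s1_def s2_def by (rule dsum_relations[OF pF pG U that s])
    have c1: "relations_finite_type X F U m s1" by (rule coh_relations_finite_type[OF F U s1])
    obtain V and k :: nat and r where V: "opn V" "x \<in> V" "V \<subseteq> U" and
      r: "\<And>l. l < k \<Longrightarrow> r l \<in> relations X F U m s1 V" and
      gen1: "generate_relations F U m s1 V k r"
      using bspec[OF iffD1[OF relations_finite_type_iff c1] x]
      by (elim exE conjE) (rule that; simp)
    have rh: "r l j \<in> carrier (hol X V)" if "l < k" "j < m" for l j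
      using r[OF that(1)] that(2) by (simp add: relations_def)
    have r0: "(\<Oplus>\<^bsub>sect F V\<^esub> j \<in> {..<m}. r l j \<odot>\<^bsub>sect F V\<^esub> rmap F U V (s1 j)) = \<zero>\<^bsub>sect F V\<^esub>" if "l < k" for l
      using r[OF that(1)] by (simp add: relations_def)
    \<comment> \<open>\<open>g l\<close> is the value in \<open>G\<close> of the \<open>l\<close>-th
      generating relation of \<open>F\<close>. Coherence of \<open>G\<close> is applied to these
      sections over the smaller set \<open>V\<close>.\<close>
    define g where "g l = (\<Oplus>\<^bsub>sect G V\<^esub> j \<in> {..<m}. r l j \<odot>\<^bsub>sect G V\<^esub> rmap G U V (s2 j))" for l
    have g: "g l \<in> carrier (sect G V)" if "l < k" for l
      unfolding g_def using pG V U rh that s2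
      by (intro psh_finsum_closed psh_smult_closed psh_rmap_closed[of G U V]) auto
    have c2: "relations_finite_type X G V k g" by (rule coh_relations_finite_type[OF G V(1) g])
    obtain V' and p :: nat and q where V': "opn V'" "x \<in> V'" "V' \<subseteq> V" and
      q: "\<And>i. i < p \<Longrightarrow> q i \<in> relations X G V k g V'" and
      gen2: "generate_relations G V k g V' p q"
      using bspec[OF iffD1[OF relations_finite_type_iff c2] V(2)]
      by (elim exE conjE) (rule that; simp)
    have qh: "q i l \<in> carrier (hol X V')" if "i < p" "l < k" for i l
      using q[OF that(1)] that(2) by (simp add: relations_def)
    have q0: "(\<Oplus>\<^bsub>sect G V'\<^esub> l \<in> {..<k}. q i l \<odot>\<^bsub>sect G V'\<^esub> rmap G V V' (g l)) = \<zero>\<^bsub>sect G V'\<^esub>" if "i < p" for i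
      using q[OF that(1)] by (simp add: relations_def)
    \<comment> \<open>The matrix product of \<open>q\<close> and \<open>r\<close>: combinations of
      relations in \<open>F\<close> whose values in \<open>G\<close> cancel.\<close>
    define R where "R i j = (\<Oplus>\<^bsub>hol X V'\<^esub> l \<in> {..<k}. q i l \<otimes>\<^bsub>hol X V'\<^esub> restrict (r l j) V')" for i j
    \<comment> \<open>Stated for an arbitrary presheaf \<open>H\<close> because it is used twice: in
      \<open>F\<close>, where the inner sums vanish, and in \<open>G\<close>, where they are the
      sections \<open>g l\<close>.\<close>
    have swap: "(\<Oplus>\<^bsub>sect H W\<^esub> j \<in> {..<m}. (\<Oplus>\<^bsub>hol X W\<^esub> l \<in> {..<k}. c l \<otimes>\<^bsub>hol X W\<^esub> restrict (r l j) W) \<odot>\<^bsub>sect H W\<^esub> rmap H U W (t j))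
       = (\<Oplus>\<^bsub>sect H W\<^esub> l \<in> {..<k}. c l \<odot>\<^bsub>sect H W\<^esub> rmap H V W (\<Oplus>\<^bsub>sect H V\<^esub> j \<in> {..<m}. r l j \<odot>\<^bsub>sect H V\<^esub> rmap H U V (t j)))"
      if H: "psh H" and W: "opn W" "W \<subseteq> V" and c: "\<And>l. l < k \<Longrightarrow> c l \<in> carrier (hol X W)"
        and t: "\<And>j. j < m \<Longrightarrow> t j \<in> carrier (sect H U)" for H W c t
    proof -
      interpret HW: Module.module "hol X W" "sect H W" using H W psh_module by blast
      have rW: "restrict (r l j) W \<in> carrier (hol X W)" if "l < k" "j < m" for l j
        using rh that V W hol_restrict by blast
      have tW: "rmap H U W (t j) \<in> carrier (sect H W)" if "j < m" for j
        using that t H U V W by (intro psh_rmap_closed[of H U W]) auto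
      have "(\<Oplus>\<^bsub>sect H W\<^esub> j \<in> {..<m}. (\<Oplus>\<^bsub>hol X W\<^esub> l \<in> {..<k}. c l \<otimes>\<^bsub>hol X W\<^esub> restrict (r l j) W) \<odot>\<^bsub>sect H W\<^esub> rmap H U W (t j))
       = (\<Oplus>\<^bsub>sect H W\<^esub> l \<in> {..<k}. c l \<odot>\<^bsub>sect H W\<^esub> (\<Oplus>\<^bsub>sect H W\<^esub> j \<in> {..<m}. restrict (r l j) W \<odot>\<^bsub>sect H W\<^esub> rmap H U W (t j)))"
        by (rule HW.finsum_smult_swap[OF c rW tW])
      also have "\<dots> = (\<Oplus>\<^bsub>sect H W\<^esub> l \<in> {..<k}. c l \<odot>\<^bsub>sect H W\<^esub> rmap H V W (\<Oplus>\<^bsub>sect H V\<^esub> j \<in> {..<m}. r l j \<odot>\<^bsub>sect H V\<^esub> rmap H U V (t j)))"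
      proof (rule psh_finsum_cong[OF H W(1)])
        fix l assume l: "l < k"
        have eq: "rmap H V W (\<Oplus>\<^bsub>sect H V\<^esub> j \<in> {..<m}. r l j \<odot>\<^bsub>sect H V\<^esub> rmap H U V (t j)) =
          (\<Oplus>\<^bsub>sect H W\<^esub> j \<in> {..<m}. restrict (r l j) W \<odot>\<^bsub>sect H W\<^esub> rmap H U W (t j))"
          by (rule psh_rmap_lincomb[OF H U V(1) W(1) V(3) W(2) rh[OF l] t])
        then show "c l \<odot>\<^bsub>sect H W\<^esub> (\<Oplus>\<^bsub>sect H W\<^esub> j \<in> {..<m}. restrict (r l j) W \<odot>\<^bsub>sect H W\<^esub> rmap H U W (t j)) =
          c l \<odot>\<^bsub>sect H W\<^esub> rmap H V W (\<Oplus>\<^bsub>sect H V\<^esub> j \<in> {..<m}. r l j \<odot>\<^bsub>sect H V\<^esub> rmap H U V (t j))" by simp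
        show "c l \<odot>\<^bsub>sect H W\<^esub> rmap H V W (\<Oplus>\<^bsub>sect H V\<^esub> j \<in> {..<m}. r l j \<odot>\<^bsub>sect H V\<^esub> rmap H U V (t j)) \<in> carrier (sect H W)"
          unfolding eq by (intro HW.smult_closed c l psh_finsum_closed[OF H W(1)] rW tW)
      qed
      finally show ?thesis .
    qed
    have V'U: "V' \<subseteq> U" using V V' by blast
    have cr: "cring (hol X W)" if "opn W" for W using psh_cring[OF pF that] .
    have Rh: "R i j \<in> carrier (hol X V')" if "i < p" "j < m" for i j
    proof -
      interpret cring "hol X V'" using cr V' by blast
      have "q i l \<otimes>\<^bsub>hol X V'\<^esub> restrict (r l j) V' \<in> carrier (hol X V')" if "l < k" for l
        using qh \<open>i < p\<close> that hol_restrict[OF V(1) V'(1,3) rh[OF that \<open>j < m\<close>]] by (intro m_closed)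
      then show ?thesis unfolding R_def by (intro finsum_closed) simp
    qed
    have Rrel: "R i \<in> relations X (dsum F G) U m s V'" if i: "i < p" for i
    proof -
      have zero: "rmap F V V' \<zero>\<^bsub>sect F V\<^esub> = \<zero>\<^bsub>sect F V'\<^esub>"
        by (rule addhom_zero[OF psh_rmap_addhom[OF pF V(1) V'(1,3)]])
      interpret FV: Module.module "hol X V'" "sect F V'" using pF V' psh_module by blast
      have "(\<Oplus>\<^bsub>sect F V'\<^esub> j \<in> {..<m}. R i j \<odot>\<^bsub>sect F V'\<^esub> rmap F U V' (s1 j)) =
        (\<Oplus>\<^bsub>sect F V'\<^esub> l \<in> {..<k}. q i l \<odot>\<^bsub>sect F V'\<^esub> rmap F V V' (\<Oplus>\<^bsub>sect F V\<^esub> j \<in> {..<m}. r l j \<odot>\<^bsub>sect F V\<^esub> rmap F U V (s1 j)))"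
        unfolding R_def by (rule swap[OF pF V'(1,3) qh[OF i] s1])
      also have "\<dots> = \<zero>\<^bsub>sect F V'\<^esub>"
        using qh[OF i] by (intro FV.M.add.finprod_one_eqI) (simp add: r0 zero)
      finally have 1: "(\<Oplus>\<^bsub>sect F V'\<^esub> j \<in> {..<m}. R i j \<odot>\<^bsub>sect F V'\<^esub> rmap F U V' (s1 j)) = \<zero>\<^bsub>sect F V'\<^esub>" .
      have "(\<Oplus>\<^bsub>sect G V'\<^esub> j \<in> {..<m}. R i j \<odot>\<^bsub>sect G V'\<^esub> rmap G U V' (s2 j)) =
        (\<Oplus>\<^bsub>sect G V'\<^esub> l \<in> {..<k}. q i l \<odot>\<^bsub>sect G V'\<^esub> rmap G V V' (g l))"
        unfolding R_def g_def by (rule swap[OF pG V'(1,3) qh[OF i] s2])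
      also have "\<dots> = \<zero>\<^bsub>sect G V'\<^esub>" by (rule q0[OF i])
      finally show ?thesis
        unfolding rel[OF V'(1) V'U] using 1 Rh[OF i]
        unfolding relations_def by (intro IntI CollectI conjI) auto
    qed
    have gen: "\<exists>W' c. opn W' \<and> y \<in> W' \<and> W' \<subseteq> W \<and> (\<forall>i<p. c i \<in> carrier (hol X W')) \<and>
         (\<forall>j<m. restrict (a j) W' =
           (\<Oplus>\<^bsub>hol X W'\<^esub> i \<in> {..<p}. c i \<otimes>\<^bsub>hol X W'\<^esub> restrict (R i j) W'))"
      if W: "opn W" "W \<subseteq> V'" and a: "a \<in> relations X (dsum F G) U m s W" and y: "y \<in> W" for W a y
    proof -
      have WV: "W \<subseteq> V" "W \<subseteq> U" using W V V' by auto
      have a12: "a \<in> relations X F U m s1 W" "a \<in> relations X G U m s2 W" using a rel[OF W(1) WV(2)] by auto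
      have ah: "a j \<in> carrier (hol X W)" if "j < m" for j using a12 that by (simp add: relations_def)
      obtain W1 b where W1: "opn W1" "y \<in> W1" "W1 \<subseteq> W" and b': "\<forall>l<k. b l \<in> carrier (hol X W1)" and
        ab': "\<forall>j<m. restrict (a j) W1 =
           (\<Oplus>\<^bsub>hol X W1\<^esub> l \<in> {..<k}. b l \<otimes>\<^bsub>hol X W1\<^esub> restrict (r l j) W1)"
        by (rule generate_relationsE[OF gen1 W(1) WV(1) a12(1) y])
      note b = b'[rule_format] and ab = ab'[rule_format]
      have W1V: "W1 \<subseteq> V" "W1 \<subseteq> V'" "W1 \<subseteq> U" using W1 W WV by auto
      have "(\<Oplus>\<^bsub>sect G W1\<^esub> l \<in> {..<k}. b l \<odot>\<^bsub>sect G W1\<^esub> rmap G V W1 (g l)) =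
        (\<Oplus>\<^bsub>sect G W1\<^esub> j \<in> {..<m}. (\<Oplus>\<^bsub>hol X W1\<^esub> l \<in> {..<k}. b l \<otimes>\<^bsub>hol X W1\<^esub> restrict (r l j) W1) \<odot>\<^bsub>sect G W1\<^esub> rmap G U W1 (s2 j))"
        unfolding g_def by (rule swap[OF pG W1(1) W1V(1) b s2, symmetric])
      also have "\<dots> = (\<Oplus>\<^bsub>sect G W1\<^esub> j \<in> {..<m}. restrict (a j) W1 \<odot>\<^bsub>sect G W1\<^esub> rmap G U W1 (s2 j))"
        by (rule psh_finsum_cong[OF pG W1(1)])
         (use pG U W1 W1V s2 ah W in \<open>auto simp: ab[symmetric] simp del: restrict_apply intro!: psh_smult_closed psh_rmap_closed[of G U W1] hol_restrict[of W W1]\<close>)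
      also have "\<dots> = rmap G W W1 (\<Oplus>\<^bsub>sect G W\<^esub> j \<in> {..<m}. a j \<odot>\<^bsub>sect G W\<^esub> rmap G U W (s2 j))"
        by (rule psh_rmap_lincomb[OF pG U W(1) W1(1) WV(2) W1(3) ah s2, symmetric])
      also have "(\<Oplus>\<^bsub>sect G W\<^esub> j \<in> {..<m}. a j \<odot>\<^bsub>sect G W\<^esub> rmap G U W (s2 j)) = \<zero>\<^bsub>sect G W\<^esub>"
        using a12 by (simp add: relations_def)
      also have "rmap G W W1 \<dots> = \<zero>\<^bsub>sect G W1\<^esub>"
        by (rule addhom_zero[OF psh_rmap_addhom[OF pG W(1) W1(1,3)]])
      \<comment> \<open>The value of \<open>a\<close> in \<open>G\<close> is zero and equals the
        combination of the \<open>g l\<close> with coefficients \<open>b\<close>; so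
        \<open>b\<close> is itself a relation and can be expanded in the \<open>q i\<close>.\<close>
      finally have "b \<in> relations X G V k g W1" using b by (simp add: relations_def)
      then have bV: "b \<in> relations X G V k g W1" .
      obtain W2 c where W2: "opn W2" "y \<in> W2" "W2 \<subseteq> W1" and c': "\<forall>i<p. c i \<in> carrier (hol X W2)" and
        bc': "\<forall>l<k. restrict (b l) W2 =
           (\<Oplus>\<^bsub>hol X W2\<^esub> i \<in> {..<p}. c i \<otimes>\<^bsub>hol X W2\<^esub> restrict (q i l) W2)"
        by (rule generate_relationsE[OF gen2 W1(1) W1V(2) bV W1(2)])
      note c = c'[rule_format] and bc = bc'[rule_format]
      have W2V: "W2 \<subseteq> V'" "W2 \<subseteq> W" "W2 \<subseteq> V" using W2 W1V W1 by auto
      have "restrict (a j) W2 = (\<Oplus>\<^bsub>hol X W2\<^esub> i \<in> {..<p}. c i \<otimes>\<^bsub>hol X W2\<^esub> restrict (R i j) W2)" if j: "j < m" for j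
      proof -
        interpret H1: cring "hol X W1" using cr W1 by blast
        interpret H2: cring "hol X W2" using cr W2 by blast
        interpret H': cring "hol X V'" using cr V' by blast
        have e1: "a j z = (\<Sum>l<k. b l z * r l j z)" if "z \<in> W1" for z
        proof -
          have "restrict (a j) W1 = (\<lambda>x\<in>W1. \<Sum>l<k. (b l \<otimes>\<^bsub>hol X W1\<^esub> restrict (r l j) W1) x)"
            unfolding ab[OF j] using b hol_restrict[OF V(1) W1(1) W1V(1) rh[OF _ j]]
            by (intro hol_finsum H1.is_cring H1.m_closed)
          from fun_cong[OF this, of z] show ?thesis using that by (simp add: hol_mult)
        qed
        have e2: "b l z = (\<Sum>i<p. c i z * q i l z)" if "z \<in> W2" "l < k" for z l
        proof -
          have "restrict (b l) W2 = (\<lambda>x\<in>W2. \<Sum>i<p. (c i \<otimes>\<^bsub>hol X W2\<^esub> restrict (q i l) W2) x)"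
            unfolding bc[OF that(2)] using c hol_restrict[OF V'(1) W2(1) W2V(1) qh[OF _ that(2)]]
            by (intro hol_finsum H2.is_cring H2.m_closed)
          from fun_cong[OF this, of z] show ?thesis using that by (simp add: hol_mult)
        qed
        have e3: "R i j z = (\<Sum>l<k. q i l z * r l j z)" if "z \<in> V'" "i < p" for z i
        proof -
          have "R i j = (\<lambda>x\<in>V'. \<Sum>l<k. (q i l \<otimes>\<^bsub>hol X V'\<^esub> restrict (r l j) V') x)"
            unfolding R_def using qh[OF that(2)] hol_restrict[OF V(1) V'(1,3) rh[OF _ j]]
            by (intro hol_finsum H'.is_cring H'.m_closed)
          from fun_cong[OF this, of z] show ?thesis using that by (simp add: hol_mult)
        qed
        \<comment> \<open>The expansion of \<open>b\<close> is substituted into that of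
          \<open>a\<close>; interchanging the sums produces the rows of \<open>R\<close>.\<close>
        have e4: "a j z = (\<Sum>i<p. c i z * R i j z)" if z: "z \<in> W2" for z
        proof -
          have "a j z = (\<Sum>l<k. (\<Sum>i<p. c i z * q i l z) * r l j z)"
            using e1[of z] e2[of z] z W2 by auto
          also have "\<dots> = (\<Sum>i<p. \<Sum>l<k. c i z * q i l z * r l j z)"
            by (simp add: sum_distrib_right) (rule sum.swap)
          also have "\<dots> = (\<Sum>i<p. c i z * R i j z)"
            using e3[of z] z W2V by (auto simp: sum_distrib_left mult.assoc intro!: sum.cong)
          finally show ?thesis .
        qed
        have "(\<Oplus>\<^bsub>hol X W2\<^esub> i \<in> {..<p}. c i \<otimes>\<^bsub>hol X W2\<^esub> restrict (R i j) W2) =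
          (\<lambda>x\<in>W2. \<Sum>i<p. (c i \<otimes>\<^bsub>hol X W2\<^esub> restrict (R i j) W2) x)"
          using c hol_restrict[OF V'(1) W2(1) W2V(1) Rh[OF _ j]] by (intro hol_finsum H2.is_cring H2.m_closed)
        also have "\<dots> = restrict (a j) W2" by (auto simp: hol_mult e4)
        finally show ?thesis by simp
      qed
      with W2 W2V c show ?thesis by (intro exI[of _ W2] exI[of _ c]) auto
    qed
    have "opn V' \<and> x \<in> V' \<and> V' \<subseteq> U" using V' V'U by blast
    moreover have "generate_relations (dsum F G) U m s V' p R"
      unfolding generate_relations_def by (intro allI impI ballI, elim conjE) (rule gen)
    moreover have "\<forall>l<p. R l \<in> relations X (dsum F G) U m s V'" using Rrel by blast
    ultimately show "\<exists>V k r. opn V \<and> x \<in> V \<and> V \<subseteq> U \<and> (\<forall>l<k. r l \<in> relations X (dsum F G) U m s V) \<and>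
        generate_relations (dsum F G) U m s V k r"
      by (intro exI[of _ V'] exI[of _ p] exI[of _ R]) simp
  qed
  moreover have "sheaf_of_modules X (dsum F G)" "finite_type X (dsum F G)"
    using F G pF pG dsum_sheaf dsum_finite_type by (simp_all add: coherent_sheaf_def)
  ultimately show ?thesis by (simp add: coherent_sheaf_def)
qed

end

lemma (in abelian_group) minus_eq_iff_eq_add:
  assumes "x \<in> carrier G" "y \<in> carrier G" "z \<in> carrier G"
  shows "x \<oplus> (\<ominus> y) = z \<longleftrightarrow> x = y \<oplus> z"
proof
  assume "x \<oplus> (\<ominus> y) = z"
  then have "y \<oplus> z = y \<oplus> (x \<oplus> (\<ominus> y))" by simp
  also have "\<dots> = x" using assms by (simp add: group_normalize)
  finally show "x = y \<oplus> z" by simp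
qed (use assms in \<open>simp add: group_normalize\<close>)

text \<open>Expresses bijectivity through representatives, the form in which it can be tested on
  local sections. The image of a class under \<open>h\<close> is in general not a full class, hence
  the saturation by \<open>q\<close>.\<close>

lemma quotient_map_bij_iff:
  assumes r: "equiv A r" and q: "equiv B q"
    and h: "\<And>a b. (a, b) \<in> r \<Longrightarrow> (h a, h b) \<in> q"
  shows "bij_betw (\<lambda>c. q `` (h ` c)) (A // r) (B // q) \<longleftrightarrow>
    (\<forall>a\<in>A. \<forall>b\<in>A. (h a, h b) \<in> q \<longrightarrow> (a, b) \<in> r) \<and> (\<forall>b\<in>B. \<exists>a\<in>A. (h a, b) \<in> q)"
proof -
  have cl: "q `` (h ` (r `` {a})) = q `` {h a}" if "a \<in> A" for a
  proof
    show "q `` (h ` (r `` {a})) \<subseteq> q `` {h a}"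
      using h q by (auto simp: equiv_def elim: transE)
    show "q `` {h a} \<subseteq> q `` (h ` (r `` {a}))"
      using that r by (auto simp: equiv_def refl_on_def)
  qed
  have hB: "h a \<in> B" if "a \<in> A" for a
    using h[of a a] r q that by (auto simp: equiv_def refl_on_def)
  have "inj_on (\<lambda>c. q `` (h ` c)) (A // r) \<longleftrightarrow> (\<forall>a\<in>A. \<forall>b\<in>A. (h a, h b) \<in> q \<longrightarrow> (a, b) \<in> r)"
  proof
    assume inj: "inj_on (\<lambda>c. q `` (h ` c)) (A // r)"
    show "\<forall>a\<in>A. \<forall>b\<in>A. (h a, h b) \<in> q \<longrightarrow> (a, b) \<in> r"
    proof (intro ballI impI)
      fix a b assume ab: "a \<in> A" "b \<in> A" "(h a, h b) \<in> q"
      then have "q `` (h ` (r `` {a})) = q `` (h ` (r `` {b}))"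
        using q by (simp add: cl equiv_class_eq)
      then have "r `` {a} = r `` {b}" using inj ab by (auto simp: inj_on_def quotientI)
      then show "(a, b) \<in> r" using r ab by (simp add: eq_equiv_class_iff)
    qed
  next
    assume *: "\<forall>a\<in>A. \<forall>b\<in>A. (h a, h b) \<in> q \<longrightarrow> (a, b) \<in> r"
    show "inj_on (\<lambda>c. q `` (h ` c)) (A // r)"
    proof (rule inj_onI)
      fix c d assume "c \<in> A // r" "d \<in> A // r" and eq: "q `` (h ` c) = q `` (h ` d)"
      then obtain a b where ab: "a \<in> A" "b \<in> A" "c = r `` {a}" "d = r `` {b}"
        by (auto elim!: quotientE)
      then have "(h a, h b) \<in> q" using eq q hB by (simp add: cl eq_equiv_class_iff)
      then show "c = d" using * ab r by (simp add: equiv_class_eq)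
    qed
  qed
  moreover have "(\<lambda>c. q `` (h ` c)) ` (A // r) = B // q \<longleftrightarrow> (\<forall>b\<in>B. \<exists>a\<in>A. (h a, b) \<in> q)"
  proof
    assume *: "(\<lambda>c. q `` (h ` c)) ` (A // r) = B // q"
    show "\<forall>b\<in>B. \<exists>a\<in>A. (h a, b) \<in> q"
    proof
      fix b assume b: "b \<in> B"
      then have "q `` {b} \<in> (\<lambda>c. q `` (h ` c)) ` (A // r)" using * by (simp add: quotientI)
      then obtain a where "a \<in> A" "q `` {b} = q `` (h ` (r `` {a}))" by (auto elim!: quotientE)
      then have "(h a, b) \<in> q" using b q hB by (simp add: cl eq_equiv_class_iff) (metis equiv_def symD)
      then show "\<exists>a\<in>A. (h a, b) \<in> q" using \<open>a \<in> A\<close> by blast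
    qed
  next
    assume *: "\<forall>b\<in>B. \<exists>a\<in>A. (h a, b) \<in> q"
    show "(\<lambda>c. q `` (h ` c)) ` (A // r) = B // q"
    proof (intro equalityI subsetI)
      fix c assume "c \<in> (\<lambda>c. q `` (h ` c)) ` (A // r)"
      then show "c \<in> B // q" using hB by (auto elim!: quotientE simp: cl quotientI)
    next
      fix d assume "d \<in> B // q"
      then obtain b where b: "b \<in> B" "d = q `` {b}" by (auto elim!: quotientE)
      then obtain a where a: "a \<in> A" "(h a, b) \<in> q" using * by blast
      then have "d = q `` (h ` (r `` {a}))" using b q by (simp add: cl equiv_class_eq)
      then show "d \<in> (\<lambda>c. q `` (h ` c)) ` (A // r)" using a by (auto simp: quotientI)
    qed
  qed
  ultimately show ?thesis by (simp add: bij_betw_def)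
qed

context coherent_sheaves
begin

section \<open>Morphisms of sheaves\<close>

lemma shom_addhom:
  "psh F \<Longrightarrow> psh G \<Longrightarrow> sheaf_hom X F G \<phi> \<Longrightarrow> opn U \<Longrightarrow> addhom (sect F U) (sect G U) (\<phi> U)"
  unfolding addhom_def by (intro conjI psh_group) (auto simp: sheaf_hom_def)

lemma shom_rmap:
  "sheaf_hom X F G \<phi> \<Longrightarrow> opn U \<Longrightarrow> opn V \<Longrightarrow> V \<subseteq> U \<Longrightarrow> s \<in> carrier (sect F U) \<Longrightarrow>
     rmap G U V (\<phi> U s) = \<phi> V (rmap F U V s)"
  by (simp add: sheaf_hom_def)

text \<open>Families that agree on sections are equally good morphisms, whatever they do elsewhere:
  the carriers are closed under the module operations and restriction, so every instance of the
  conditions stays inside them.\<close>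

lemma shom_cong:
  assumes "sheaf_hom X F G \<phi>" "psh F" "\<And>U s. opn U \<Longrightarrow> s \<in> carrier (sect F U) \<Longrightarrow> \<psi> U s = \<phi> U s"
  shows "sheaf_hom X F G \<psi>"
proof -
  have "s \<oplus>\<^bsub>sect F U\<^esub> t \<in> carrier (sect F U)" if "opn U" "s \<in> carrier (sect F U)" "t \<in> carrier (sect F U)" for U s t
    using that assms(2) by (meson abelian_groupE(1) psh_group)
  then show ?thesis
    using assms by (simp add: sheaf_hom_def psh_smult_closed psh_rmap_closed)
qed

lemma shom_id: "sheaf_hom X F F (\<lambda>U s. s)"
  by (simp add: sheaf_hom_def)

lemma shom_comp:
  "sheaf_hom X F G \<phi> \<Longrightarrow> sheaf_hom X G H \<psi> \<Longrightarrow> sheaf_hom X F H (\<lambda>U s. \<psi> U (\<phi> U s))"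
  by (simp add: sheaf_hom_def)

lemma shom_zero: "psh G \<Longrightarrow> sheaf_hom X F G (\<lambda>U s. \<zero>\<^bsub>sect G U\<^esub>)"
proof -
  assume G: "psh G"
  have "\<zero>\<^bsub>sect G U\<^esub> \<in> carrier (sect G U) \<and> \<zero>\<^bsub>sect G U\<^esub> = \<zero>\<^bsub>sect G U\<^esub> \<oplus>\<^bsub>sect G U\<^esub> \<zero>\<^bsub>sect G U\<^esub>"
    if "opn U" for U
    using abelian_groupE(2,5)[OF psh_group[OF G that]] by simp
  then show ?thesis using G by (simp add: sheaf_hom_def addhom_zero[OF psh_rmap_addhom] addhom_zero[OF psh_smult_addhom])
qed

lemma shom_add:
  assumes F: "psh F" and G: "psh G" and f: "sheaf_hom X F G \<phi>" and g: "sheaf_hom X F G \<psi>"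
  shows "sheaf_hom X F G (\<lambda>U s. \<phi> U s \<oplus>\<^bsub>sect G U\<^esub> \<psi> U s)"
proof -
  have 1: "\<phi> U s \<oplus>\<^bsub>sect G U\<^esub> \<psi> U s \<in> carrier (sect G U)" if "opn U" "s \<in> carrier (sect F U)" for U s
    using that f g abelian_groupE(1)[OF psh_group[OF G that(1)]] by (simp add: sheaf_hom_def)
  have 2: "\<phi> U (s \<oplus>\<^bsub>sect F U\<^esub> t) \<oplus>\<^bsub>sect G U\<^esub> \<psi> U (s \<oplus>\<^bsub>sect F U\<^esub> t) =
     (\<phi> U s \<oplus>\<^bsub>sect G U\<^esub> \<psi> U s) \<oplus>\<^bsub>sect G U\<^esub> (\<phi> U t \<oplus>\<^bsub>sect G U\<^esub> \<psi> U t)"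
    if "opn U" "s \<in> carrier (sect F U)" "t \<in> carrier (sect F U)" for U s t
  proof -
    interpret G: abelian_group "sect G U" using G that psh_group by blast
    show ?thesis using that f g by (simp add: sheaf_hom_def G.a_ac)
  qed
  have 3: "\<phi> U (a \<odot>\<^bsub>sect F U\<^esub> s) \<oplus>\<^bsub>sect G U\<^esub> \<psi> U (a \<odot>\<^bsub>sect F U\<^esub> s) =
     a \<odot>\<^bsub>sect G U\<^esub> (\<phi> U s \<oplus>\<^bsub>sect G U\<^esub> \<psi> U s)"
    if "opn U" "s \<in> carrier (sect F U)" "a \<in> carrier (hol X U)" for U s a
    using that f g addhom_add[OF psh_smult_addhom[OF G that(1,3)]] by (simp add: sheaf_hom_def)
  have 4: "rmap G U V (\<phi> U s \<oplus>\<^bsub>sect G U\<^esub> \<psi> U s) =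
     \<phi> V (rmap F U V s) \<oplus>\<^bsub>sect G V\<^esub> \<psi> V (rmap F U V s)"
    if "opn U" "opn V" "V \<subseteq> U" "s \<in> carrier (sect F U)" for U V s
    using that f g addhom_add[OF psh_rmap_addhom[OF G that(1-3)]] by (simp add: sheaf_hom_def)
  show ?thesis using 1 2 3 4 by (simp add: sheaf_hom_def)
qed

lemma shom_neg:
  assumes F: "psh F" and G: "psh G" and f: "sheaf_hom X F G \<phi>"
  shows "sheaf_hom X F G (\<lambda>U s. \<ominus>\<^bsub>sect G U\<^esub> \<phi> U s)"
proof -
  have 1: "\<ominus>\<^bsub>sect G U\<^esub> \<phi> U s \<in> carrier (sect G U)" if "opn U" "s \<in> carrier (sect F U)" for U s
    using that f abelian_group.a_inv_closed[OF psh_group[OF G that(1)]] by (simp add: sheaf_hom_def)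
  have 2: "\<ominus>\<^bsub>sect G U\<^esub> \<phi> U (s \<oplus>\<^bsub>sect F U\<^esub> t) = (\<ominus>\<^bsub>sect G U\<^esub> \<phi> U s) \<oplus>\<^bsub>sect G U\<^esub> (\<ominus>\<^bsub>sect G U\<^esub> \<phi> U t)"
    if "opn U" "s \<in> carrier (sect F U)" "t \<in> carrier (sect F U)" for U s t
  proof -
    interpret G: abelian_group "sect G U" using G that psh_group by blast
    show ?thesis using that f by (simp add: sheaf_hom_def G.minus_add)
  qed
  have 3: "\<ominus>\<^bsub>sect G U\<^esub> \<phi> U (a \<odot>\<^bsub>sect F U\<^esub> s) = a \<odot>\<^bsub>sect G U\<^esub> (\<ominus>\<^bsub>sect G U\<^esub> \<phi> U s)"
    if "opn U" "s \<in> carrier (sect F U)" "a \<in> carrier (hol X U)" for U s a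
    using that f addhom_neg[OF psh_smult_addhom[OF G that(1,3)]] by (simp add: sheaf_hom_def)
  have 4: "rmap G U V (\<ominus>\<^bsub>sect G U\<^esub> \<phi> U s) = \<ominus>\<^bsub>sect G V\<^esub> \<phi> V (rmap F U V s)"
    if "opn U" "opn V" "V \<subseteq> U" "s \<in> carrier (sect F U)" for U V s
    using that f addhom_neg[OF psh_rmap_addhom[OF G that(1-3)]] by (simp add: sheaf_hom_def)
  show ?thesis using 1 2 3 4 by (simp add: sheaf_hom_def)
qed

lemma shom_pair:
  "sheaf_hom X F G \<phi> \<Longrightarrow> sheaf_hom X F H \<psi> \<Longrightarrow> sheaf_hom X F (dsum G H) (\<lambda>U s. spair (\<phi> U s) (\<psi> U s))"
  by (simp add: sheaf_hom_def)

lemma shom_fst: "sheaf_hom X (dsum F G) F (\<lambda>U s. sfst s)"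
  and shom_snd: "sheaf_hom X (dsum F G) G (\<lambda>U s. ssnd s)"
  by (auto simp: sheaf_hom_def dsum_carrier)

section \<open>Complexes\<close>

abbreviation "sec A i U \<equiv> sect (cob A i) U"
abbreviation Ob :: "('x, 's) cplx set" where "Ob \<equiv> Dob X"

context
  fixes A :: "('x, 's) cplx"
  assumes A: "A \<in> Ob"
begin

lemma Ob_coh [simp]: "coh (cob A i)"
  using A by (simp add: Dob_def)

lemma Ob_psh [simp]: "psh (cob A i)"
  using coh_psh by simp

lemma Ob_shom [simp]: "sheaf_hom X (cob A i) (cob A (i + 1)) (cdiff A i)"
  using A by (simp add: Dob_def)

lemma Ob_bounded: "\<exists>N. \<forall>i U. N < \<bar>i\<bar> \<and> opn U \<longrightarrow> carrier (sec A i U) = {\<zero>\<^bsub>sec A i U\<^esub>}"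
  using A unfolding Dob_def by (elim CollectE conjE)

context
  fixes U assumes U: "opn U"
begin

lemma sec_group: "abelian_group (sec A i U)"
  using U by (simp add: psh_group)

interpretation abelian_group "sec A i U" for i by (rule sec_group)

lemma sec_zero [simp]: "\<zero>\<^bsub>sec A i U\<^esub> \<in> carrier (sec A i U)" by simp
lemma sec_add [simp]: "s \<in> carrier (sec A i U) \<Longrightarrow> t \<in> carrier (sec A i U) \<Longrightarrow> s \<oplus>\<^bsub>sec A i U\<^esub> t \<in> carrier (sec A i U)"
  by simp
lemma sec_neg [simp]: "s \<in> carrier (sec A i U) \<Longrightarrow> \<ominus>\<^bsub>sec A i U\<^esub> s \<in> carrier (sec A i U)" by simp
lemma sec_simps [simp]:
  "s \<in> carrier (sec A i U) \<Longrightarrow> s \<oplus>\<^bsub>sec A i U\<^esub> \<zero>\<^bsub>sec A i U\<^esub> = s"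
  "s \<in> carrier (sec A i U) \<Longrightarrow> \<zero>\<^bsub>sec A i U\<^esub> \<oplus>\<^bsub>sec A i U\<^esub> s = s"
  "s \<in> carrier (sec A i U) \<Longrightarrow> \<ominus>\<^bsub>sec A i U\<^esub> (\<ominus>\<^bsub>sec A i U\<^esub> s) = s"
  "\<ominus>\<^bsub>sec A i U\<^esub> \<zero>\<^bsub>sec A i U\<^esub> = \<zero>\<^bsub>sec A i U\<^esub>"
  "s \<in> carrier (sec A i U) \<Longrightarrow> s \<oplus>\<^bsub>sec A i U\<^esub> (\<ominus>\<^bsub>sec A i U\<^esub> s) = \<zero>\<^bsub>sec A i U\<^esub>"
  "s \<in> carrier (sec A i U) \<Longrightarrow> (\<ominus>\<^bsub>sec A i U\<^esub> s) \<oplus>\<^bsub>sec A i U\<^esub> s = \<zero>\<^bsub>sec A i U\<^esub>"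
  by (simp_all add: r_neg l_neg)

lemmas sec_normalize = a_minus_def[of "sec A i U" for i] a_ac minus_add r_neg1 r_neg2 cancel_apart

lemma d_closed [simp]: "s \<in> carrier (sec A i U) \<Longrightarrow> cdiff A i U s \<in> carrier (sec A (i + 1) U)"
  using addhom_closed[OF shom_addhom[OF _ _ Ob_shom U]] by simp

text \<open>The degree \<open>i\<close> does not match the pattern \<open>i - 1 + 1\<close>
  syntactically, so the variant starting one degree lower is a rule of its own. Several rules below
  are doubled for the same reason.\<close>

lemma d_closed' [simp]: "s \<in> carrier (sec A (i - 1) U) \<Longrightarrow> cdiff A (i - 1) U s \<in> carrier (sec A i U)"
  using d_closed[of s "i - 1"] by simp

lemma d_simps [simp]:
  "s \<in> carrier (sec A i U) \<Longrightarrow> t \<in> carrier (sec A i U) \<Longrightarrow>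
    cdiff A i U (s \<oplus>\<^bsub>sec A i U\<^esub> t) = cdiff A i U s \<oplus>\<^bsub>sec A (i + 1) U\<^esub> cdiff A i U t"
  "s \<in> carrier (sec A i U) \<Longrightarrow> cdiff A i U (\<ominus>\<^bsub>sec A i U\<^esub> s) = \<ominus>\<^bsub>sec A (i + 1) U\<^esub> cdiff A i U s"
  "cdiff A i U \<zero>\<^bsub>sec A i U\<^esub> = \<zero>\<^bsub>sec A (i + 1) U\<^esub>"
  "s \<in> carrier (sec A i U) \<Longrightarrow> cdiff A (i + 1) U (cdiff A i U s) = \<zero>\<^bsub>sec A (i + 2) U\<^esub>"
  "s \<in> carrier (sec A (i - 1) U) \<Longrightarrow> cdiff A i U (cdiff A (i - 1) U s) = \<zero>\<^bsub>sec A (i + 1) U\<^esub>"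
proof -
  show dd: "s \<in> carrier (sec A i U) \<Longrightarrow> cdiff A (i + 1) U (cdiff A i U s) = \<zero>\<^bsub>sec A (i + 2) U\<^esub>" for s i
    using A U by (simp add: Dob_def)
  show "s \<in> carrier (sec A (i - 1) U) \<Longrightarrow> cdiff A i U (cdiff A (i - 1) U s) = \<zero>\<^bsub>sec A (i + 1) U\<^esub>"
    using dd[of s "i - 1"] by (simp add: add.commute)
qed (simp_all add: addhom_add[OF shom_addhom[OF _ _ Ob_shom U]] addhom_neg[OF shom_addhom[OF _ _ Ob_shom U]]
    addhom_zero[OF shom_addhom[OF _ _ Ob_shom U]])

context
  fixes V assumes V: "opn V" "V \<subseteq> U"
begin

lemma r_simps [simp]:
  "s \<in> carrier (sec A i U) \<Longrightarrow> rmap (cob A i) U V s \<in> carrier (sec A i V)"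
  "s \<in> carrier (sec A i U) \<Longrightarrow> t \<in> carrier (sec A i U) \<Longrightarrow>
     rmap (cob A i) U V (s \<oplus>\<^bsub>sec A i U\<^esub> t) = rmap (cob A i) U V s \<oplus>\<^bsub>sec A i V\<^esub> rmap (cob A i) U V t"
  "s \<in> carrier (sec A i U) \<Longrightarrow> rmap (cob A i) U V (\<ominus>\<^bsub>sec A i U\<^esub> s) = \<ominus>\<^bsub>sec A i V\<^esub> rmap (cob A i) U V s"
  "rmap (cob A i) U V \<zero>\<^bsub>sec A i U\<^esub> = \<zero>\<^bsub>sec A i V\<^esub>"
  "s \<in> carrier (sec A i U) \<Longrightarrow> rmap (cob A i) U U s = s"
  "s \<in> carrier (sec A i U) \<Longrightarrow> rmap (cob A (i + 1)) U V (cdiff A i U s) = cdiff A i V (rmap (cob A i) U V s)"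
  "s \<in> carrier (sec A (i - 1) U) \<Longrightarrow>
     rmap (cob A i) U V (cdiff A (i - 1) U s) = cdiff A (i - 1) V (rmap (cob A (i - 1)) U V s)"
proof -
  show d: "s \<in> carrier (sec A i U) \<Longrightarrow> rmap (cob A (i + 1)) U V (cdiff A i U s) = cdiff A i V (rmap (cob A i) U V s)" for s i
    by (rule shom_rmap[OF Ob_shom U V])
  show "s \<in> carrier (sec A (i - 1) U) \<Longrightarrow>
     rmap (cob A i) U V (cdiff A (i - 1) U s) = cdiff A (i - 1) V (rmap (cob A (i - 1)) U V s)"
    using d[of s "i - 1"] by simp
qed (simp_all add: psh_rmap_closed U V psh_rmap_id addhom_add[OF psh_rmap_addhom[OF Ob_psh U V]]
  addhom_neg[OF psh_rmap_addhom[OF Ob_psh U V]] addhom_zero[OF psh_rmap_addhom[OF Ob_psh U V]])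

lemma r_r [simp]:
  "opn W \<Longrightarrow> W \<subseteq> V \<Longrightarrow> s \<in> carrier (sec A i U) \<Longrightarrow>
     rmap (cob A i) V W (rmap (cob A i) U V s) = rmap (cob A i) U W s"
  using psh_rmap_comp[OF Ob_psh U V(1) _ _ V(2)] by simp

end

end

end

lemma ObI:
  assumes "\<And>i. coh (cob A i)" "\<And>i. sheaf_hom X (cob A i) (cob A (i + 1)) (cdiff A i)"
    "\<And>i U s. opn U \<Longrightarrow> s \<in> carrier (sec A i U) \<Longrightarrow>
       cdiff A (i + 1) U (cdiff A i U s) = \<zero>\<^bsub>sec A (i + 2) U\<^esub>"
    "\<And>i U. (N::int) < \<bar>i\<bar> \<Longrightarrow> opn U \<Longrightarrow> carrier (sec A i U) = {\<zero>\<^bsub>sec A i U\<^esub>}"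
  shows "A \<in> Ob"
  unfolding Dob_def by (intro CollectI conjI allI impI exI[of _ N]) (simp_all add: assms(1-3), simp add: assms(4))

lemma chain_mapI:
  assumes "\<And>i. sheaf_hom X (cob A i) (cob B i) (f i)"
    "\<And>i U s. opn U \<Longrightarrow> s \<in> carrier (sec A i U) \<Longrightarrow> cdiff B i U (f i U s) = f (i + 1) U (cdiff A i U s)"
  shows "chain_map X A B f"
  using assms by (simp add: chain_map_def)

lemma chain_shom: "chain_map X A B f \<Longrightarrow> sheaf_hom X (cob A i) (cob B i) (f i)"
  by (simp add: chain_map_def)

text \<open>As rewrite rules these move differentials outwards and restrictions inwards, so that
  terms reach a common normal form: differential, then chain map, then restriction.\<close>

lemma cm_simps:
  assumes A: "A \<in> Ob" and B: "B \<in> Ob" and f: "chain_map X A B f" and U: "opn U"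
  shows "s \<in> carrier (sec A i U) \<Longrightarrow> f i U s \<in> carrier (sec B i U)"
  "s \<in> carrier (sec A i U) \<Longrightarrow> t \<in> carrier (sec A i U) \<Longrightarrow> f i U (s \<oplus>\<^bsub>sec A i U\<^esub> t) = f i U s \<oplus>\<^bsub>sec B i U\<^esub> f i U t"
  "s \<in> carrier (sec A i U) \<Longrightarrow> f i U (\<ominus>\<^bsub>sec A i U\<^esub> s) = \<ominus>\<^bsub>sec B i U\<^esub> f i U s"
  "f i U \<zero>\<^bsub>sec A i U\<^esub> = \<zero>\<^bsub>sec B i U\<^esub>"
  "s \<in> carrier (sec A i U) \<Longrightarrow> f (i + 1) U (cdiff A i U s) = cdiff B i U (f i U s)"
  "s \<in> carrier (sec A (i - 1) U) \<Longrightarrow> f i U (cdiff A (i - 1) U s) = cdiff B (i - 1) U (f (i - 1) U s)"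
  "opn V \<Longrightarrow> V \<subseteq> U \<Longrightarrow> s \<in> carrier (sec A i U) \<Longrightarrow>
     rmap (cob B i) U V (f i U s) = f i V (rmap (cob A i) U V s)"
proof -
  show d: "s \<in> carrier (sec A i U) \<Longrightarrow> f (i + 1) U (cdiff A i U s) = cdiff B i U (f i U s)" for s i
    using f U by (simp add: chain_map_def)
  show "s \<in> carrier (sec A (i - 1) U) \<Longrightarrow> f i U (cdiff A (i - 1) U s) = cdiff B (i - 1) U (f (i - 1) U s)"
    using d[of s "i - 1"] by simp
  show "opn V \<Longrightarrow> V \<subseteq> U \<Longrightarrow> s \<in> carrier (sec A i U) \<Longrightarrow>
     rmap (cob B i) U V (f i U s) = f i V (rmap (cob A i) U V s)"
    by (rule shom_rmap[OF chain_shom[OF f] U])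
qed (simp_all add: addhom_closed[OF shom_addhom[OF Ob_psh[OF A] Ob_psh[OF B] chain_shom[OF f] U]]
 addhom_add[OF shom_addhom[OF Ob_psh[OF A] Ob_psh[OF B] chain_shom[OF f] U]]
 addhom_neg[OF shom_addhom[OF Ob_psh[OF A] Ob_psh[OF B] chain_shom[OF f] U]]
 addhom_zero[OF shom_addhom[OF Ob_psh[OF A] Ob_psh[OF B] chain_shom[OF f] U]])

text \<open>Graded maps without any condition on differentials. Degree \<open>- 1\<close> occurs for
  homotopies, degree 1 for twistings, and degree 0 for a homotopy whose target is a complex shifted
  by one.\<close>

definition deg :: "int \<Rightarrow> ('x, 's) cplx \<Rightarrow> ('x, 's) cplx \<Rightarrow> ('x, 's) cmap \<Rightarrow> bool" where
  "deg k A B h \<longleftrightarrow> (\<forall>i. sheaf_hom X (cob A i) (cob B (i + k)) (h i))"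

lemma deg_shom: "deg k A B h \<Longrightarrow> sheaf_hom X (cob A i) (cob B (i + k)) (h i)"
  by (simp add: deg_def)

text \<open>The premise \<open>i + k = j\<close> lets the target degree appear in whatever form the
  goal displays it, instead of the literal sum \<open>i + k\<close>.\<close>

lemma deg_simps:
  assumes A: "A \<in> Ob" and B: "B \<in> Ob" and h: "deg k A B h" and U: "opn U" and k: "i + k = j"
  shows "s \<in> carrier (sec A i U) \<Longrightarrow> h i U s \<in> carrier (sec B j U)"
  "s \<in> carrier (sec A i U) \<Longrightarrow> t \<in> carrier (sec A i U) \<Longrightarrow> h i U (s \<oplus>\<^bsub>sec A i U\<^esub> t) = h i U s \<oplus>\<^bsub>sec B j U\<^esub> h i U t"
  "s \<in> carrier (sec A i U) \<Longrightarrow> h i U (\<ominus>\<^bsub>sec A i U\<^esub> s) = \<ominus>\<^bsub>sec B j U\<^esub> h i U s"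
  "h i U \<zero>\<^bsub>sec A i U\<^esub> = \<zero>\<^bsub>sec B j U\<^esub>"
  "opn V \<Longrightarrow> V \<subseteq> U \<Longrightarrow> s \<in> carrier (sec A i U) \<Longrightarrow>
     rmap (cob B j) U V (h i U s) = h i V (rmap (cob A i) U V s)"
proof -
  note sh = deg_shom[OF h, of i, unfolded k]
  show "opn V \<Longrightarrow> V \<subseteq> U \<Longrightarrow> s \<in> carrier (sec A i U) \<Longrightarrow>
     rmap (cob B j) U V (h i U s) = h i V (rmap (cob A i) U V s)"
    by (rule shom_rmap[OF sh U])
qed (simp_all add: addhom_closed[OF shom_addhom[OF Ob_psh[OF A] Ob_psh[OF B] deg_shom[OF h, of i, unfolded k] U]]
  addhom_add[OF shom_addhom[OF Ob_psh[OF A] Ob_psh[OF B] deg_shom[OF h, of i, unfolded k] U]]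
  addhom_neg[OF shom_addhom[OF Ob_psh[OF A] Ob_psh[OF B] deg_shom[OF h, of i, unfolded k] U]]
  addhom_zero[OF shom_addhom[OF Ob_psh[OF A] Ob_psh[OF B] deg_shom[OF h, of i, unfolded k] U]])

section \<open>Chain homotopies\<close>

definition homotopy_by ::
  "('x, 's) cplx \<Rightarrow> ('x, 's) cplx \<Rightarrow> ('x, 's) cmap \<Rightarrow> ('x, 's) cmap \<Rightarrow> ('x, 's) cmap \<Rightarrow> bool" where
  "homotopy_by A B h f g \<longleftrightarrow> deg (- 1) A B h \<and>
     (\<forall>i U s. opn U \<longrightarrow> s \<in> carrier (sec A i U) \<longrightarrow>
        f i U s = g i U s \<oplus>\<^bsub>sec B i U\<^esub> (cdiff B (i - 1) U (h i U s) \<oplus>\<^bsub>sec B i U\<^esub> h (i + 1) U (cdiff A i U s)))"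

lemma homotopic_iff: "homotopic X A B f g \<longleftrightarrow> (\<exists>h. homotopy_by A B h f g)"
  by (auto simp: homotopic_def deg_def homotopy_by_def)

lemma homotopy_byD:
  assumes "homotopy_by A B h f g"
  shows "deg (- 1) A B h" "\<And>i U s. opn U \<Longrightarrow> s \<in> carrier (sec A i U) \<Longrightarrow>
     f i U s = g i U s \<oplus>\<^bsub>sec B i U\<^esub> (cdiff B (i - 1) U (h i U s) \<oplus>\<^bsub>sec B i U\<^esub> h (i + 1) U (cdiff A i U s))"
  using assms by (simp_all add: homotopy_by_def)

lemma homotopicE:
  assumes "homotopic X A B f g"
  obtains h where "homotopy_by A B h f g"
  using assms by (auto simp: homotopic_iff)

lemma homotopicI:
  assumes "deg (- 1) A B h" "\<And>i U s. opn U \<Longrightarrow> s \<in> carrier (sec A i U) \<Longrightarrow>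
     f i U s = g i U s \<oplus>\<^bsub>sec B i U\<^esub> (cdiff B (i - 1) U (h i U s) \<oplus>\<^bsub>sec B i U\<^esub> h (i + 1) U (cdiff A i U s))"
  shows "homotopic X A B f g"
  unfolding homotopic_iff homotopy_by_def by (intro exI[of _ h] conjI allI impI assms)

lemma deg_zero: "B \<in> Ob \<Longrightarrow> deg k A B (\<lambda>i U s. \<zero>\<^bsub>sec B (i + k) U\<^esub>)"
  by (simp add: deg_def shom_zero)

text \<open>The zero homotopy relates maps that differ only outside the sections.\<close>

lemma homotopic_eqI:
  assumes "A \<in> Ob" and B: "B \<in> Ob" and g: "chain_map X A B g"
    and "\<And>i U s. opn U \<Longrightarrow> s \<in> carrier (sec A i U) \<Longrightarrow> f i U s = g i U s"
  shows "homotopic X A B f g"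
  by (rule homotopicI[OF deg_zero[OF B]]) (simp add: assms cm_simps[OF assms(1-3)])

lemma homotopic_refl: "A \<in> Ob \<Longrightarrow> B \<in> Ob \<Longrightarrow> chain_map X A B f \<Longrightarrow> homotopic X A B f f"
  by (rule homotopic_eqI) simp_all

lemma homotopic_sym:
  assumes A: "A \<in> Ob" and B: "B \<in> Ob" and f: "chain_map X A B f" and g: "chain_map X A B g"
    and fg: "homotopic X A B f g"
  shows "homotopic X A B g f"
proof -
  obtain h where nh: "homotopy_by A B h f g" using fg by (rule homotopicE)
  note h = homotopy_byD(1)[OF nh] and eq = homotopy_byD(2)[OF nh]
  note [simp] = A B cm_simps[OF A B f] cm_simps[OF A B g] deg_simps[OF A B h]
  show ?thesis
  proof (rule homotopicI)
    show "deg (- 1) A B (\<lambda>i U s. \<ominus>\<^bsub>sec B (i - 1) U\<^esub> h i U s)"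
      using h by (auto simp: deg_def intro!: shom_neg)
  qed (simp add: eq sec_normalize[OF B])
qed

lemma homotopic_trans:
  assumes A: "A \<in> Ob" and B: "B \<in> Ob" and k: "chain_map X A B k"
    and fg: "homotopic X A B f g" and gk: "homotopic X A B g k"
  shows "homotopic X A B f k"
proof -
  obtain h where nh: "homotopy_by A B h f g" using fg by (rule homotopicE)
  note h = homotopy_byD(1)[OF nh] and eq = homotopy_byD(2)[OF nh]
  obtain h' where nh': "homotopy_by A B h' g k" using gk by (rule homotopicE)
  note h' = homotopy_byD(1)[OF nh'] and eq' = homotopy_byD(2)[OF nh']
  note [simp] = A B cm_simps[OF A B k] deg_simps[OF A B h] deg_simps[OF A B h']
  show ?thesis
  proof (rule homotopicI)
    show "deg (- 1) A B (\<lambda>i U s. h i U s \<oplus>\<^bsub>sec B (i - 1) U\<^esub> h' i U s)"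
      using h h' by (auto simp: deg_def intro!: shom_add)
  qed (simp add: eq eq' sec_normalize[OF B])
qed

lemma homotopic_ccomp_left:
  assumes A: "A \<in> Ob" and B: "B \<in> Ob" and C: "C \<in> Ob" and g: "chain_map X A B g"
    and k: "chain_map X B C k" and fg: "homotopic X A B f g"
  shows "homotopic X A C (ccomp k f) (ccomp k g)"
proof -
  obtain h where nh: "homotopy_by A B h f g" using fg by (rule homotopicE)
  note h = homotopy_byD(1)[OF nh] and eq = homotopy_byD(2)[OF nh]
  note [simp] = A B C cm_simps[OF A B g] cm_simps[OF B C k] deg_simps[OF A B h]
  show ?thesis
  proof (rule homotopicI)
    show "deg (- 1) A C (\<lambda>i U s. k (i - 1) U (h i U s))"
      using shom_comp[OF deg_shom[OF h] chain_shom[OF k]] by (simp add: deg_def)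
  qed (simp add: eq ccomp_def)
qed

lemma homotopic_ccomp_right:
  assumes A: "A \<in> Ob" and B: "B \<in> Ob" and C: "C \<in> Ob"
    and k: "chain_map X A B k" and fg: "homotopic X B C f g"
  shows "homotopic X A C (ccomp f k) (ccomp g k)"
proof -
  obtain h where nh: "homotopy_by B C h f g" using fg by (rule homotopicE)
  note h = homotopy_byD(1)[OF nh] and eq = homotopy_byD(2)[OF nh]
  note [simp] = A B C cm_simps[OF A B k] deg_simps[OF B C h]
  show ?thesis
  proof (rule homotopicI)
    show "deg (- 1) A C (\<lambda>i U s. h i U (k i U s))"
      using shom_comp[OF chain_shom[OF k] deg_shom[OF h]] by (simp add: deg_def)
  qed (simp add: eq ccomp_def)
qed

lemma chain_id: "chain_map X A A cid"
  by (auto simp: chain_map_def cid_def shom_id)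

lemma chain_comp:
  assumes "A \<in> Ob" "B \<in> Ob" "C \<in> Ob" "chain_map X A B f" "chain_map X B C g"
  shows "chain_map X A C (ccomp g f)"
  unfolding ccomp_def
  by (intro chain_mapI shom_comp[OF chain_shom[OF assms(4)] chain_shom[OF assms(5)]])
    (simp add: assms cm_simps[OF assms(1,2,4)] cm_simps[OF assms(2,3,5)])

lemma chain_zero: "A \<in> Ob \<Longrightarrow> B \<in> Ob \<Longrightarrow> chain_map X A B (czero B)"
  unfolding czero_def by (intro chain_mapI shom_zero) simp_all

lemma ccomp_assoc: "ccomp (ccomp h g) f = ccomp h (ccomp g f)"
  and ccomp_cid [simp]: "ccomp f cid = f" "ccomp cid f = f"
  by (simp_all add: ccomp_def cid_def)

section \<open>Quasi-isomorphisms\<close>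

text \<open>Exactness of the mapping cone on stalks; in this form a quasi-isomorphism is characterised by a
  single condition.\<close>

definition cone_exact :: "('x, 's) cplx \<Rightarrow> ('x, 's) cplx \<Rightarrow> ('x, 's) cmap \<Rightarrow> bool" where
  "cone_exact A B f \<longleftrightarrow> (\<forall>i U x a b. opn U \<longrightarrow> x \<in> U \<longrightarrow>
     a \<in> carrier (sec A (i + 1) U) \<longrightarrow> b \<in> carrier (sec B i U) \<longrightarrow>
     cdiff A (i + 1) U a = \<zero>\<^bsub>sec A (i + 2) U\<^esub> \<longrightarrow> f (i + 1) U a = cdiff B i U b \<longrightarrow>
     (\<exists>W a' b'. opn W \<and> x \<in> W \<and> W \<subseteq> U \<and> a' \<in> carrier (sec A i W) \<and> b' \<in> carrier (sec B (i - 1) W) \<and>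
        rmap (cob A (i + 1)) U W a = cdiff A i W a' \<and>
        rmap (cob B i) U W b = f i W a' \<oplus>\<^bsub>sec B i W\<^esub> cdiff B (i - 1) W b'))"

lemma cone_exactE:
  assumes "cone_exact A B f" "opn U" "x \<in> U" "a \<in> carrier (sec A (i + 1) U)" "b \<in> carrier (sec B i U)"
    "cdiff A (i + 1) U a = \<zero>\<^bsub>sec A (i + 2) U\<^esub>" "f (i + 1) U a = cdiff B i U b"
  obtains W a' b' where "opn W" "x \<in> W" "W \<subseteq> U" "a' \<in> carrier (sec A i W)" "b' \<in> carrier (sec B (i - 1) W)"
    "rmap (cob A (i + 1)) U W a = cdiff A i W a'"
    "rmap (cob B i) U W b = f i W a' \<oplus>\<^bsub>sec B i W\<^esub> cdiff B (i - 1) W b'"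
proof -
  have "\<exists>W a' b'. opn W \<and> x \<in> W \<and> W \<subseteq> U \<and> a' \<in> carrier (sec A i W) \<and> b' \<in> carrier (sec B (i - 1) W) \<and>
        rmap (cob A (i + 1)) U W a = cdiff A i W a' \<and>
        rmap (cob B i) U W b = f i W a' \<oplus>\<^bsub>sec B i W\<^esub> cdiff B (i - 1) W b'"
    using assms(1)[unfolded cone_exact_def, rule_format, OF assms(2-7)] .
  then show ?thesis by (elim exE conjE) (rule that)
qed

lemma cone_exactI:
  assumes "\<And>i U x a b. opn U \<Longrightarrow> x \<in> U \<Longrightarrow>
     a \<in> carrier (sec A (i + 1) U) \<Longrightarrow> b \<in> carrier (sec B i U) \<Longrightarrow>
     cdiff A (i + 1) U a = \<zero>\<^bsub>sec A (i + 2) U\<^esub> \<Longrightarrow> f (i + 1) U a = cdiff B i U b \<Longrightarrow>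
     \<exists>W a' b'. opn W \<and> x \<in> W \<and> W \<subseteq> U \<and> a' \<in> carrier (sec A i W) \<and> b' \<in> carrier (sec B (i - 1) W) \<and>
        rmap (cob A (i + 1)) U W a = cdiff A i W a' \<and>
        rmap (cob B i) U W b = f i W a' \<oplus>\<^bsub>sec B i W\<^esub> cdiff B (i - 1) W b'"
  shows "cone_exact A B f"
  unfolding cone_exact_def by (intro allI impI assms)

section \<open>Stalks of the cohomology sheaves\<close>

lemma cocycles_iff:
  "(U, s) \<in> cocycles_at X A i x \<longleftrightarrow> opn U \<and> x \<in> U \<and> s \<in> carrier (sec A i U) \<and>
     cdiff A i U s = \<zero>\<^bsub>sec A (i + 1) U\<^esub>"
  by (simp add: cocycles_at_def)

text \<open>Free of subtraction, this form fits the additive normalisation of sections.\<close>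

lemma cohomologous_iff:
  "((U, s), (V, t)) \<in> cohomologous_at X A i x \<longleftrightarrow>
     (U, s) \<in> cocycles_at X A i x \<and> (V, t) \<in> cocycles_at X A i x \<and>
     (\<exists>W r. opn W \<and> x \<in> W \<and> W \<subseteq> U \<and> W \<subseteq> V \<and> r \<in> carrier (sec A (i - 1) W) \<and>
        rmap (cob A i) U W s = rmap (cob A i) V W t \<oplus>\<^bsub>sec A i W\<^esub> cdiff A (i - 1) W r)"
  if A: "A \<in> Ob"
proof -
  have "rmap (cob A i) U W s \<ominus>\<^bsub>sec A i W\<^esub> rmap (cob A i) V W t = cdiff A (i - 1) W r \<longleftrightarrow>
     rmap (cob A i) U W s = rmap (cob A i) V W t \<oplus>\<^bsub>sec A i W\<^esub> cdiff A (i - 1) W r"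
    if "(U, s) \<in> cocycles_at X A i x" "(V, t) \<in> cocycles_at X A i x"
      "opn W" "W \<subseteq> U" "W \<subseteq> V" "r \<in> carrier (sec A (i - 1) W)" for W r
  proof -
    interpret abelian_group "sec A i W" using A that sec_group by blast
    show ?thesis
      using that A by (simp add: cocycles_iff a_minus_def minus_eq_iff_eq_add)
  qed
  then show ?thesis by (auto simp: cohomologous_at_def)
qed

lemma equiv_cohomologous:
  assumes A: "A \<in> Ob"
  shows "equiv (cocycles_at X A i x) (cohomologous_at X A i x)"
proof (rule equivI)
  show "cohomologous_at X A i x \<subseteq> cocycles_at X A i x \<times> cocycles_at X A i x"
    by (auto simp: cohomologous_at_def)
  show "refl_on (cocycles_at X A i x) (cohomologous_at X A i x)"
  proof (rule refl_onI; clarify)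
    fix U s assume s: "(U, s) \<in> cocycles_at X A i x"
    then show "((U, s), (U, s)) \<in> cohomologous_at X A i x"
      unfolding cohomologous_iff[OF A]
      by (intro conjI exI[of _ U] exI[of _ "\<zero>\<^bsub>sec A (i - 1) U\<^esub>"]) (auto simp: cocycles_iff A)
  qed
  show "sym (cohomologous_at X A i x)"
  proof (rule symI; clarify)
    fix U s V t assume st: "((U, s), (V, t)) \<in> cohomologous_at X A i x"
    then obtain W r where W: "opn W" "x \<in> W" "W \<subseteq> U" "W \<subseteq> V" "r \<in> carrier (sec A (i - 1) W)"
      "rmap (cob A i) U W s = rmap (cob A i) V W t \<oplus>\<^bsub>sec A i W\<^esub> cdiff A (i - 1) W r"
      unfolding cohomologous_iff[OF A] by blast
    have "(U, s) \<in> cocycles_at X A i x" "(V, t) \<in> cocycles_at X A i x"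
      using st by (simp_all add: cohomologous_iff[OF A])
    with W show "((V, t), (U, s)) \<in> cohomologous_at X A i x"
      unfolding cohomologous_iff[OF A]
      by (intro conjI exI[of _ W] exI[of _ "\<ominus>\<^bsub>sec A (i - 1) W\<^esub> r"])
        (auto simp: cocycles_iff A sec_normalize[OF A])
  qed
  show "trans (cohomologous_at X A i x)"
  proof (rule transI; clarify)
    fix U s V t Y q
    assume st: "((U, s), (V, t)) \<in> cohomologous_at X A i x" and tq: "((V, t), (Y, q)) \<in> cohomologous_at X A i x"
    obtain W r where W: "opn W" "x \<in> W" "W \<subseteq> U" "W \<subseteq> V" "r \<in> carrier (sec A (i - 1) W)"
      "rmap (cob A i) U W s = rmap (cob A i) V W t \<oplus>\<^bsub>sec A i W\<^esub> cdiff A (i - 1) W r"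
      using st unfolding cohomologous_iff[OF A] by blast
    obtain W' r' where W': "opn W'" "x \<in> W'" "W' \<subseteq> V" "W' \<subseteq> Y" "r' \<in> carrier (sec A (i - 1) W')"
      "rmap (cob A i) V W' t = rmap (cob A i) Y W' q \<oplus>\<^bsub>sec A i W'\<^esub> cdiff A (i - 1) W' r'"
      using tq unfolding cohomologous_iff[OF A] by blast
    \<comment> \<open>Both comparisons are restricted to a common neighbourhood, where the two
      primitives can be added.\<close>
    define Z where "Z = W \<inter> W'"
    have Z: "opn Z" "x \<in> Z" "Z \<subseteq> W" "Z \<subseteq> W'" "Z \<subseteq> U" "Z \<subseteq> Y" "Z \<subseteq> V" using W W' by (auto simp: Z_def)
    have c: "opn U" "opn V" "opn Y" "s \<in> carrier (sec A i U)" "t \<in> carrier (sec A i V)" "q \<in> carrier (sec A i Y)"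
      using st tq by (simp_all add: cohomologous_iff[OF A] cocycles_iff)
    have "rmap (cob A i) W Z (rmap (cob A i) U W s) =
        rmap (cob A i) W Z (rmap (cob A i) V W t) \<oplus>\<^bsub>sec A i Z\<^esub> cdiff A (i - 1) Z (rmap (cob A (i - 1)) W Z r)"
      unfolding W(6) using W Z c A by (simp del: r_r)
    moreover have "rmap (cob A i) W' Z (rmap (cob A i) V W' t) =
        rmap (cob A i) W' Z (rmap (cob A i) Y W' q) \<oplus>\<^bsub>sec A i Z\<^esub> cdiff A (i - 1) Z (rmap (cob A (i - 1)) W' Z r')"
      unfolding W'(6) using W' Z c A by (simp del: r_r)
    ultimately have "rmap (cob A i) U Z s = rmap (cob A i) Y Z q \<oplus>\<^bsub>sec A i Z\<^esub>
       cdiff A (i - 1) Z (rmap (cob A (i - 1)) W' Z r' \<oplus>\<^bsub>sec A (i - 1) Z\<^esub> rmap (cob A (i - 1)) W Z r)"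
      using W(1-5) W'(1-5) Z c A by (simp add: sec_normalize[OF A])
    with st tq show "((U, s), (Y, q)) \<in> cohomologous_at X A i x"
      unfolding cohomologous_iff[OF A] using W W' Z A
      by (intro conjI exI[of _ Z] exI[of _ "rmap (cob A (i - 1)) W' Z r' \<oplus>\<^bsub>sec A (i - 1) Z\<^esub> rmap (cob A (i - 1)) W Z r"]) auto
  qed
qed

lemma bij_cohomology_map_iff:
  assumes A: "A \<in> Ob" and B: "B \<in> Ob" and f: "chain_map X A B f"
  shows "bij_betw (cohomology_map X B f i x) (cohomology_stalk X A i x) (cohomology_stalk X B i x) \<longleftrightarrow>
    (\<forall>U s V t. (U, s) \<in> cocycles_at X A i x \<longrightarrow> (V, t) \<in> cocycles_at X A i x \<longrightarrow>
      ((U, f i U s), (V, f i V t)) \<in> cohomologous_at X B i x \<longrightarrow> ((U, s), (V, t)) \<in> cohomologous_at X A i x) \<and>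
    (\<forall>V t. (V, t) \<in> cocycles_at X B i x \<longrightarrow>
      (\<exists>U s. (U, s) \<in> cocycles_at X A i x \<and> ((U, f i U s), (V, t)) \<in> cohomologous_at X B i x))"
proof -
  define h where "h = (\<lambda>(U, s). (U, f i U s))"
  have map: "cohomology_map X B f i x = (\<lambda>c. cohomologous_at X B i x `` (h ` c))"
    by (intro ext) (force simp: cohomology_map_def h_def)
  have "(h a, h b) \<in> cohomologous_at X B i x" if "(a, b) \<in> cohomologous_at X A i x" for a b
  proof -
    obtain U s V t where ab: "a = (U, s)" "b = (V, t)" by fastforce
    note [simp] = A B cm_simps[OF A B f]
    from that obtain W r where W: "opn W" "x \<in> W" "W \<subseteq> U" "W \<subseteq> V" "r \<in> carrier (sec A (i - 1) W)"
      "rmap (cob A i) U W s = rmap (cob A i) V W t \<oplus>\<^bsub>sec A i W\<^esub> cdiff A (i - 1) W r"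
      unfolding ab cohomologous_iff[OF A] by blast
    have c: "(U, s) \<in> cocycles_at X A i x" "(V, t) \<in> cocycles_at X A i x"
      using that by (simp_all add: ab cohomologous_iff[OF A])
    have c': "cdiff B i U (f i U s) = \<zero>\<^bsub>sec B (i + 1) U\<^esub>" "cdiff B i V (f i V t) = \<zero>\<^bsub>sec B (i + 1) V\<^esub>"
      using c cm_simps(5)[OF A B f, of U s i, symmetric] cm_simps(5)[OF A B f, of V t i, symmetric]
      by (simp_all add: cocycles_iff)
    show ?thesis
      unfolding ab h_def split_conv cohomologous_iff[OF B] using W c c'
      by (intro conjI exI[of _ W] exI[of _ "f (i - 1) W r"]) (auto simp: cocycles_iff)
  qed
  from quotient_map_bij_iff[OF equiv_cohomologous[OF A] equiv_cohomologous[OF B] this]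
  show ?thesis unfolding map cohomology_stalk_def by (simp add: h_def Ball_def Bex_def)
qed

text \<open>Injectivity in degree \<open>i + 1\<close> gives \<open>a = d r\<close> near
  \<open>x\<close>. Then \<open>b - f r\<close> is a cocycle, and surjectivity in degree
  \<open>i\<close> replaces it by \<open>f s\<close> up to a boundary with \<open>s\<close> a
  cocycle of \<open>A\<close>; the section sought is \<open>r + s\<close>. In terms of the mapping
  cone, the pair tested is the cocycle \<open>(a, - b)\<close>.\<close>

lemma quasi_iso_imp_cone_exact:
  assumes A: "A \<in> Ob" and B: "B \<in> Ob" and q: "quasi_iso X A B f"
  shows "cone_exact A B f"
proof (rule cone_exactI)
  have f: "chain_map X A B f" using q by (simp add: quasi_iso_def)
  note [simp] = A B cm_simps[OF A B f]
  fix i U x a b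
  assume U: "opn U" "x \<in> U" and a: "a \<in> carrier (sec A (i + 1) U)" and b: "b \<in> carrier (sec B i U)"
    and da: "cdiff A (i + 1) U a = \<zero>\<^bsub>sec A (i + 2) U\<^esub>" and fa: "f (i + 1) U a = cdiff B i U b"
  have x: "x \<in> topspace (points X)" using U openin_subset by blast
  have bij: "bij_betw (cohomology_map X B f i x) (cohomology_stalk X A i x) (cohomology_stalk X B i x)" for i
    using q x by (simp add: quasi_iso_def)
  have "(U, a) \<in> cocycles_at X A (i + 1) x" "(U, \<zero>\<^bsub>sec A (i + 1) U\<^esub>) \<in> cocycles_at X A (i + 1) x"
    using U a da by (simp_all add: cocycles_iff add.assoc)
  moreover have "((U, f (i + 1) U a), (U, f (i + 1) U \<zero>\<^bsub>sec A (i + 1) U\<^esub>)) \<in> cohomologous_at X B (i + 1) x"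
    unfolding cohomologous_iff[OF B] using U a b fa
    by (intro conjI exI[of _ U] exI[of _ b]) (auto simp: cocycles_iff add.assoc)
  ultimately have "((U, a), (U, \<zero>\<^bsub>sec A (i + 1) U\<^esub>)) \<in> cohomologous_at X A (i + 1) x"
    using bij[of "i + 1"] unfolding bij_cohomology_map_iff[OF A B f] by blast
  then obtain W r where W: "opn W" "x \<in> W" "W \<subseteq> U" "r \<in> carrier (sec A i W)" "rmap (cob A (i + 1)) U W a = cdiff A i W r"
    using U by (auto simp: cohomologous_iff[OF A])
  \<comment> \<open>The defect that remains after \<open>r\<close>; it is closed because
    \<open>f r\<close> and \<open>b\<close> have the same differential on \<open>W\<close>.\<close>
  define c where "c = rmap (cob B i) U W b \<oplus>\<^bsub>sec B i W\<^esub> (\<ominus>\<^bsub>sec B i W\<^esub> f i W r)"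
  have "rmap (cob B (i + 1)) U W (f (i + 1) U a) = f (i + 1) W (cdiff A i W r)"
    using U W a by (simp del: cm_simps(5)[OF A B f])
  then have fr: "cdiff B i W (rmap (cob B i) U W b) = cdiff B i W (f i W r)"
    using U W b unfolding fa by simp
  have "(W, c) \<in> cocycles_at X B i x"
    using U W b fr by (simp add: cocycles_iff c_def sec_simps(5)[OF B])
  then obtain V s where V: "(V, s) \<in> cocycles_at X A i x" "((V, f i V s), (W, c)) \<in> cohomologous_at X B i x"
    using bij[of i] unfolding bij_cohomology_map_iff[OF A B f] by blast
  then obtain Z t where Z: "opn Z" "x \<in> Z" "Z \<subseteq> V" "Z \<subseteq> W" "t \<in> carrier (sec B (i - 1) Z)"
     and Zeq: "rmap (cob B i) V Z (f i V s) = rmap (cob B i) W Z c \<oplus>\<^bsub>sec B i Z\<^esub> cdiff B (i - 1) Z t"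
    unfolding cohomologous_iff[OF B] by blast
  have s: "opn V" "s \<in> carrier (sec A i V)" "cdiff A i V s = \<zero>\<^bsub>sec A (i + 1) V\<^esub>" using V by (auto simp: cocycles_iff)
  have ZU: "Z \<subseteq> U" using Z W by auto
  have ds: "cdiff A i Z (rmap (cob A i) V Z s) = \<zero>\<^bsub>sec A (i + 1) Z\<^esub>"
    using r_simps(6)[OF A s(1) Z(1,3) s(2), symmetric] s Z by simp
  have rc: "rmap (cob B i) W Z c = rmap (cob B i) U Z b \<oplus>\<^bsub>sec B i Z\<^esub> (\<ominus>\<^bsub>sec B i Z\<^esub> f i Z (rmap (cob A i) W Z r))"
    unfolding c_def using U W Z b by simp
  have fs: "rmap (cob B i) V Z (f i V s) = f i Z (rmap (cob A i) V Z s)" using s Z by simp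
  let ?a = "rmap (cob A i) W Z r \<oplus>\<^bsub>sec A i Z\<^esub> rmap (cob A i) V Z s" and ?b = "\<ominus>\<^bsub>sec B (i - 1) Z\<^esub> t"
  have "rmap (cob A (i + 1)) U Z a = rmap (cob A (i + 1)) W Z (rmap (cob A (i + 1)) U W a)"
    using U W(1-4) Z a by simp
  also have "\<dots> = cdiff A i Z ?a" unfolding W(5) using W Z s ds by simp
  finally have 1: "rmap (cob A (i + 1)) U Z a = cdiff A i Z ?a" .
  have 2: "rmap (cob B i) U Z b = f i Z ?a \<oplus>\<^bsub>sec B i Z\<^esub> cdiff B (i - 1) Z ?b"
    using U W Z ZU b s Zeq unfolding rc fs by (simp add: sec_normalize[OF B])
  show "\<exists>W a' b'. opn W \<and> x \<in> W \<and> W \<subseteq> U \<and> a' \<in> carrier (sec A i W) \<and> b' \<in> carrier (sec B (i - 1) W) \<and>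
        rmap (cob A (i + 1)) U W a = cdiff A i W a' \<and>
        rmap (cob B i) U W b = f i W a' \<oplus>\<^bsub>sec B i W\<^esub> cdiff B (i - 1) W b'"
    using Z ZU W s 1 2 by (intro exI[of _ Z] exI[of _ ?a] exI[of _ ?b]) simp
qed

text \<open>Injectivity is exactness in degree \<open>i - 1\<close>, applied to the difference of
  two cocycles with cohomologous images. Surjectivity is exactness in degree \<open>i\<close>,
  applied to the zero section of \<open>A\<close> and the given cocycle of \<open>B\<close>.\<close>

lemma cone_exact_imp_quasi_iso:
  assumes A: "A \<in> Ob" and B: "B \<in> Ob" and f: "chain_map X A B f" and ce: "cone_exact A B f"
  shows "quasi_iso X A B f"
  unfolding quasi_iso_def bij_cohomology_map_iff[OF A B f]
proof (intro conjI f allI impI ballI)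
  note [simp] = A B cm_simps[OF A B f]
  {
    fix i x U s V t
    assume s: "(U, s) \<in> cocycles_at X A i x" and t: "(V, t) \<in> cocycles_at X A i x"
      and "((U, f i U s), (V, f i V t)) \<in> cohomologous_at X B i x"
    then obtain W r where W: "opn W" "x \<in> W" "W \<subseteq> U" "W \<subseteq> V" "r \<in> carrier (sec B (i - 1) W)"
      and eq: "rmap (cob B i) U W (f i U s) = rmap (cob B i) V W (f i V t) \<oplus>\<^bsub>sec B i W\<^esub> cdiff B (i - 1) W r"
      unfolding cohomologous_iff[OF B] by blast
    have c: "opn U" "s \<in> carrier (sec A i U)" "opn V" "t \<in> carrier (sec A i V)"
       "cdiff A i U s = \<zero>\<^bsub>sec A (i + 1) U\<^esub>" "cdiff A i V t = \<zero>\<^bsub>sec A (i + 1) V\<^esub>"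
      using s t by (simp_all add: cocycles_iff)
    have d: "cdiff A i W (rmap (cob A i) U W s) = \<zero>\<^bsub>sec A (i + 1) W\<^esub>"
       "cdiff A i W (rmap (cob A i) V W t) = \<zero>\<^bsub>sec A (i + 1) W\<^esub>"
      using r_simps(6)[OF A c(1) W(1,3) c(2), symmetric] r_simps(6)[OF A c(3) W(1,4) c(4), symmetric] c W by simp_all
    let ?a = "rmap (cob A i) U W s \<oplus>\<^bsub>sec A i W\<^esub> (\<ominus>\<^bsub>sec A i W\<^esub> rmap (cob A i) V W t)"
    have 1: "?a \<in> carrier (sec A (i - 1 + 1) W)" using W c by simp
    have 2: "cdiff A (i - 1 + 1) W ?a = \<zero>\<^bsub>sec A (i - 1 + 2) W\<^esub>" using W c d by (simp add: add.commute)
    have 3: "f (i - 1 + 1) W ?a = cdiff B (i - 1) W r"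
      using eq W c by (simp add: sec_normalize[OF B])
    obtain Z a' where Z: "opn Z" "x \<in> Z" "Z \<subseteq> W" "a' \<in> carrier (sec A (i - 1) Z)"
      "rmap (cob A (i - 1 + 1)) W Z ?a = cdiff A (i - 1) Z a'"
      by (rule cone_exactE[OF ce W(1,2) 1 W(5) 2 3]) (rule that)
    have ZU: "Z \<subseteq> U" "Z \<subseteq> V" using Z W by auto
    have "rmap (cob A i) U Z s \<oplus>\<^bsub>sec A i Z\<^esub> (\<ominus>\<^bsub>sec A i Z\<^esub> rmap (cob A i) V Z t) = cdiff A (i - 1) Z a'"
      using Z W c by simp
    then have "rmap (cob A i) U Z s = rmap (cob A i) V Z t \<oplus>\<^bsub>sec A i Z\<^esub> cdiff A (i - 1) Z a'"
      using Z W ZU c A by (simp add: abelian_group.minus_eq_iff_eq_add[OF sec_group])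
    with s t Z ZU show "((U, s), (V, t)) \<in> cohomologous_at X A i x"
      unfolding cohomologous_iff[OF A] by blast
  next
    fix i x V t assume t: "(V, t) \<in> cocycles_at X B i x"
    then have c: "opn V" "x \<in> V" "t \<in> carrier (sec B i V)" "cdiff B i V t = \<zero>\<^bsub>sec B (i + 1) V\<^esub>"
      by (simp_all add: cocycles_iff)
    have 0: "\<zero>\<^bsub>sec A (i + 1) V\<^esub> \<in> carrier (sec A (i + 1) V)"
      "cdiff A (i + 1) V \<zero>\<^bsub>sec A (i + 1) V\<^esub> = \<zero>\<^bsub>sec A (i + 2) V\<^esub>"
      "f (i + 1) V \<zero>\<^bsub>sec A (i + 1) V\<^esub> = cdiff B i V t"
      using c by (simp_all add: add.assoc)
    obtain W a' b' where W: "opn W" "x \<in> W" "W \<subseteq> V" "a' \<in> carrier (sec A i W)" "b' \<in> carrier (sec B (i - 1) W)"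
      and e1: "rmap (cob A (i + 1)) V W \<zero>\<^bsub>sec A (i + 1) V\<^esub> = cdiff A i W a'"
      and e2: "rmap (cob B i) V W t = f i W a' \<oplus>\<^bsub>sec B i W\<^esub> cdiff B (i - 1) W b'"
      by (rule cone_exactE[OF ce c(1,2) 0(1) c(3) 0(2,3)])
    have da: "cdiff A i W a' = \<zero>\<^bsub>sec A (i + 1) W\<^esub>" using e1 c W by simp
    then have 1: "(W, a') \<in> cocycles_at X A i x" using W by (simp add: cocycles_iff)
    have "cdiff B i W (f i W a') = \<zero>\<^bsub>sec B (i + 1) W\<^esub>"
      using cm_simps(5)[OF A B f W(1,4), symmetric] da W by simp
    then have 2: "(W, f i W a') \<in> cocycles_at X B i x" using W by (simp add: cocycles_iff)
    have "((W, f i W a'), (V, t)) \<in> cohomologous_at X B i x"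
      unfolding cohomologous_iff[OF B] using 2 t W e2
      by (intro conjI exI[of _ W] exI[of _ "\<ominus>\<^bsub>sec B (i - 1) W\<^esub> b'"]) (auto simp: sec_normalize[OF B])
    with 1 show "\<exists>U s. (U, s) \<in> cocycles_at X A i x \<and> ((U, f i U s), (V, t)) \<in> cohomologous_at X B i x"
      by blast
  }
qed

lemma quasi_iso_iff:
  "A \<in> Ob \<Longrightarrow> B \<in> Ob \<Longrightarrow> quasi_iso X A B f \<longleftrightarrow> chain_map X A B f \<and> cone_exact A B f"
  using quasi_iso_imp_cone_exact cone_exact_imp_quasi_iso by (auto simp: quasi_iso_def)

end

text \<open>Degrees occur inside terms such as \<open>cob A i\<close>, so equal degrees have to be
  rewritten to the same expression before facts about sections match.\<close>

lemma int_index_simps [simp]: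
  "(i::int) - 1 + 2 = i + 1" "i + 2 + - 1 = i + 1" "i + 2 - 1 = i + 1" "i + 1 + 1 = i + 2"
  by simp_all

context coherent_sheaves
begin

section \<open>Closure properties of quasi-isomorphisms\<close>

lemma d_closed_2 [simp]:
  "A \<in> Ob \<Longrightarrow> opn U \<Longrightarrow> s \<in> carrier (sec A (i - 2) U) \<Longrightarrow> cdiff A (i - 2) U s \<in> carrier (sec A (i - 1) U)"
  using d_closed'[of A U s "i - 1"] by simp

lemma qis_chain: "quasi_iso X A B f \<Longrightarrow> chain_map X A B f"
  by (simp add: quasi_iso_def)

lemma qis_id:
  assumes A: "A \<in> Ob"
  shows "quasi_iso X A A cid"
  unfolding quasi_iso_iff[OF A A]
proof (intro conjI chain_id cone_exactI)
  fix i U x a b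
  assume "opn U" "x \<in> U" "a \<in> carrier (sec A (i + 1) U)" "b \<in> carrier (sec A i U)" "cid (i + 1) U a = cdiff A i U b"
  then show "\<exists>W a' b'. opn W \<and> x \<in> W \<and> W \<subseteq> U \<and> a' \<in> carrier (sec A i W) \<and> b' \<in> carrier (sec A (i - 1) W) \<and>
        rmap (cob A (i + 1)) U W a = cdiff A i W a' \<and>
        rmap (cob A i) U W b = cid i W a' \<oplus>\<^bsub>sec A i W\<^esub> cdiff A (i - 1) W b'"
    using A by (intro exI[of _ U] exI[of _ b] exI[of _ "\<zero>\<^bsub>sec A (i - 1) U\<^esub>"]) (simp add: cid_def)
qed

text \<open>Exactness for \<open>g\<close>, applied to \<open>(f a, c)\<close>, yields a primitive
  \<open>b'\<close> of \<open>f a\<close> near the point; exactness for \<open>f\<close>, applied to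
  the restriction of \<open>a\<close> and to \<open>b'\<close>, then yields a primitive of
  \<open>a\<close>. The correction term in \<open>B\<close> is pushed forward by
  \<open>g\<close>.\<close>

lemma qis_comp:
  assumes A: "A \<in> Ob" and B: "B \<in> Ob" and C: "C \<in> Ob" and qf: "quasi_iso X A B f" and qg: "quasi_iso X B C g"
  shows "quasi_iso X A C (ccomp g f)"
proof -
  note f = qis_chain[OF qf] and g = qis_chain[OF qg]
  have cf: "cone_exact A B f" and cg: "cone_exact B C g"
    using qf qg A B C by (simp_all add: quasi_iso_iff)
  note [simp] = A B C cm_simps[OF A B f] cm_simps[OF B C g]
  have "cone_exact A C (ccomp g f)"
  proof (rule cone_exactI)
    fix i U x a c
    assume U: "opn U" "x \<in> U" and a: "a \<in> carrier (sec A (i + 1) U)" and c: "c \<in> carrier (sec C i U)"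
      and da: "cdiff A (i + 1) U a = \<zero>\<^bsub>sec A (i + 2) U\<^esub>" and eq: "ccomp g f (i + 1) U a = cdiff C i U c"
    have 1: "f (i + 1) U a \<in> carrier (sec B (i + 1) U)" using U a by simp
    have 2: "cdiff B (i + 1) U (f (i + 1) U a) = \<zero>\<^bsub>sec B (i + 2) U\<^esub>"
      using cm_simps(5)[OF A B f U(1) a] da U by (simp add: add.assoc)
    have 3: "g (i + 1) U (f (i + 1) U a) = cdiff C i U c" using eq by (simp add: ccomp_def)
    obtain W b' c' where W: "opn W" "x \<in> W" "W \<subseteq> U" "b' \<in> carrier (sec B i W)" "c' \<in> carrier (sec C (i - 1) W)"
      and e1: "rmap (cob B (i + 1)) U W (f (i + 1) U a) = cdiff B i W b'"
      and e2: "rmap (cob C i) U W c = g i W b' \<oplus>\<^bsub>sec C i W\<^esub> cdiff C (i - 1) W c'"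
      by (rule cone_exactE[OF cg U 1 c 2 3])
    have 4: "rmap (cob A (i + 1)) U W a \<in> carrier (sec A (i + 1) W)" using U W a by simp
    have 5: "cdiff A (i + 1) W (rmap (cob A (i + 1)) U W a) = \<zero>\<^bsub>sec A (i + 2) W\<^esub>"
      using r_simps(6)[OF A U(1) W(1,3) a] da U W by (simp add: add.assoc)
    have 6: "f (i + 1) W (rmap (cob A (i + 1)) U W a) = cdiff B i W b'" using e1 U W a by simp
    obtain Z a' b'' where Z: "opn Z" "x \<in> Z" "Z \<subseteq> W" "a' \<in> carrier (sec A i Z)" "b'' \<in> carrier (sec B (i - 1) Z)"
      and e3: "rmap (cob A (i + 1)) W Z (rmap (cob A (i + 1)) U W a) = cdiff A i Z a'"
      and e4: "rmap (cob B i) W Z b' = f i Z a' \<oplus>\<^bsub>sec B i Z\<^esub> cdiff B (i - 1) Z b''"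
      by (rule cone_exactE[OF cf W(1,2) 4 W(4) 5 6])
    have ZU: "Z \<subseteq> U" using Z W by auto
    have 7: "rmap (cob A (i + 1)) U Z a = cdiff A i Z a'" using e3 U W Z a by simp
    have "rmap (cob C i) U Z c = rmap (cob C i) W Z (rmap (cob C i) U W c)" using U W(1-3) Z(1-3) c by simp
    also have "\<dots> = g i Z (rmap (cob B i) W Z b') \<oplus>\<^bsub>sec C i Z\<^esub> cdiff C (i - 1) Z (rmap (cob C (i - 1)) W Z c')"
      unfolding e2 using W Z by simp
    also have "\<dots> = ccomp g f i Z a' \<oplus>\<^bsub>sec C i Z\<^esub>
       cdiff C (i - 1) Z (g (i - 1) Z b'' \<oplus>\<^bsub>sec C (i - 1) Z\<^esub> rmap (cob C (i - 1)) W Z c')"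
      unfolding e4 using W Z by (simp add: ccomp_def sec_normalize[OF C])
    finally show "\<exists>W a' b'. opn W \<and> x \<in> W \<and> W \<subseteq> U \<and> a' \<in> carrier (sec A i W) \<and> b' \<in> carrier (sec C (i - 1) W) \<and>
        rmap (cob A (i + 1)) U W a = cdiff A i W a' \<and>
        rmap (cob C i) U W c = ccomp g f i W a' \<oplus>\<^bsub>sec C i W\<^esub> cdiff C (i - 1) W b'"
      using Z ZU 7 W by (intro exI[of _ Z] exI[of _ a'] exI[of _ "g (i - 1) Z b'' \<oplus>\<^bsub>sec C (i - 1) Z\<^esub> rmap (cob C (i - 1)) W Z c'"]) simp
  qed
  then show ?thesis using chain_comp[OF A B C f g] by (simp add: quasi_iso_iff)
qed

text \<open>On a cocycle \<open>a\<close> the two maps differ by the boundary of \<open>h a\<close>.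
  Hence \<open>b\<close> is replaced by \<open>b + h a\<close> before exactness for \<open>f\<close>
  is used, and \<open>h a\<close> cancels afterwards against \<open>h (d a')\<close>.\<close>

lemma qis_homotopic:
  assumes A: "A \<in> Ob" and B: "B \<in> Ob" and qf: "quasi_iso X A B f" and g: "chain_map X A B g"
    and fg: "homotopic X A B f g"
  shows "quasi_iso X A B g"
proof -
  note f = qis_chain[OF qf]
  have cf: "cone_exact A B f" using qf A B by (simp_all add: quasi_iso_iff)
  obtain h where nh: "homotopy_by A B h f g" using fg by (rule homotopicE)
  note h = homotopy_byD(1)[OF nh] and eq = homotopy_byD(2)[OF nh]
  note [simp] = A B cm_simps[OF A B f] cm_simps[OF A B g] deg_simps[OF A B h]
  have "cone_exact A B g"
  proof (rule cone_exactI)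
    fix i U x a b
    assume U: "opn U" "x \<in> U" and a: "a \<in> carrier (sec A (i + 1) U)" and b: "b \<in> carrier (sec B i U)"
      and da: "cdiff A (i + 1) U a = \<zero>\<^bsub>sec A (i + 2) U\<^esub>" and ga: "g (i + 1) U a = cdiff B i U b"
    let ?b = "b \<oplus>\<^bsub>sec B i U\<^esub> h (i + 1) U a"
    have 1: "?b \<in> carrier (sec B i U)" using U a b by simp
    have 2: "f (i + 1) U a = cdiff B i U ?b"
      using U a b da ga eq[OF U(1) a] deg_simps(4)[OF A B h U(1), of "i + 2" "i + 1"] by (simp add: add.assoc)
    obtain W a' b' where W: "opn W" "x \<in> W" "W \<subseteq> U" "a' \<in> carrier (sec A i W)" "b' \<in> carrier (sec B (i - 1) W)"
      and e1: "rmap (cob A (i + 1)) U W a = cdiff A i W a'"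
      and e2: "rmap (cob B i) U W ?b = f i W a' \<oplus>\<^bsub>sec B i W\<^esub> cdiff B (i - 1) W b'"
      by (rule cone_exactE[OF cf U a 1 da 2])
    interpret G: abelian_group "sec B i W" by (rule sec_group[OF B W(1)])
    have "rmap (cob B i) U W b \<oplus>\<^bsub>sec B i W\<^esub> h (i + 1) W (cdiff A i W a') =
       f i W a' \<oplus>\<^bsub>sec B i W\<^esub> cdiff B (i - 1) W b'"
      using e2 U W a b by (simp add: e1)
    also have "\<dots> = (g i W a' \<oplus>\<^bsub>sec B i W\<^esub> cdiff B (i - 1) W (h i W a' \<oplus>\<^bsub>sec B (i - 1) W\<^esub> b')) \<oplus>\<^bsub>sec B i W\<^esub> h (i + 1) W (cdiff A i W a')"
      unfolding eq[OF W(1,4)] using W by (simp add: sec_normalize[OF B])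
    finally have "rmap (cob B i) U W b = g i W a' \<oplus>\<^bsub>sec B i W\<^esub> cdiff B (i - 1) W (h i W a' \<oplus>\<^bsub>sec B (i - 1) W\<^esub> b')"
      using U W b by (subst (asm) G.add.right_cancel) auto
    then show "\<exists>W a' b'. opn W \<and> x \<in> W \<and> W \<subseteq> U \<and> a' \<in> carrier (sec A i W) \<and> b' \<in> carrier (sec B (i - 1) W) \<and>
        rmap (cob A (i + 1)) U W a = cdiff A i W a' \<and>
        rmap (cob B i) U W b = g i W a' \<oplus>\<^bsub>sec B i W\<^esub> cdiff B (i - 1) W b'"
      using W e1 by (intro exI[of _ W] exI[of _ a'] exI[of _ "h i W a' \<oplus>\<^bsub>sec B (i - 1) W\<^esub> b'"]) simp
  qed
  then show ?thesis using g by (simp add: quasi_iso_iff)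
qed

text \<open>One case of two out of three. Exactness for the composite, applied to
  \<open>(a, s b)\<close>, finds a primitive \<open>a'\<close> of \<open>a\<close>; then
  \<open>b - f a'\<close> is a cocycle whose image under \<open>s\<close> bounds, and exactness for
  \<open>s\<close> one degree lower makes it a boundary. It is what turns the first leg of a
  dominating roof into a quasi-isomorphism.\<close>

lemma qis_cancel_left:
  assumes A: "A \<in> Ob" and B: "B \<in> Ob" and C: "C \<in> Ob" and f: "chain_map X A B f" and qs: "quasi_iso X B C s"
    and qsf: "quasi_iso X A C (ccomp s f)"
  shows "quasi_iso X A B f"
proof -
  note s = qis_chain[OF qs]
  have cs: "cone_exact B C s" and csf: "cone_exact A C (ccomp s f)"
    using qs qsf A B C by (simp_all add: quasi_iso_iff)
  note [simp] = A B C cm_simps[OF A B f] cm_simps[OF B C s]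
  have "cone_exact A B f"
  proof (rule cone_exactI)
    fix i U x a b
    assume U: "opn U" "x \<in> U" and a: "a \<in> carrier (sec A (i + 1) U)" and b: "b \<in> carrier (sec B i U)"
      and da: "cdiff A (i + 1) U a = \<zero>\<^bsub>sec A (i + 2) U\<^esub>" and fa: "f (i + 1) U a = cdiff B i U b"
    have 1: "s i U b \<in> carrier (sec C i U)" using U b by simp
    have 2: "ccomp s f (i + 1) U a = cdiff C i U (s i U b)" using U b by (simp add: ccomp_def fa)
    obtain W a' c' where W: "opn W" "x \<in> W" "W \<subseteq> U" "a' \<in> carrier (sec A i W)" "c' \<in> carrier (sec C (i - 1) W)"
      and e1: "rmap (cob A (i + 1)) U W a = cdiff A i W a'"
      and e2: "rmap (cob C i) U W (s i U b) = ccomp s f i W a' \<oplus>\<^bsub>sec C i W\<^esub> cdiff C (i - 1) W c'"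
      by (rule cone_exactE[OF csf U a 1 da 2])
    let ?b = "rmap (cob B i) U W b \<oplus>\<^bsub>sec B i W\<^esub> (\<ominus>\<^bsub>sec B i W\<^esub> f i W a')"
    have 3: "?b \<in> carrier (sec B (i - 1 + 1) W)" using U W b by simp
    have "cdiff B i W (rmap (cob B i) U W b) = rmap (cob B (i + 1)) U W (f (i + 1) U a)"
      unfolding fa using U W b by simp
    also have "\<dots> = cdiff B i W (f i W a')" using U W a by (simp add: e1)
    finally have 4: "cdiff B (i - 1 + 1) W ?b = \<zero>\<^bsub>sec B (i - 1 + 2) W\<^esub>" using U W b by simp
    have 5: "s (i - 1 + 1) W ?b = cdiff C (i - 1) W c'"
      using e2 U W b by (simp add: ccomp_def sec_normalize[OF C])
    obtain Z b' c'' where Z: "opn Z" "x \<in> Z" "Z \<subseteq> W" "b' \<in> carrier (sec B (i - 1) Z)"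
      and e3: "rmap (cob B (i - 1 + 1)) W Z ?b = cdiff B (i - 1) Z b'"
      by (rule cone_exactE[OF cs W(1,2) 3 W(5) 4 5]) (rule that)
    have ZU: "Z \<subseteq> U" using Z W by auto
    have "rmap (cob A (i + 1)) U Z a = rmap (cob A (i + 1)) W Z (rmap (cob A (i + 1)) U W a)" using U W Z a by simp
    also have "\<dots> = cdiff A i Z (rmap (cob A i) W Z a')" unfolding e1 using W Z by simp
    finally have 6: "rmap (cob A (i + 1)) U Z a = cdiff A i Z (rmap (cob A i) W Z a')" .
    have "rmap (cob B i) U Z b = f i Z (rmap (cob A i) W Z a') \<oplus>\<^bsub>sec B i Z\<^esub> cdiff B (i - 1) Z b'"
      using e3 U W Z ZU b by (simp add: abelian_group.minus_eq_iff_eq_add[OF sec_group])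
    with 6 show "\<exists>W a' b'. opn W \<and> x \<in> W \<and> W \<subseteq> U \<and> a' \<in> carrier (sec A i W) \<and> b' \<in> carrier (sec B (i - 1) W) \<and>
        rmap (cob A (i + 1)) U W a = cdiff A i W a' \<and>
        rmap (cob B i) U W b = f i W a' \<oplus>\<^bsub>sec B i W\<^esub> cdiff B (i - 1) W b'"
      using Z ZU W by (intro exI[of _ Z] exI[of _ "rmap (cob A i) W Z a'"] exI[of _ b']) simp
  qed
  then show ?thesis using f by (simp add: quasi_iso_iff)
qed

section \<open>Shifts\<close>

lemma cob_shift [simp]: "cob (shift n A) i = cob A (i + n)"
  by (simp add: shift_def)

lemma cdiff_shift:
  "cdiff (shift n A) i U s =
    (if even n then cdiff A (i + n) U s else \<ominus>\<^bsub>sec A (i + n + 1) U\<^esub> cdiff A (i + n) U s)"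
  by (simp add: shift_def)

lemma cdiff_shift_1 [simp]:
  "cdiff (shift 1 A) i U s = \<ominus>\<^bsub>sec A (i + 2) U\<^esub> cdiff A (i + 1) U s"
  "cdiff (shift (- 1) A) i U s = \<ominus>\<^bsub>sec A i U\<^esub> cdiff A (i - 1) U s"
  by (simp_all add: cdiff_shift add.assoc)

lemma shift_Ob [simp]:
  assumes A: "A \<in> Ob"
  shows "shift n A \<in> Ob"
proof -
  obtain N where N: "\<forall>i U. N < \<bar>i\<bar> \<and> opn U \<longrightarrow> carrier (sec A i U) = {\<zero>\<^bsub>sec A i U\<^esub>}"
    using Ob_bounded[OF A] by (elim exE)
  have e: "i + 1 + n = i + n + 1" "i + 2 + n = i + n + 2" for i by simp_all
  show ?thesis
  proof (rule ObI[where N = "N + \<bar>n\<bar>"])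
    fix i
    show "sheaf_hom X (cob (shift n A) i) (cob (shift n A) (i + 1)) (cdiff (shift n A) i)"
      using Ob_shom[OF A, of "i + n"] shom_neg[OF Ob_psh[OF A] Ob_psh[OF A] Ob_shom[OF A, of "i + n"]]
      by (cases "even n") (simp_all add: shift_def e)
  next
    fix i U s assume "opn U" "s \<in> carrier (sec (shift n A) i U)"
    then show "cdiff (shift n A) (i + 1) U (cdiff (shift n A) i U s) = \<zero>\<^bsub>sec (shift n A) (i + 2) U\<^esub>"
      using A by (simp add: cdiff_shift e)
  qed (use A N in auto)
qed

lemma shift_map_simps [simp]:
  "shift_map n (ccomp g f) = ccomp (shift_map n g) (shift_map n f)" "shift_map n cid = cid"
  "shift_map n f i = f (i + n)"
  by (simp_all add: shift_map_def ccomp_def cid_def)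

lemma shift_chain:
  assumes A: "A \<in> Ob" and B: "B \<in> Ob" and f: "chain_map X A B f"
  shows "chain_map X (shift n A) (shift n B) (shift_map n f)"
proof (rule chain_mapI)
  note [simp] = A B cm_simps[OF A B f]
  show "sheaf_hom X (cob (shift n A) i) (cob (shift n B) i) (shift_map n f i)" for i
    using chain_shom[OF f] by simp
  fix i U s assume "opn U" "s \<in> carrier (sec (shift n A) i U)"
  moreover have e: "i + 1 + n = i + n + 1" by simp
  ultimately show "cdiff (shift n B) i U (shift_map n f i U s) = shift_map n f (i + 1) U (cdiff (shift n A) i U s)"
    by (simp add: cdiff_shift e)
qed

text \<open>Passing to the shifted differentials multiplies both summands of
  \<open>d h + h d\<close> by the sign of the shift; for odd \<open>n\<close> this is offset by
  using \<open>- h\<close>.\<close>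

lemma shift_homotopic:
  assumes A: "A \<in> Ob" and B: "B \<in> Ob" and g: "chain_map X A B g" and fg: "homotopic X A B f g"
  shows "homotopic X (shift n A) (shift n B) (shift_map n f) (shift_map n g)"
proof -
  obtain h where nh: "homotopy_by A B h f g" using fg by (rule homotopicE)
  note h = homotopy_byD(1)[OF nh] and eq = homotopy_byD(2)[OF nh]
  note [simp] = A B cm_simps[OF A B g] deg_simps[OF A B h]
  have e: "i + 1 + n = i + n + 1" "i - 1 + n = i + n - 1" for i by simp_all
  show ?thesis
  proof (cases "even n")
    case True
    show ?thesis
    proof (rule homotopicI)
      show "deg (- 1) (shift n A) (shift n B) (shift_map n h)"
        using h by (simp add: deg_def e)
    qed (simp add: cdiff_shift e eq True)
  next
    case False
    show ?thesis
    proof (rule homotopicI)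
      show "deg (- 1) (shift n A) (shift n B) (\<lambda>i U s. \<ominus>\<^bsub>sec B (i + n - 1) U\<^esub> h (i + n) U s)"
        using h by (auto simp: deg_def e intro!: shom_neg)
    qed (simp add: cdiff_shift e eq False)
  qed
qed

text \<open>For odd \<open>n\<close> the condition on \<open>(a, b)\<close> is that of the unshifted
  complexes for \<open>(a, - b)\<close>, and the primitive \<open>a'\<close> found there has to be
  negated.\<close>

lemma shift_qis:
  assumes A: "A \<in> Ob" and B: "B \<in> Ob" and q: "quasi_iso X A B f"
  shows "quasi_iso X (shift n A) (shift n B) (shift_map n f)"
proof -
  note f = qis_chain[OF q]
  have cf: "cone_exact A B f" using q A B by (simp_all add: quasi_iso_iff)
  note [simp] = A B cm_simps[OF A B f]
  have e: "i + 1 + n = i + n + 1" "i - 1 + n = i + n - 1" "i + 2 + n = i + n + 2" for i by simp_all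
  have "cone_exact (shift n A) (shift n B) (shift_map n f)"
  proof (cases "even n")
    case True
    show ?thesis
    proof (rule cone_exactI)
      fix i U x a b
      assume *: "opn U" "x \<in> U" "a \<in> carrier (sec (shift n A) (i + 1) U)" "b \<in> carrier (sec (shift n B) i U)"
       "cdiff (shift n A) (i + 1) U a = \<zero>\<^bsub>sec (shift n A) (i + 2) U\<^esub>"
       "shift_map n f (i + 1) U a = cdiff (shift n B) i U b"
      obtain W a' b' where W: "opn W" "x \<in> W" "W \<subseteq> U" "a' \<in> carrier (sec A (i + n) W)" "b' \<in> carrier (sec B (i + n - 1) W)"
        "rmap (cob A (i + n + 1)) U W a = cdiff A (i + n) W a'"
        "rmap (cob B (i + n)) U W b = f (i + n) W a' \<oplus>\<^bsub>sec B (i + n) W\<^esub> cdiff B (i + n - 1) W b'"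
        by (rule cone_exactE[OF cf *(1,2), of a "i + n" b]) (use * True in \<open>simp_all add: e cdiff_shift\<close>)
      then show "\<exists>W a' b'. opn W \<and> x \<in> W \<and> W \<subseteq> U \<and> a' \<in> carrier (sec (shift n A) i W) \<and> b' \<in> carrier (sec (shift n B) (i - 1) W) \<and>
        rmap (cob (shift n A) (i + 1)) U W a = cdiff (shift n A) i W a' \<and>
        rmap (cob (shift n B) i) U W b = shift_map n f i W a' \<oplus>\<^bsub>sec (shift n B) i W\<^esub> cdiff (shift n B) (i - 1) W b'"
        using True by (intro exI[of _ W] exI[of _ a'] exI[of _ b']) (simp add: cdiff_shift e)
    qed
  next
    case False
    show ?thesis
    proof (rule cone_exactI)
      fix i U x a b
      assume *: "opn U" "x \<in> U" "a \<in> carrier (sec (shift n A) (i + 1) U)" "b \<in> carrier (sec (shift n B) i U)"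
       "cdiff (shift n A) (i + 1) U a = \<zero>\<^bsub>sec (shift n A) (i + 2) U\<^esub>"
       "shift_map n f (i + 1) U a = cdiff (shift n B) i U b"
      \<comment> \<open>\<open>\<ominus>\<close> is known to be an involution only on the carrier,
        so removing the sign requires membership of the differential in the carrier.\<close>
      have da: "cdiff A (i + n + 1) U a = \<zero>\<^bsub>sec A (i + n + 2) U\<^esub>"
      proof -
        have "\<ominus>\<^bsub>sec A (i + n + 2) U\<^esub> cdiff A (i + n + 1) U a = \<zero>\<^bsub>sec A (i + n + 2) U\<^esub>"
          using *(5) False e(1)[of "i + 1"] by (simp add: cdiff_shift e del: add.assoc)
        moreover have "cdiff A (i + n + 1) U a \<in> carrier (sec A (i + n + 2) U)"
          using d_closed[OF A *(1), of a "i + n + 1"] *(3) by (simp add: e)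
        ultimately show ?thesis using sec_simps(3,4)[OF A *(1)] by metis
      qed
      obtain W a' b' where W: "opn W" "x \<in> W" "W \<subseteq> U" "a' \<in> carrier (sec A (i + n) W)" "b' \<in> carrier (sec B (i + n - 1) W)"
        "rmap (cob A (i + n + 1)) U W a = cdiff A (i + n) W a'"
        "rmap (cob B (i + n)) U W (\<ominus>\<^bsub>sec B (i + n) U\<^esub> b) = f (i + n) W a' \<oplus>\<^bsub>sec B (i + n) W\<^esub> cdiff B (i + n - 1) W b'"
        by (rule cone_exactE[OF cf *(1,2), of a "i + n" "\<ominus>\<^bsub>sec B (i + n) U\<^esub> b"]) (use * da False in \<open>simp_all add: e cdiff_shift\<close>)
      have "rmap (cob B (i + n)) U W b = \<ominus>\<^bsub>sec B (i + n) W\<^esub> rmap (cob B (i + n)) U W (\<ominus>\<^bsub>sec B (i + n) U\<^esub> b)"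
        using * W(1-3) by simp
      also have "\<dots> = f (i + n) W (\<ominus>\<^bsub>sec A (i + n) W\<^esub> a') \<oplus>\<^bsub>sec B (i + n) W\<^esub> (\<ominus>\<^bsub>sec B (i + n) W\<^esub> cdiff B (i + n - 1) W b')"
        unfolding W(7) using W(1-5) by (simp add: sec_normalize[OF B])
      finally show "\<exists>W a' b'. opn W \<and> x \<in> W \<and> W \<subseteq> U \<and> a' \<in> carrier (sec (shift n A) i W) \<and> b' \<in> carrier (sec (shift n B) (i - 1) W) \<and>
        rmap (cob (shift n A) (i + 1)) U W a = cdiff (shift n A) i W a' \<and>
        rmap (cob (shift n B) i) U W b = shift_map n f i W a' \<oplus>\<^bsub>sec (shift n B) i W\<^esub> cdiff (shift n B) (i - 1) W b'"
        using False W by (intro exI[of _ W] exI[of _ "\<ominus>\<^bsub>sec A (i + n) W\<^esub> a'"] exI[of _ b']) (simp add: cdiff_shift e)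
    qed
  qed
  then show ?thesis using shift_chain[OF A B f] by (simp add: quasi_iso_iff)
qed

section \<open>Twisted direct sums\<close>

text \<open>Mapping cones, homotopy fibres and the objects completing Ore squares are all of this form.\<close>

definition tw :: "('x, 's) cplx \<Rightarrow> ('x, 's) cplx \<Rightarrow> ('x, 's) cmap \<Rightarrow> ('x, 's) cplx" where
  "tw A B e = \<lparr>cob = (\<lambda>i. dsum (cob A i) (cob B i)),
     cdiff = (\<lambda>i U s. spair (cdiff A i U (sfst s)) (e i U (sfst s) \<oplus>\<^bsub>sec B (i + 1) U\<^esub> cdiff B i U (ssnd s)))\<rparr>"

text \<open>By the last clause \<open>e\<close> anticommutes with the differentials, which is what
  makes the triangular differential of \<open>tw A B e\<close> square to zero. Equivalently,
  \<open>e\<close> is a chain map from \<open>A\<close> to \<open>B[1]\<close>, and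
  \<open>tw A B e\<close> is the extension of \<open>A\<close> by \<open>B\<close> that it
  classifies.\<close>

definition twisting :: "('x, 's) cplx \<Rightarrow> ('x, 's) cplx \<Rightarrow> ('x, 's) cmap \<Rightarrow> bool" where
  "twisting A B e \<longleftrightarrow> A \<in> Ob \<and> B \<in> Ob \<and> deg 1 A B e \<and>
     (\<forall>i U s. opn U \<longrightarrow> s \<in> carrier (sec A i U) \<longrightarrow>
        e (i + 1) U (cdiff A i U s) = \<ominus>\<^bsub>sec B (i + 2) U\<^esub> cdiff B (i + 1) U (e i U s))"

lemma cob_tw [simp]: "cob (tw A B e) i = dsum (cob A i) (cob B i)"
  by (simp add: tw_def)

lemma cdiff_tw [simp]: "cdiff (tw A B e) i U s =
   spair (cdiff A i U (sfst s)) (e i U (sfst s) \<oplus>\<^bsub>sec B (i + 1) U\<^esub> cdiff B i U (ssnd s))"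
  by (simp add: tw_def)

lemma twistingD:
  assumes "twisting A B e"
  shows "A \<in> Ob" "B \<in> Ob" "deg 1 A B e" "\<And>i U s. opn U \<Longrightarrow> s \<in> carrier (sec A i U) \<Longrightarrow>
        e (i + 1) U (cdiff A i U s) = \<ominus>\<^bsub>sec B (i + 2) U\<^esub> cdiff B (i + 1) U (e i U s)"
  using assms by (simp_all add: twisting_def)

lemma twistingI:
  assumes "A \<in> Ob" "B \<in> Ob" "deg 1 A B e" "\<And>i U s. opn U \<Longrightarrow> s \<in> carrier (sec A i U) \<Longrightarrow>
        e (i + 1) U (cdiff A i U s) = \<ominus>\<^bsub>sec B (i + 2) U\<^esub> cdiff B (i + 1) U (e i U s)"
  shows "twisting A B e"
  using assms by (simp add: twisting_def)

lemma tw_Ob: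
  assumes e: "twisting A B e"
  shows "tw A B e \<in> Ob"
proof -
  note A = twistingD(1)[OF e] and B = twistingD(2)[OF e] and de = twistingD(3)[OF e]
  note [simp] = A B deg_simps[OF A B de] twistingD(4)[OF e]
  obtain N where N: "\<forall>i U. N < \<bar>i\<bar> \<and> opn U \<longrightarrow> carrier (sec A i U) = {\<zero>\<^bsub>sec A i U\<^esub>}"
    using Ob_bounded[OF A] by (elim exE)
  obtain M where M: "\<forall>i U. M < \<bar>i\<bar> \<and> opn U \<longrightarrow> carrier (sec B i U) = {\<zero>\<^bsub>sec B i U\<^esub>}"
    using Ob_bounded[OF B] by (elim exE)
  show ?thesis
  proof (rule ObI[where N = "max N M"])
    show "coh (cob (tw A B e) i)" for i by (simp add: dsum_coherent)
    show "sheaf_hom X (cob (tw A B e) i) (cob (tw A B e) (i + 1)) (cdiff (tw A B e) i)" for i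
      unfolding cob_tw cdiff_tw[abs_def]
      by (intro shom_pair shom_add dsum_psh Ob_psh A B shom_comp[OF shom_fst Ob_shom] shom_comp[OF shom_snd Ob_shom]
        shom_comp[OF shom_fst deg_shom[OF de]])
  next
    fix i U s assume "opn U" "s \<in> carrier (sec (tw A B e) i U)"
    then show "cdiff (tw A B e) (i + 1) U (cdiff (tw A B e) i U s) = \<zero>\<^bsub>sec (tw A B e) (i + 2) U\<^esub>"
      using d_closed[OF B, of U _ "i + 1"] by (auto elim!: dsumE simp: add.assoc)
  next
    fix i U assume "max N M < \<bar>i\<bar>" "opn U"
    then show "carrier (sec (tw A B e) i U) = {\<zero>\<^bsub>sec (tw A B e) i U\<^esub>}"
      using N[rule_format, of i U] M[rule_format, of i U] by (auto simp: dsum_carrier)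
  qed
qed

lemma tw_fst_chain:
  assumes e: "twisting A B e"
  shows "chain_map X (tw A B e) A (\<lambda>i U s. sfst s)"
  by (rule chain_mapI) (simp_all add: shom_fst)

lemma tw_incl_chain:
  assumes e: "twisting A B e"
  shows "chain_map X B (tw A B e) (\<lambda>i U b. spair \<zero>\<^bsub>sec A i U\<^esub> b)"
proof -
  note A = twistingD(1)[OF e] and B = twistingD(2)[OF e] and de = twistingD(3)[OF e]
  note [simp] = A B deg_simps[OF A B de]
  show ?thesis
  proof (rule chain_mapI)
    show "sheaf_hom X (cob B i) (cob (tw A B e) i) (\<lambda>U b. spair \<zero>\<^bsub>sec A i U\<^esub> b)" for i
      unfolding cob_tw by (intro shom_pair shom_zero shom_id) simp
  qed simp
qed

section \<open>Acyclic complexes and homotopy fibres\<close>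

definition acyclic_cplx :: "('x, 's) cplx \<Rightarrow> bool" where
  "acyclic_cplx K \<longleftrightarrow> (\<forall>i U x k. opn U \<longrightarrow> x \<in> U \<longrightarrow> k \<in> carrier (sec K i U) \<longrightarrow>
     cdiff K i U k = \<zero>\<^bsub>sec K (i + 1) U\<^esub> \<longrightarrow>
     (\<exists>W k'. opn W \<and> x \<in> W \<and> W \<subseteq> U \<and> k' \<in> carrier (sec K (i - 1) W) \<and> rmap (cob K i) U W k = cdiff K (i - 1) W k'))"

lemma acyclicE:
  assumes "acyclic_cplx K" "opn U" "x \<in> U" "k \<in> carrier (sec K i U)" "cdiff K i U k = \<zero>\<^bsub>sec K (i + 1) U\<^esub>"
  obtains W k' where "opn W" "x \<in> W" "W \<subseteq> U" "k' \<in> carrier (sec K (i - 1) W)" "rmap (cob K i) U W k = cdiff K (i - 1) W k'"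
  using assms(1)[unfolded acyclic_cplx_def, rule_format, OF assms(2-5)] by blast

lemma acyclicI:
  assumes "\<And>i U x k. opn U \<Longrightarrow> x \<in> U \<Longrightarrow> k \<in> carrier (sec K i U) \<Longrightarrow>
     cdiff K i U k = \<zero>\<^bsub>sec K (i + 1) U\<^esub> \<Longrightarrow>
     \<exists>W k'. opn W \<and> x \<in> W \<and> W \<subseteq> U \<and> k' \<in> carrier (sec K (i - 1) W) \<and> rmap (cob K i) U W k = cdiff K (i - 1) W k'"
  shows "acyclic_cplx K"
  unfolding acyclic_cplx_def by (intro allI impI assms)

text \<open>The kernel of the projection is \<open>K\<close>, and an acyclic kernel contributes no
  cohomology. Concretely, the second coordinate \<open>k\<close> of a cocycle over
  \<open>d b\<close> becomes closed after subtracting \<open>e b\<close>, and a primitive of the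
  difference completes \<open>b\<close> to a primitive of the cocycle.\<close>

lemma tw_fst_qis:
  assumes e: "twisting A K e" and ac: "acyclic_cplx K"
  shows "quasi_iso X (tw A K e) A (\<lambda>i U s. sfst s)"
proof -
  note A = twistingD(1)[OF e] and K = twistingD(2)[OF e] and de = twistingD(3)[OF e]
  note [simp] = A K deg_simps[OF A K de] twistingD(4)[OF e]
  have "cone_exact (tw A K e) A (\<lambda>i U s. sfst s)"
  proof (rule cone_exactI)
    fix i U x y b
    assume U: "opn U" "x \<in> U" and y: "y \<in> carrier (sec (tw A K e) (i + 1) U)" and b: "b \<in> carrier (sec A i U)"
      and dy: "cdiff (tw A K e) (i + 1) U y = \<zero>\<^bsub>sec (tw A K e) (i + 2) U\<^esub>" and eq: "sfst y = cdiff A i U b"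
    obtain k where k: "y = spair (cdiff A i U b) k" "k \<in> carrier (sec K (i + 1) U)"
      using y eq by (auto elim!: dsumE)
    have dk: "\<ominus>\<^bsub>sec K (i + 2) U\<^esub> cdiff K (i + 1) U (e i U b) \<oplus>\<^bsub>sec K (i + 2) U\<^esub> cdiff K (i + 1) U k = \<zero>\<^bsub>sec K (i + 2) U\<^esub>"
      using dy U b by (simp add: k add.assoc)
    let ?k = "k \<oplus>\<^bsub>sec K (i + 1) U\<^esub> (\<ominus>\<^bsub>sec K (i + 1) U\<^esub> e i U b)"
    have 1: "?k \<in> carrier (sec K (i + 1) U)" using k U b by simp
    have cl: "cdiff K (i + 1) U (e i U b) \<in> carrier (sec K (i + 2) U)" "cdiff K (i + 1) U k \<in> carrier (sec K (i + 2) U)"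
      using d_closed[OF K U(1), of _ "i + 1"] U k b by (simp_all add: add.assoc)
    have 2: "cdiff K (i + 1) U ?k = \<zero>\<^bsub>sec K (i + 1 + 1) U\<^esub>"
      using dk U k b cl by (simp add: add.assoc sec_normalize[OF K])
    obtain W k' where W: "opn W" "x \<in> W" "W \<subseteq> U" "k' \<in> carrier (sec K (i + 1 - 1) W)"
      "rmap (cob K (i + 1)) U W ?k = cdiff K (i + 1 - 1) W k'"
      by (rule acyclicE[OF ac U 1 2])
    have "rmap (cob K (i + 1)) U W k = e i W (rmap (cob A i) U W b) \<oplus>\<^bsub>sec K (i + 1) W\<^esub> cdiff K i W k'"
      using W U b k by (simp add: abelian_group.minus_eq_iff_eq_add[OF sec_group])
    then show "\<exists>W a' b'. opn W \<and> x \<in> W \<and> W \<subseteq> U \<and> a' \<in> carrier (sec (tw A K e) i W) \<and> b' \<in> carrier (sec A (i - 1) W) \<and>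
        rmap (cob (tw A K e) (i + 1)) U W y = cdiff (tw A K e) i W a' \<and>
        rmap (cob A i) U W b = sfst a' \<oplus>\<^bsub>sec A i W\<^esub> cdiff A (i - 1) W b'"
      using W U b k by (intro exI[of _ W] exI[of _ "spair (rmap (cob A i) U W b) k'"] exI[of _ "\<zero>\<^bsub>sec A (i - 1) W\<^esub>"]) simp
  qed
  then show ?thesis using tw_Ob[OF e] tw_fst_chain[OF e] by (simp add: quasi_iso_iff)
qed

lemma shift_acyclic:
  assumes K: "K \<in> Ob" and ac: "acyclic_cplx K"
  shows "acyclic_cplx (shift (- 1) K)"
proof (rule acyclicI)
  note [simp] = K
  fix i U x k
  assume *: "opn U" "x \<in> U" "k \<in> carrier (sec (shift (- 1) K) i U)" "cdiff (shift (- 1) K) i U k = \<zero>\<^bsub>sec (shift (- 1) K) (i + 1) U\<^esub>"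
  have k: "k \<in> carrier (sec K (i - 1) U)" using * by simp
  have "\<ominus>\<^bsub>sec K i U\<^esub> (cdiff (shift (- 1) K) i U k) = \<zero>\<^bsub>sec K i U\<^esub>"
    unfolding *(4) using * by simp
  then have dk: "cdiff K (i - 1) U k = \<zero>\<^bsub>sec K (i - 1 + 1) U\<^esub>" using * k by simp
  obtain W k' where W: "opn W" "x \<in> W" "W \<subseteq> U" "k' \<in> carrier (sec K (i - 1 - 1) W)"
      "rmap (cob K (i - 1)) U W k = cdiff K (i - 1 - 1) W k'"
    by (rule acyclicE[OF ac *(1,2) k dk])
  then show "\<exists>W k'. opn W \<and> x \<in> W \<and> W \<subseteq> U \<and> k' \<in> carrier (sec (shift (- 1) K) (i - 1) W) \<and>
      rmap (cob (shift (- 1) K) i) U W k = cdiff (shift (- 1) K) (i - 1) W k'"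
    using d_simps(2)[OF K W(1,4)] d_closed'[OF K W(1,4)]
    by (intro exI[of _ W] exI[of _ "\<ominus>\<^bsub>sec K (i - 1 - 1) W\<^esub> k'"]) simp
qed

text \<open>This is the homotopy fibre of \<open>f\<close>. The sign in the differential of
  \<open>B[-1]\<close> turns the commutation of \<open>f\<close> with the differentials into the
  anticommutation required of a twisting.\<close>

lemma fib_twisting:
  assumes A: "A \<in> Ob" and B: "B \<in> Ob" and f: "chain_map X A B f"
  shows "twisting A (shift (- 1) B) f"
proof -
  note [simp] = A B cm_simps[OF A B f]
  show ?thesis
    using chain_shom[OF f] by (intro twistingI) (simp_all add: deg_def)
qed

text \<open>A cocycle of the fibre is a datum of \<open>cone_exact\<close> one degree lower, and the
  pair returned there is a primitive once its second entry is negated, because of the sign in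
  \<open>B[-1]\<close>.\<close>

lemma fib_acyclic:
  assumes A: "A \<in> Ob" and B: "B \<in> Ob" and q: "quasi_iso X A B t"
  shows "acyclic_cplx (tw A (shift (- 1) B) t)"
proof (rule acyclicI)
  note t = qis_chain[OF q]
  note [simp] = A B cm_simps[OF A B t]
  have ct: "cone_exact A B t" using q by (simp add: quasi_iso_iff)
  fix i U x k
  assume U: "opn U" "x \<in> U" and k: "k \<in> carrier (sec (tw A (shift (- 1) B) t) i U)"
    and dk: "cdiff (tw A (shift (- 1) B) t) i U k = \<zero>\<^bsub>sec (tw A (shift (- 1) B) t) (i + 1) U\<^esub>"
  obtain w b where wb: "k = spair w b" "w \<in> carrier (sec A i U)" "b \<in> carrier (sec B (i - 1) U)"
    using k by (auto elim!: dsumE)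
  have w: "cdiff A i U w = \<zero>\<^bsub>sec A (i + 1) U\<^esub>" "t i U w = cdiff B (i - 1) U b"
    using dk wb U by (simp_all add: abelian_group.minus_eq_iff_eq_add[OF sec_group])
  obtain W w' b' where W: "opn W" "x \<in> W" "W \<subseteq> U" "w' \<in> carrier (sec A (i - 1) W)" "b' \<in> carrier (sec B (i - 1 - 1) W)"
    "rmap (cob A (i - 1 + 1)) U W w = cdiff A (i - 1) W w'"
    "rmap (cob B (i - 1)) U W b = t (i - 1) W w' \<oplus>\<^bsub>sec B (i - 1) W\<^esub> cdiff B (i - 1 - 1) W b'"
    by (rule cone_exactE[OF ct U, of w "i - 1" b]) (use wb w in simp_all)
  then show "\<exists>W k'. opn W \<and> x \<in> W \<and> W \<subseteq> U \<and> k' \<in> carrier (sec (tw A (shift (- 1) B) t) (i - 1) W) \<and>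
     rmap (cob (tw A (shift (- 1) B) t) i) U W k = cdiff (tw A (shift (- 1) B) t) (i - 1) W k'"
    using wb d_simps(2)[OF B W(1,5)] d_closed'[OF B W(1,5)]
    by (intro exI[of _ W] exI[of _ "spair w' (\<ominus>\<^bsub>sec B (i - 1 - 1) W\<^esub> b')"]) simp
qed

section \<open>Calculus of fractions\<close>

text \<open>The homotopy pullback \<open>Y\<close> is a twisted sum of \<open>Z\<close> and the acyclic homotopy fibre of \<open>t\<close>.\<close>

lemma ore:
  assumes Z: "Z \<in> Ob" and W: "W \<in> Ob" and B: "B \<in> Ob" and f: "chain_map X Z B f" and q: "quasi_iso X W B t"
  obtains Y a b where "Y \<in> Ob" "quasi_iso X Y Z a" "chain_map X Y W b" "homotopic X Y B (ccomp f a) (ccomp t b)"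
proof -
  note t = qis_chain[OF q]
  note [simp] = Z W B cm_simps[OF Z B f] cm_simps[OF W B t]
  define K where "K = tw W (shift (- 1) B) t"
  note tK = fib_twisting[OF W B t]
  have K [simp]: "K \<in> Ob" unfolding K_def by (rule tw_Ob[OF tK])
  have ac: "acyclic_cplx K" unfolding K_def by (rule fib_acyclic[OF W B q])
  have cK [simp]: "cob K i = dsum (cob W i) (cob B (i - 1))" for i by (simp add: K_def)
  have dK [simp]: "cdiff K i U s = spair (cdiff W i U (sfst s))
    (t i U (sfst s) \<oplus>\<^bsub>sec B i U\<^esub> (\<ominus>\<^bsub>sec B i U\<^esub> cdiff B (i - 1) U (ssnd s)))" for i U s
    by (simp add: K_def)
  define e where "e i U z = spair \<zero>\<^bsub>sec W (i + 1) U\<^esub> (f i U z)" for i U z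
  have te: "twisting Z K e"
  proof (rule twistingI)
    show "deg 1 Z K e"
      using chain_shom[OF f] by (auto simp: deg_def e_def[abs_def] intro!: shom_pair shom_zero)
  qed (simp_all add: e_def add.assoc)
  define Y where "Y = tw Z K e"
  have Y: "Y \<in> Ob" unfolding Y_def by (rule tw_Ob[OF te])
  have cY [simp]: "cob Y i = dsum (cob Z i) (cob K i)" for i by (simp add: Y_def)
  have dY [simp]: "cdiff Y i U s = spair (cdiff Z i U (sfst s)) (e i U (sfst s) \<oplus>\<^bsub>sec K (i + 1) U\<^esub> cdiff K i U (ssnd s))" for i U s
    by (simp add: Y_def)
  define a :: "('x, 's) cmap" where "a = (\<lambda>i U s. sfst s)"
  \<comment> \<open>For \<open>y = (z, w, c)\<close> the last coordinate of \<open>d y\<close> is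
    \<open>f z + t w - d c\<close>. With \<open>b y = - w\<close> this says that \<open>c\<close> is
    a homotopy from \<open>ccomp f a\<close> to \<open>ccomp t b\<close>.\<close>
  define b where "b i U y = \<ominus>\<^bsub>sec W i U\<^esub> sfst (ssnd y)" for i :: int and U y
  have qa: "quasi_iso X Y Z a" unfolding Y_def a_def by (rule tw_fst_qis[OF te ac])
  have b: "chain_map X Y W b"
  proof (rule chain_mapI)
    show "sheaf_hom X (cob Y i) (cob W i) (b i)" for i
      unfolding b_def[abs_def] cY cK
      by (intro shom_neg shom_comp[OF shom_snd shom_fst] dsum_psh Ob_psh Z W B)
    show "cdiff W i U (b i U s) = b (i + 1) U (cdiff Y i U s)" if "opn U" "s \<in> carrier (sec Y i U)" for i U s
      using that by (auto elim!: dsumE simp: b_def e_def)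
  qed
  have "homotopic X Y B (ccomp f a) (ccomp t b)"
  proof (rule homotopicI[where h = "\<lambda>i U y. ssnd (ssnd y)"])
    show "deg (- 1) Y B (\<lambda>i U y. ssnd (ssnd y))"
      unfolding deg_def cY cK by (auto intro!: shom_comp[OF shom_snd shom_snd])
    fix i U s assume "opn U" "s \<in> carrier (sec Y i U)"
    then show "ccomp f a i U s = ccomp t b i U s \<oplus>\<^bsub>sec B i U\<^esub>
      (cdiff B (i - 1) U (ssnd (ssnd s)) \<oplus>\<^bsub>sec B i U\<^esub> ssnd (ssnd (cdiff Y i U s)))"
      by (auto elim!: dsumE simp: a_def b_def e_def ccomp_def sec_normalize[OF B])
  qed
  with that Y qa b show ?thesis by blast
qed

text \<open>A homotopy from \<open>t f\<close> to \<open>t g\<close> turns \<open>f - g\<close> into a chain map from \<open>Z\<close> to the acyclic homotopy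
  fibre of \<open>t\<close>; then \<open>Y\<close> is the homotopy fibre of this chain map.\<close>

lemma qis_right_cancel:
  assumes Z: "Z \<in> Ob" and W: "W \<in> Ob" and B: "B \<in> Ob" and f: "chain_map X Z W f" and g: "chain_map X Z W g"
    and q: "quasi_iso X W B t" and tfg: "homotopic X Z B (ccomp t f) (ccomp t g)"
  obtains Y a where "Y \<in> Ob" "quasi_iso X Y Z a" "homotopic X Y W (ccomp f a) (ccomp g a)"
proof -
  note t = qis_chain[OF q]
  obtain h where nh: "homotopy_by Z B h (ccomp t f) (ccomp t g)" using tfg by (rule homotopicE)
  note h = homotopy_byD(1)[OF nh] and eq = homotopy_byD(2)[OF nh]
  note [simp] = Z W B cm_simps[OF Z W f] cm_simps[OF Z W g] cm_simps[OF W B t] deg_simps[OF Z B h]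
  define K where "K = tw W (shift (- 1) B) t"
  note tK = fib_twisting[OF W B t]
  have K [simp]: "K \<in> Ob" unfolding K_def by (rule tw_Ob[OF tK])
  have ac: "acyclic_cplx (shift (- 1) K)" using shift_acyclic[OF K] fib_acyclic[OF W B q] by (simp add: K_def)
  have cK [simp]: "cob K i = dsum (cob W i) (cob B (i - 1))" for i by (simp add: K_def)
  have dK [simp]: "cdiff K i U s = spair (cdiff W i U (sfst s))
    (t i U (sfst s) \<oplus>\<^bsub>sec B i U\<^esub> (\<ominus>\<^bsub>sec B i U\<^esub> cdiff B (i - 1) U (ssnd s)))" for i U s
    by (simp add: K_def)
  \<comment> \<open>The pair of \<open>f - g\<close> and \<open>h\<close> is compatible with the
    differentials exactly because \<open>h\<close> is a homotopy from \<open>ccomp t f\<close> to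
    \<open>ccomp t g\<close>.\<close>
  define e where "e i U z = spair (f i U z \<oplus>\<^bsub>sec W i U\<^esub> (\<ominus>\<^bsub>sec W i U\<^esub> g i U z)) (h i U z)" for i U z
  have te: "twisting Z (shift (- 1) K) e"
  proof (rule twistingI)
    show "deg 1 Z (shift (- 1) K) e"
      using chain_shom[OF f] chain_shom[OF g] deg_shom[OF h]
      by (auto simp: deg_def e_def[abs_def] intro!: shom_pair shom_add shom_neg)
    fix i U z assume U: "opn U" and z: "z \<in> carrier (sec Z i U)"
    have "t i U (f i U z) = t i U (g i U z) \<oplus>\<^bsub>sec B i U\<^esub> (cdiff B (i - 1) U (h i U z) \<oplus>\<^bsub>sec B i U\<^esub> h (i + 1) U (cdiff Z i U z))"
      using eq[OF U z] by (simp add: ccomp_def)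
    then show "e (i + 1) U (cdiff Z i U z) = \<ominus>\<^bsub>sec (shift (- 1) K) (i + 2) U\<^esub> cdiff (shift (- 1) K) (i + 1) U (e i U z)"
      using U z by (simp add: e_def sec_normalize[OF B] sec_normalize[OF W])
  qed simp_all
  define Y where "Y = tw Z (shift (- 1) K) e"
  have Y: "Y \<in> Ob" unfolding Y_def by (rule tw_Ob[OF te])
  have cY [simp]: "cob Y i = dsum (cob Z i) (cob K (i - 1))" for i by (simp add: Y_def)
  have dY [simp]: "cdiff Y i U s = spair (cdiff Z i U (sfst s))
     (e i U (sfst s) \<oplus>\<^bsub>sec K i U\<^esub> (\<ominus>\<^bsub>sec K i U\<^esub> cdiff K (i - 1) U (ssnd s)))" for i U s
    by (simp add: Y_def)
  define a :: "('x, 's) cmap" where "a = (\<lambda>i U s. sfst s)"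
  have qa: "quasi_iso X Y Z a" unfolding Y_def a_def by (rule tw_fst_qis[OF te ac])
  have "homotopic X Y W (ccomp f a) (ccomp g a)"
  \<comment> \<open>For \<open>y = (z, w, c)\<close> the coordinate of \<open>d y\<close> in
    \<open>W\<close> is \<open>f z - g z - d w\<close>, so \<open>w\<close> itself is the
    homotopy.\<close>
  proof (rule homotopicI[where h = "\<lambda>i U y. sfst (ssnd y)"])
    show "deg (- 1) Y W (\<lambda>i U y. sfst (ssnd y))"
      unfolding deg_def cY cK by (auto intro!: shom_comp[OF shom_snd shom_fst])
    fix i U s assume "opn U" "s \<in> carrier (sec Y i U)"
    then show "ccomp f a i U s = ccomp g a i U s \<oplus>\<^bsub>sec W i U\<^esub>
      (cdiff W (i - 1) U (sfst (ssnd s)) \<oplus>\<^bsub>sec W i U\<^esub> sfst (ssnd (cdiff Y i U s)))"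
      by (auto elim!: dsumE simp: a_def e_def ccomp_def sec_normalize[OF W])
  qed
  with that Y qa show ?thesis by blast
qed

section \<open>The homotopy category\<close>

notation ccomp (infixr "\<circ>\<^sub>c" 70)

text \<open>Membership of source and target among the objects is bundled in, so that the laws of the
  homotopy category chain by resolution; \<open>qi\<close> and \<open>hq\<close> are bundled
  likewise.\<close>

definition mor :: "('x, 's) cplx \<Rightarrow> ('x, 's) cplx \<Rightarrow> ('x, 's) cmap \<Rightarrow> bool" where
  "mor A B f \<longleftrightarrow> A \<in> Ob \<and> B \<in> Ob \<and> chain_map X A B f"

definition qi :: "('x, 's) cplx \<Rightarrow> ('x, 's) cplx \<Rightarrow> ('x, 's) cmap \<Rightarrow> bool" where
  "qi A B f \<longleftrightarrow> A \<in> Ob \<and> B \<in> Ob \<and> quasi_iso X A B f"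

definition hq :: "('x, 's) cplx \<Rightarrow> ('x, 's) cplx \<Rightarrow> ('x, 's) cmap \<Rightarrow> ('x, 's) cmap \<Rightarrow> bool" where
  "hq A B f g \<longleftrightarrow> mor A B f \<and> mor A B g \<and> homotopic X A B f g"

lemma mor_Ob: "mor A B f \<Longrightarrow> A \<in> Ob" "mor A B f \<Longrightarrow> B \<in> Ob"
  by (simp_all add: mor_def)

lemma qi_mor: "qi A B f \<Longrightarrow> mor A B f"
  by (simp add: qi_def mor_def qis_chain)

lemma hq_mor: "hq A B f g \<Longrightarrow> mor A B f" "hq A B f g \<Longrightarrow> mor A B g"
  by (simp_all add: hq_def)

lemma mor_comp: "mor A B f \<Longrightarrow> mor B C g \<Longrightarrow> mor A C (g \<circ>\<^sub>c f)"
  by (auto simp: mor_def intro: chain_comp)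

lemma mor_id: "A \<in> Ob \<Longrightarrow> mor A A cid"
  by (simp add: mor_def chain_id)

lemma mor_zero: "A \<in> Ob \<Longrightarrow> B \<in> Ob \<Longrightarrow> mor A B (czero B)"
  by (simp add: mor_def chain_zero)

lemma qi_comp: "qi A B f \<Longrightarrow> qi B C g \<Longrightarrow> qi A C (g \<circ>\<^sub>c f)"
  by (auto simp: qi_def intro: qis_comp)

lemma qi_id: "A \<in> Ob \<Longrightarrow> qi A A cid"
  by (simp add: qi_def qis_id)

lemma hq_refl: "mor A B f \<Longrightarrow> hq A B f f"
  by (auto simp: hq_def mor_def intro: homotopic_refl)

lemma hq_sym: "hq A B f g \<Longrightarrow> hq A B g f"
  by (auto simp: hq_def mor_def intro: homotopic_sym)

lemma hq_trans [trans]: "hq A B f g \<Longrightarrow> hq A B g k \<Longrightarrow> hq A B f k"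
  by (auto simp: hq_def mor_def intro: homotopic_trans)

lemma hq_left: "hq A B f g \<Longrightarrow> mor B C k \<Longrightarrow> hq A C (k \<circ>\<^sub>c f) (k \<circ>\<^sub>c g)"
  by (auto simp: hq_def mor_comp) (auto simp: mor_def intro: homotopic_ccomp_left)

lemma hq_right: "mor A B k \<Longrightarrow> hq B C f g \<Longrightarrow> hq A C (f \<circ>\<^sub>c k) (g \<circ>\<^sub>c k)"
  by (auto simp: hq_def mor_comp) (auto simp: mor_def intro: homotopic_ccomp_right)

text \<open>The map \<open>f\<close> becomes a morphism only through its agreement with
  \<open>g\<close>. This is the tool for identities that hold on all sections but not as equalities
  of functions.\<close>

lemma hq_eqI:
  assumes "mor A B g" "\<And>i U s. opn U \<Longrightarrow> s \<in> carrier (sec A i U) \<Longrightarrow> f i U s = g i U s"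
  shows "hq A B f g"
proof -
  have "sheaf_hom X (cob A i) (cob B i) (f i)" for i
    using assms by (auto simp: mor_def intro: shom_cong[OF chain_shom])
  then have "mor A B f"
    using assms by (auto simp: mor_def chain_map_def)
  with assms show ?thesis by (auto simp: hq_def mor_def intro: homotopic_eqI)
qed

lemma qi_hq: "qi A B f \<Longrightarrow> hq A B f g \<Longrightarrow> qi A B g"
  by (auto simp: qi_def hq_def mor_def intro: qis_homotopic)

lemma qi_cancel: "mor A B f \<Longrightarrow> qi B C s \<Longrightarrow> qi A C (s \<circ>\<^sub>c f) \<Longrightarrow> qi A B f"
  by (auto simp: qi_def mor_def intro: qis_cancel_left)

lemma qi_ore:
  assumes "mor Z B f" "qi W B t"
  obtains Y a b where "qi Y Z a" "mor Y W b" "hq Y B (f \<circ>\<^sub>c a) (t \<circ>\<^sub>c b)"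
proof -
  have *: "Z \<in> Ob" "W \<in> Ob" "B \<in> Ob" "chain_map X Z B f" "quasi_iso X W B t"
    using assms by (simp_all add: mor_def qi_def)
  obtain Y a b where "Y \<in> Ob" "quasi_iso X Y Z a" "chain_map X Y W b" "homotopic X Y B (f \<circ>\<^sub>c a) (t \<circ>\<^sub>c b)"
    by (rule ore[OF *])
  then have "qi Y Z a" "mor Y W b" "homotopic X Y B (f \<circ>\<^sub>c a) (t \<circ>\<^sub>c b)"
    using * by (simp_all add: mor_def qi_def)
  with that assms show ?thesis by (meson hq_def mor_comp qi_mor)
qed

lemma qi_right_cancel:
  assumes "mor Z W f" "mor Z W g" "qi W B t" "hq Z B (t \<circ>\<^sub>c f) (t \<circ>\<^sub>c g)"
  obtains Y a where "qi Y Z a" "hq Y W (f \<circ>\<^sub>c a) (g \<circ>\<^sub>c a)"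
proof -
  have *: "Z \<in> Ob" "W \<in> Ob" "B \<in> Ob" "chain_map X Z W f" "chain_map X Z W g" "quasi_iso X W B t"
     "homotopic X Z B (t \<circ>\<^sub>c f) (t \<circ>\<^sub>c g)"
    using assms by (simp_all add: mor_def qi_def hq_def)
  obtain Y a where "Y \<in> Ob" "quasi_iso X Y Z a" "homotopic X Y W (f \<circ>\<^sub>c a) (g \<circ>\<^sub>c a)"
    by (rule qis_right_cancel[OF *])
  then have "qi Y Z a" "homotopic X Y W (f \<circ>\<^sub>c a) (g \<circ>\<^sub>c a)"
    using * by (simp_all add: qi_def)
  with that assms show ?thesis by (meson hq_def mor_comp qi_mor)
qed

section \<open>Roofs\<close>

abbreviation cl :: "('x, 's) cplx \<Rightarrow> ('x, 's) cplx \<Rightarrow> ('x, 's) roof \<Rightarrow> ('x, 's) roof set" where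
  "cl A B R \<equiv> roof_equiv X A B `` {R}"

lemma roofs_iff:
  "A \<in> Ob \<Longrightarrow> B \<in> Ob \<Longrightarrow> (Z, s, f) \<in> roofs X A B \<longleftrightarrow> qi Z A s \<and> mor Z B f"
  by (auto simp: roofs_def qi_def mor_def)

lemma roof_equiv_iff:
  assumes "A \<in> Ob" "B \<in> Ob"
  shows "((Z, s, f), (Z', s', f')) \<in> roof_equiv X A B \<longleftrightarrow>
    qi Z A s \<and> mor Z B f \<and> qi Z' A s' \<and> mor Z' B f' \<and>
    (\<exists>Y a b. mor Y Z a \<and> mor Y Z' b \<and> qi Y A (s \<circ>\<^sub>c a) \<and> hq Y A (s \<circ>\<^sub>c a) (s' \<circ>\<^sub>c b) \<and> hq Y B (f \<circ>\<^sub>c a) (f' \<circ>\<^sub>c b))"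
    (is "?L \<longleftrightarrow> ?R")
proof
  assume ?L
  then obtain Y a b where *: "qi Z A s" "mor Z B f" "qi Z' A s'" "mor Z' B f'" "Y \<in> Ob"
    "chain_map X Y Z a" "chain_map X Y Z' b" "quasi_iso X Y A (s \<circ>\<^sub>c a)"
    "homotopic X Y A (s \<circ>\<^sub>c a) (s' \<circ>\<^sub>c b)" "homotopic X Y B (f \<circ>\<^sub>c a) (f' \<circ>\<^sub>c b)"
    using assms by (auto simp: roof_equiv_def roofs_iff)
  then have "mor Y Z a" "mor Y Z' b" by (auto simp: mor_def qi_def)
  moreover have "mor Y A (s \<circ>\<^sub>c a)" "mor Y A (s' \<circ>\<^sub>c b)" "mor Y B (f \<circ>\<^sub>c a)" "mor Y B (f' \<circ>\<^sub>c b)"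
    using * calculation by (blast intro: mor_comp qi_mor)+
  moreover have "qi Y A (s \<circ>\<^sub>c a)" using * assms by (simp add: qi_def)
  ultimately show ?R using * unfolding hq_def by blast
next
  assume ?R
  then show ?L using assms by (auto simp: roof_equiv_def roofs_iff mor_def hq_def qi_def)
qed

text \<open>For transitivity the two dominating objects are joined by an Ore square over the apex of
  the middle roof. The square exists because the leg \<open>a2\<close> is a quasi-isomorphism by
  cancellation, although only its composite with \<open>s2\<close> is assumed to be one.\<close>

lemma roof_equiv_equiv:
  assumes A: "A \<in> Ob" and B: "B \<in> Ob"
  shows "equiv (roofs X A B) (roof_equiv X A B)"
proof (rule equivI)
  note iff = roof_equiv_iff[OF A B]
  show "roof_equiv X A B \<subseteq> roofs X A B \<times> roofs X A B" by (auto simp: roof_equiv_def)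
  show "refl_on (roofs X A B) (roof_equiv X A B)"
  proof (rule refl_onI; clarify)
    fix Z s f assume "(Z, s, f) \<in> roofs X A B"
    then have "qi Z A s" "mor Z B f" by (simp_all add: roofs_iff A B)
    then show "((Z, s, f), (Z, s, f)) \<in> roof_equiv X A B"
      unfolding iff by (intro conjI exI[of _ Z] exI[of _ cid]) (auto intro: hq_refl mor_id mor_Ob qi_mor)
  qed
  show "sym (roof_equiv X A B)"
  proof (rule symI; clarify)
    fix Z s f Z' s' f' assume "((Z, s, f), (Z', s', f')) \<in> roof_equiv X A B"
    then show "((Z', s', f'), (Z, s, f)) \<in> roof_equiv X A B"
      unfolding iff by (blast intro: hq_sym qi_hq)
  qed
  show "trans (roof_equiv X A B)"
  proof (rule transI; clarify)
    fix Z1 s1 f1 Z2 s2 f2 Z3 s3 f3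
    assume 12: "((Z1, s1, f1), (Z2, s2, f2)) \<in> roof_equiv X A B"
      and 23: "((Z2, s2, f2), (Z3, s3, f3)) \<in> roof_equiv X A B"
    obtain Y1 a1 b1 where Y1: "mor Y1 Z1 a1" "mor Y1 Z2 b1" "qi Y1 A (s1 \<circ>\<^sub>c a1)" "hq Y1 A (s1 \<circ>\<^sub>c a1) (s2 \<circ>\<^sub>c b1)"
      "hq Y1 B (f1 \<circ>\<^sub>c a1) (f2 \<circ>\<^sub>c b1)" using 12 unfolding iff by blast
    obtain Y2 a2 b2 where Y2: "mor Y2 Z2 a2" "mor Y2 Z3 b2" "qi Y2 A (s2 \<circ>\<^sub>c a2)" "hq Y2 A (s2 \<circ>\<^sub>c a2) (s3 \<circ>\<^sub>c b2)"
      "hq Y2 B (f2 \<circ>\<^sub>c a2) (f3 \<circ>\<^sub>c b2)" using 23 unfolding iff by blast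
    have s: "qi Z1 A s1" "qi Z2 A s2" "qi Z3 A s3" "mor Z1 B f1" "mor Z2 B f2" "mor Z3 B f3"
      using 12 23 unfolding iff by blast+
    have a2: "qi Y2 Z2 a2" using qi_cancel[OF Y2(1) s(2) Y2(3)] .
    obtain V c d where V: "qi V Y1 c" "mor V Y2 d" "hq V Z2 (b1 \<circ>\<^sub>c c) (a2 \<circ>\<^sub>c d)"
      by (rule qi_ore[OF Y1(2) a2])
    note c = qi_mor[OF V(1)]
    have "hq V A (s1 \<circ>\<^sub>c a1 \<circ>\<^sub>c c) (s2 \<circ>\<^sub>c b1 \<circ>\<^sub>c c)" using hq_right[OF c Y1(4)] by (simp add: ccomp_assoc)
    also have "hq V A (s2 \<circ>\<^sub>c b1 \<circ>\<^sub>c c) (s2 \<circ>\<^sub>c a2 \<circ>\<^sub>c d)" using hq_left[OF V(3) qi_mor[OF s(2)]] .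
    also have "hq V A (s2 \<circ>\<^sub>c a2 \<circ>\<^sub>c d) (s3 \<circ>\<^sub>c b2 \<circ>\<^sub>c d)" using hq_right[OF V(2) Y2(4)] by (simp add: ccomp_assoc)
    finally have 1: "hq V A (s1 \<circ>\<^sub>c a1 \<circ>\<^sub>c c) (s3 \<circ>\<^sub>c b2 \<circ>\<^sub>c d)" .
    have "hq V B (f1 \<circ>\<^sub>c a1 \<circ>\<^sub>c c) (f2 \<circ>\<^sub>c b1 \<circ>\<^sub>c c)" using hq_right[OF c Y1(5)] by (simp add: ccomp_assoc)
    also have "hq V B (f2 \<circ>\<^sub>c b1 \<circ>\<^sub>c c) (f2 \<circ>\<^sub>c a2 \<circ>\<^sub>c d)" using hq_left[OF V(3) s(5)] .
    also have "hq V B (f2 \<circ>\<^sub>c a2 \<circ>\<^sub>c d) (f3 \<circ>\<^sub>c b2 \<circ>\<^sub>c d)" using hq_right[OF V(2) Y2(5)] by (simp add: ccomp_assoc)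
    finally have 2: "hq V B (f1 \<circ>\<^sub>c a1 \<circ>\<^sub>c c) (f3 \<circ>\<^sub>c b2 \<circ>\<^sub>c d)" .
    have 3: "qi V A (s1 \<circ>\<^sub>c a1 \<circ>\<^sub>c c)" using qi_comp[OF V(1) Y1(3)] by (simp add: ccomp_assoc)
    show "((Z1, s1, f1), (Z3, s3, f3)) \<in> roof_equiv X A B"
      unfolding iff using s 1 2 3 mor_comp[OF c Y1(1)] mor_comp[OF V(2) Y2(2)] by blast
  qed
qed

section \<open>Classes of roofs and their composition\<close>

lemma cl_eqI:
  assumes "qi Z A s" "mor Z B f" "qi Z' A s'" "mor Z' B f'" "mor Y Z a" "mor Y Z' b"
    "qi Y A (s \<circ>\<^sub>c a)" "hq Y A (s \<circ>\<^sub>c a) (s' \<circ>\<^sub>c b)" "hq Y B (f \<circ>\<^sub>c a) (f' \<circ>\<^sub>c b)"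
  shows "cl A B (Z, s, f) = cl A B (Z', s', f')"
proof -
  have A: "A \<in> Ob" and B: "B \<in> Ob" using assms mor_Ob qi_mor by blast+
  have "((Z, s, f), (Z', s', f')) \<in> roof_equiv X A B" unfolding roof_equiv_iff[OF A B] using assms by blast
  then show ?thesis by (rule equiv_class_eq[OF roof_equiv_equiv[OF A B]])
qed

lemma cl_hqI:
  assumes s: "qi Z A s" and f: "hq Z B f f'" and ss: "hq Z A s s'"
  shows "cl A B (Z, s, f) = cl A B (Z, s', f')"
  using mor_id[OF mor_Ob(1)[OF qi_mor[OF s]]] s ss f qi_hq hq_mor
  by (intro cl_eqI[where Y = Z and a = cid and b = cid]) auto

lemma cl_eq_iff:
  assumes "qi Z A s" "mor Z B f" "qi Z' A s'" "mor Z' B f'"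
  shows "cl A B (Z, s, f) = cl A B (Z', s', f') \<longleftrightarrow>
    (\<exists>Y a b. mor Y Z a \<and> mor Y Z' b \<and> qi Y A (s \<circ>\<^sub>c a) \<and> hq Y A (s \<circ>\<^sub>c a) (s' \<circ>\<^sub>c b) \<and> hq Y B (f \<circ>\<^sub>c a) (f' \<circ>\<^sub>c b))"
proof -
  have A: "A \<in> Ob" and B: "B \<in> Ob" using assms mor_Ob qi_mor by blast+
  have "cl A B (Z, s, f) = cl A B (Z', s', f') \<longleftrightarrow> ((Z, s, f), (Z', s', f')) \<in> roof_equiv X A B"
    using assms A B by (intro eq_equiv_class_iff[OF roof_equiv_equiv[OF A B]]) (simp_all add: roofs_iff)
  then show ?thesis unfolding roof_equiv_iff[OF A B] using assms by simp
qed

lemma DHomE: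
  assumes "\<phi> \<in> DHom X A B" "A \<in> Ob" "B \<in> Ob"
  obtains Z s f where "qi Z A s" "mor Z B f" "\<phi> = cl A B (Z, s, f)"
  using assms by (auto simp: DHom_def roofs_iff elim!: quotientE)

lemma cl_DHom: "qi Z A s \<Longrightarrow> mor Z B f \<Longrightarrow> cl A B (Z, s, f) \<in> DHom X A B"
proof -
  assume *: "qi Z A s" "mor Z B f"
  then have "A \<in> Ob" "B \<in> Ob" using mor_Ob qi_mor by blast+
  with * show ?thesis unfolding DHom_def by (intro quotientI) (simp add: roofs_iff)
qed

lemma cl_self: "qi Z A s \<Longrightarrow> mor Z B f \<Longrightarrow> (Z, s, f) \<in> cl A B (Z, s, f)"
proof -
  assume *: "qi Z A s" "mor Z B f"
  then have AB: "A \<in> Ob" "B \<in> Ob" using mor_Ob qi_mor by blast+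
  with * show ?thesis
    using equiv_class_self[OF roof_equiv_equiv[OF AB], of "(Z, s, f)"] by (simp add: roofs_iff)
qed

text \<open>Independence of the composite from both representatives and from the Ore square. A
  common refinement \<open>V2\<close> of \<open>Y\<close> and \<open>Y'\<close> is compared with the
  object \<open>U0\<close> that dominates the second factors. The resulting maps to
  \<open>W'\<close> agree only after composition with \<open>t'\<close>, and one more refinement,
  \<open>V4\<close>, removes \<open>t'\<close>.\<close>

lemma composite_roofs_equiv:
  assumes A: "A \<in> Ob" and B: "B \<in> Ob" and C: "C \<in> Ob"
    and R: "((Z, s, f), (Z', s', f')) \<in> roof_equiv X A B" and Q: "((W, t, g), (W', t', g')) \<in> roof_equiv X B C"
    and Y: "qi Y Z a" "mor Y W b" "hq Y B (f \<circ>\<^sub>c a) (t \<circ>\<^sub>c b)"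
    and Y': "qi Y' Z' a'" "mor Y' W' b'" "hq Y' B (f' \<circ>\<^sub>c a') (t' \<circ>\<^sub>c b')"
  shows "cl A C (Y, s \<circ>\<^sub>c a, g \<circ>\<^sub>c b) = cl A C (Y', s' \<circ>\<^sub>c a', g' \<circ>\<^sub>c b')"
proof -
  obtain V0 e e' where V0: "mor V0 Z e" "mor V0 Z' e'" "qi V0 A (s \<circ>\<^sub>c e)" "hq V0 A (s \<circ>\<^sub>c e) (s' \<circ>\<^sub>c e')"
      "hq V0 B (f \<circ>\<^sub>c e) (f' \<circ>\<^sub>c e')" using R unfolding roof_equiv_iff[OF A B] by blast
  have s: "qi Z A s" "qi Z' A s'" and f: "mor Z B f" "mor Z' B f'"
    using R unfolding roof_equiv_iff[OF A B] by blast+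
  obtain U0 m m' where U0: "mor U0 W m" "mor U0 W' m'" "qi U0 B (t \<circ>\<^sub>c m)" "hq U0 B (t \<circ>\<^sub>c m) (t' \<circ>\<^sub>c m')"
      "hq U0 C (g \<circ>\<^sub>c m) (g' \<circ>\<^sub>c m')" using Q unfolding roof_equiv_iff[OF B C] by blast
  have t: "qi W B t" "qi W' B t'" and g: "mor W C g" "mor W' C g'"
    using Q unfolding roof_equiv_iff[OF B C] by blast+
  have m: "qi U0 W m" using qi_cancel[OF U0(1) t(1) U0(3)] .
  \<comment> \<open>The leg \<open>p\<close> opposite to the quasi-isomorphism \<open>a\<close> is
    again one, so passing from \<open>V0\<close> to \<open>V1\<close> keeps the denominator a
    quasi-isomorphism.\<close>
  obtain V1 p q where V1: "qi V1 V0 p" "mor V1 Y q" "hq V1 Z (e \<circ>\<^sub>c p) (a \<circ>\<^sub>c q)"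
    by (rule qi_ore[OF V0(1) Y(1)])
  have p: "mor V1 V0 p" using V1 qi_mor by blast
  obtain V2 p2 q' where V2: "qi V2 V1 p2" "mor V2 Y' q'" "hq V2 Z' ((e' \<circ>\<^sub>c p) \<circ>\<^sub>c p2) (a' \<circ>\<^sub>c q')"
    by (rule qi_ore[OF mor_comp[OF p V0(2)] Y'(1)])
  have p2: "mor V2 V1 p2" using V2 qi_mor by blast
  define r where "r = q \<circ>\<^sub>c p2"
  have r: "mor V2 Y r" unfolding r_def by (rule mor_comp[OF p2 V1(2)])
  have br: "mor V2 W (b \<circ>\<^sub>c r)" by (rule mor_comp[OF r Y(2)])
  have ar: "hq V2 Z (a \<circ>\<^sub>c r) (e \<circ>\<^sub>c p \<circ>\<^sub>c p2)"
    using hq_sym[OF hq_right[OF p2 V1(3)]] by (simp add: ccomp_assoc r_def)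
  have pp: "mor V2 V0 (p \<circ>\<^sub>c p2)" by (rule mor_comp[OF p2 p])
  have eq': "hq V2 Z' (e' \<circ>\<^sub>c p \<circ>\<^sub>c p2) (a' \<circ>\<^sub>c q')" using V2(3) by (simp add: ccomp_assoc)
  have sar: "hq V2 A (s \<circ>\<^sub>c a \<circ>\<^sub>c r) (s \<circ>\<^sub>c e \<circ>\<^sub>c p \<circ>\<^sub>c p2)" by (rule hq_left[OF ar qi_mor[OF s(1)]])
  have "qi V2 A ((s \<circ>\<^sub>c e) \<circ>\<^sub>c p \<circ>\<^sub>c p2)" by (rule qi_comp[OF qi_comp[OF V2(1) V1(1)] V0(3)])
  then have sarq: "qi V2 A (s \<circ>\<^sub>c a \<circ>\<^sub>c r)" using qi_hq[OF _ hq_sym[OF sar]] by (simp add: ccomp_assoc)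
  have "hq V2 A ((s \<circ>\<^sub>c e) \<circ>\<^sub>c p \<circ>\<^sub>c p2) ((s' \<circ>\<^sub>c e') \<circ>\<^sub>c p \<circ>\<^sub>c p2)" by (rule hq_right[OF pp V0(4)])
  with sar have "hq V2 A (s \<circ>\<^sub>c a \<circ>\<^sub>c r) (s' \<circ>\<^sub>c e' \<circ>\<^sub>c p \<circ>\<^sub>c p2)" by (auto simp: ccomp_assoc intro: hq_trans)
  also have "hq V2 A (s' \<circ>\<^sub>c e' \<circ>\<^sub>c p \<circ>\<^sub>c p2) (s' \<circ>\<^sub>c a' \<circ>\<^sub>c q')" by (rule hq_left[OF eq' qi_mor[OF s(2)]])
  finally have ss: "hq V2 A (s \<circ>\<^sub>c a \<circ>\<^sub>c r) (s' \<circ>\<^sub>c a' \<circ>\<^sub>c q')" .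
  \<comment> \<open>Since \<open>m\<close> is a quasi-isomorphism, the map from \<open>V2\<close> to
    \<open>W\<close> lifts to \<open>U0\<close> up to homotopy after a refinement.\<close>
  obtain V3 p3 k where V3: "qi V3 V2 p3" "mor V3 U0 k" "hq V3 W ((b \<circ>\<^sub>c r) \<circ>\<^sub>c p3) (m \<circ>\<^sub>c k)"
    by (rule qi_ore[OF br m])
  have p3: "mor V3 V2 p3" using V3 qi_mor by blast
  have bq: "mor V2 W' (b' \<circ>\<^sub>c q')" by (rule mor_comp[OF V2(2) Y'(2)])
  have "hq V2 B (t \<circ>\<^sub>c b \<circ>\<^sub>c r) (f \<circ>\<^sub>c a \<circ>\<^sub>c r)" using hq_sym[OF hq_right[OF r Y(3)]] by (simp add: ccomp_assoc)
  also have "hq V2 B (f \<circ>\<^sub>c a \<circ>\<^sub>c r) (f \<circ>\<^sub>c e \<circ>\<^sub>c p \<circ>\<^sub>c p2)" by (rule hq_left[OF ar f(1)])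
  also have "hq V2 B (f \<circ>\<^sub>c e \<circ>\<^sub>c p \<circ>\<^sub>c p2) (f' \<circ>\<^sub>c e' \<circ>\<^sub>c p \<circ>\<^sub>c p2)" using hq_right[OF pp V0(5)] by (simp add: ccomp_assoc)
  also have "hq V2 B (f' \<circ>\<^sub>c e' \<circ>\<^sub>c p \<circ>\<^sub>c p2) (f' \<circ>\<^sub>c a' \<circ>\<^sub>c q')" by (rule hq_left[OF eq' f(2)])
  also have "hq V2 B (f' \<circ>\<^sub>c a' \<circ>\<^sub>c q') (t' \<circ>\<^sub>c b' \<circ>\<^sub>c q')" using hq_right[OF V2(2) Y'(3)] by (simp add: ccomp_assoc)
  finally have tb: "hq V2 B (t \<circ>\<^sub>c b \<circ>\<^sub>c r) (t' \<circ>\<^sub>c b' \<circ>\<^sub>c q')" .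
  have "hq V3 B (t' \<circ>\<^sub>c m' \<circ>\<^sub>c k) (t \<circ>\<^sub>c m \<circ>\<^sub>c k)" using hq_sym[OF hq_right[OF V3(2) U0(4)]] by (simp add: ccomp_assoc)
  also have "hq V3 B (t \<circ>\<^sub>c m \<circ>\<^sub>c k) (t \<circ>\<^sub>c b \<circ>\<^sub>c r \<circ>\<^sub>c p3)"
    using hq_left[OF hq_sym[OF V3(3)] qi_mor[OF t(1)]] by (simp add: ccomp_assoc)
  also have "hq V3 B (t \<circ>\<^sub>c b \<circ>\<^sub>c r \<circ>\<^sub>c p3) (t' \<circ>\<^sub>c b' \<circ>\<^sub>c q' \<circ>\<^sub>c p3)" using hq_right[OF p3 tb] by (simp add: ccomp_assoc)
  finally have tm: "hq V3 B (t' \<circ>\<^sub>c m' \<circ>\<^sub>c k) (t' \<circ>\<^sub>c (b' \<circ>\<^sub>c q') \<circ>\<^sub>c p3)" by (simp add: ccomp_assoc)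
  obtain V4 p4 where V4: "qi V4 V3 p4" "hq V4 W' ((m' \<circ>\<^sub>c k) \<circ>\<^sub>c p4) (((b' \<circ>\<^sub>c q') \<circ>\<^sub>c p3) \<circ>\<^sub>c p4)"
    by (rule qi_right_cancel[OF mor_comp[OF V3(2) U0(2)] mor_comp[OF p3 bq] t(2) tm])
  have p4: "mor V4 V3 p4" using V4 qi_mor by blast
  have P: "qi V4 V2 (p3 \<circ>\<^sub>c p4)" by (rule qi_comp[OF V4(1) V3(1)])
  note Pm = qi_mor[OF P]
  have "hq V4 C (g \<circ>\<^sub>c b \<circ>\<^sub>c r \<circ>\<^sub>c p3 \<circ>\<^sub>c p4) (g \<circ>\<^sub>c m \<circ>\<^sub>c k \<circ>\<^sub>c p4)"
    using hq_right[OF p4 hq_left[OF V3(3) g(1)]] by (simp add: ccomp_assoc)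
  also have "hq V4 C (g \<circ>\<^sub>c m \<circ>\<^sub>c k \<circ>\<^sub>c p4) (g' \<circ>\<^sub>c m' \<circ>\<^sub>c k \<circ>\<^sub>c p4)"
    using hq_right[OF mor_comp[OF p4 V3(2)] U0(5)] by (simp add: ccomp_assoc)
  also have "hq V4 C (g' \<circ>\<^sub>c m' \<circ>\<^sub>c k \<circ>\<^sub>c p4) (g' \<circ>\<^sub>c b' \<circ>\<^sub>c q' \<circ>\<^sub>c p3 \<circ>\<^sub>c p4)"
    using hq_left[OF V4(2) g(2)] by (simp add: ccomp_assoc)
  finally have gg: "hq V4 C (g \<circ>\<^sub>c b \<circ>\<^sub>c r \<circ>\<^sub>c p3 \<circ>\<^sub>c p4) (g' \<circ>\<^sub>c b' \<circ>\<^sub>c q' \<circ>\<^sub>c p3 \<circ>\<^sub>c p4)" .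
  show ?thesis
  proof (rule cl_eqI)
    show "qi Y A (s \<circ>\<^sub>c a)" "qi Y' A (s' \<circ>\<^sub>c a')" using Y Y' s qi_comp by blast+
    show "mor Y C (g \<circ>\<^sub>c b)" "mor Y' C (g' \<circ>\<^sub>c b')" using Y Y' g mor_comp by blast+
    show "mor V4 Y (r \<circ>\<^sub>c p3 \<circ>\<^sub>c p4)" "mor V4 Y' (q' \<circ>\<^sub>c p3 \<circ>\<^sub>c p4)" using Pm r V2(2) mor_comp by blast+
    show "qi V4 A ((s \<circ>\<^sub>c a) \<circ>\<^sub>c r \<circ>\<^sub>c p3 \<circ>\<^sub>c p4)" using qi_comp[OF P sarq] by (simp add: ccomp_assoc)
    show "hq V4 A ((s \<circ>\<^sub>c a) \<circ>\<^sub>c r \<circ>\<^sub>c p3 \<circ>\<^sub>c p4) ((s' \<circ>\<^sub>c a') \<circ>\<^sub>c q' \<circ>\<^sub>c p3 \<circ>\<^sub>c p4)"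
      using hq_right[OF Pm ss] by (simp add: ccomp_assoc)
    show "hq V4 C ((g \<circ>\<^sub>c b) \<circ>\<^sub>c r \<circ>\<^sub>c p3 \<circ>\<^sub>c p4) ((g' \<circ>\<^sub>c b') \<circ>\<^sub>c q' \<circ>\<^sub>c p3 \<circ>\<^sub>c p4)"
      using gg by (simp add: ccomp_assoc)
  qed
qed

text \<open>\<open>Dcomp\<close> collects the roofs equivalent to composites over all choices of
  representatives and squares; by the independence just proved, these form the class of any single
  composite.\<close>

lemma Dcomp_cl:
  assumes s: "qi Z A s" and f: "mor Z B f" and t: "qi W B t" and g: "mor W C g"
    and Y: "qi Y Z a" "mor Y W b" "hq Y B (f \<circ>\<^sub>c a) (t \<circ>\<^sub>c b)"
  shows "Dcomp X A B C (cl B C (W, t, g)) (cl A B (Z, s, f)) = cl A C (Y, s \<circ>\<^sub>c a, g \<circ>\<^sub>c b)"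
proof -
  have A: "A \<in> Ob" and B: "B \<in> Ob" and C: "C \<in> Ob" using s f g mor_Ob qi_mor by blast+
  show ?thesis
  proof (intro equalityI subsetI)
    fix R assume "R \<in> Dcomp X A B C (cl B C (W, t, g)) (cl A B (Z, s, f))"
    then obtain Z' s' f' W' t' g' Y' a' b' where
      1: "((Z, s, f), (Z', s', f')) \<in> roof_equiv X A B" "((W, t, g), (W', t', g')) \<in> roof_equiv X B C"
      "Y' \<in> Ob" "quasi_iso X Y' Z' a'" "chain_map X Y' W' b'" "homotopic X Y' B (f' \<circ>\<^sub>c a') (t' \<circ>\<^sub>c b')"
      and R: "R \<in> cl A C (Y', s' \<circ>\<^sub>c a', g' \<circ>\<^sub>c b')"
      unfolding Dcomp_def by auto
    have "mor Z' B f'" "mor W' B t'" "mor W' C g'"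
      using 1(1,2) unfolding roof_equiv_iff[OF A B] roof_equiv_iff[OF B C] by (blast intro: qi_mor)+
    with 1 have "qi Y' Z' a'" "mor Y' W' b'" "hq Y' B (f' \<circ>\<^sub>c a') (t' \<circ>\<^sub>c b')"
      by (auto simp: qi_def mor_def hq_def qis_chain intro: chain_comp)
    then show "R \<in> cl A C (Y, s \<circ>\<^sub>c a, g \<circ>\<^sub>c b)"
      using composite_roofs_equiv[OF A B C 1(1,2) Y] R by simp
  next
    fix R assume R: "R \<in> cl A C (Y, s \<circ>\<^sub>c a, g \<circ>\<^sub>c b)"
    have "(Z, s, f) \<in> cl A B (Z, s, f)" "(W, t, g) \<in> cl B C (W, t, g)" using s t f g cl_self by blast+
    moreover have "Y \<in> Ob" "quasi_iso X Y Z a" "chain_map X Y W b" "homotopic X Y B (f \<circ>\<^sub>c a) (t \<circ>\<^sub>c b)"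
      using Y by (simp_all add: qi_def mor_def hq_def)
    ultimately show "R \<in> Dcomp X A B C (cl B C (W, t, g)) (cl A B (Z, s, f))"
      using R unfolding Dcomp_def mem_Collect_eq Image_singleton_iff by blast
  qed
qed

lemma Dcomp_closed:
  assumes "A \<in> Ob" "B \<in> Ob" "C \<in> Ob" "\<phi> \<in> DHom X A B" "\<psi> \<in> DHom X B C"
  shows "Dcomp X A B C \<psi> \<phi> \<in> DHom X A C"
proof -
  obtain Z s f where R: "qi Z A s" "mor Z B f" "\<phi> = cl A B (Z, s, f)" using assms DHomE by blast
  obtain W t g where Q: "qi W B t" "mor W C g" "\<psi> = cl B C (W, t, g)" using assms DHomE by blast
  obtain Y a b where Y: "qi Y Z a" "mor Y W b" "hq Y B (f \<circ>\<^sub>c a) (t \<circ>\<^sub>c b)" by (rule qi_ore[OF R(2) Q(1)])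
  show ?thesis
    unfolding R(3) Q(3) Dcomp_cl[OF R(1,2) Q(1,2) Y]
    using R Q Y by (intro cl_DHom) (blast intro: qi_comp mor_comp)+
qed

text \<open>A third Ore square over \<open>W\<close> joins the squares of the two inner composites,
  so that both bracketings are represented by one roof with apex \<open>Y3\<close>.\<close>

lemma Dcomp_assoc:
  assumes "A \<in> Ob" "B \<in> Ob" "C \<in> Ob" "D \<in> Ob" "\<phi> \<in> DHom X A B" "\<psi> \<in> DHom X B C" "\<omega> \<in> DHom X C D"
  shows "Dcomp X A B D (Dcomp X B C D \<omega> \<psi>) \<phi> = Dcomp X A C D \<omega> (Dcomp X A B C \<psi> \<phi>)"
proof -
  obtain Z s f where R: "qi Z A s" "mor Z B f" "\<phi> = cl A B (Z, s, f)" using assms DHomE by blast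
  obtain W t g where Q: "qi W B t" "mor W C g" "\<psi> = cl B C (W, t, g)" using assms DHomE by blast
  obtain V r h where P: "qi V C r" "mor V D h" "\<omega> = cl C D (V, r, h)" using assms DHomE by blast
  obtain Y1 a1 b1 where Y1: "qi Y1 Z a1" "mor Y1 W b1" "hq Y1 B (f \<circ>\<^sub>c a1) (t \<circ>\<^sub>c b1)" by (rule qi_ore[OF R(2) Q(1)])
  obtain Y2 a2 b2 where Y2: "qi Y2 W a2" "mor Y2 V b2" "hq Y2 C (g \<circ>\<^sub>c a2) (r \<circ>\<^sub>c b2)" by (rule qi_ore[OF Q(2) P(1)])
  obtain Y3 a3 b3 where Y3: "qi Y3 Y1 a3" "mor Y3 Y2 b3" "hq Y3 W (b1 \<circ>\<^sub>c a3) (a2 \<circ>\<^sub>c b3)" by (rule qi_ore[OF Y1(2) Y2(1)])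
  note a3 = qi_mor[OF Y3(1)]
  have 1: "hq Y3 C ((g \<circ>\<^sub>c b1) \<circ>\<^sub>c a3) (r \<circ>\<^sub>c b2 \<circ>\<^sub>c b3)"
    using hq_trans[OF hq_left[OF Y3(3) Q(2)]] hq_right[OF Y3(2) Y2(3)] by (simp add: ccomp_assoc)
  have 2: "hq Y3 B (f \<circ>\<^sub>c a1 \<circ>\<^sub>c a3) ((t \<circ>\<^sub>c a2) \<circ>\<^sub>c b3)"
    using hq_trans[OF hq_right[OF a3 Y1(3)]] hq_left[OF Y3(3) qi_mor[OF Q(1)]] by (simp add: ccomp_assoc)
  have "Dcomp X A C D \<omega> (Dcomp X A B C \<psi> \<phi>) = cl A D (Y3, (s \<circ>\<^sub>c a1) \<circ>\<^sub>c a3, h \<circ>\<^sub>c b2 \<circ>\<^sub>c b3)"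
    unfolding R(3) Q(3) P(3) Dcomp_cl[OF R(1,2) Q(1,2) Y1]
    by (rule Dcomp_cl[OF qi_comp[OF Y1(1) R(1)] mor_comp[OF Y1(2) Q(2)] P(1,2) Y3(1) mor_comp[OF Y3(2) Y2(2)] 1])
  moreover have "Dcomp X A B D (Dcomp X B C D \<omega> \<psi>) \<phi> = cl A D (Y3, s \<circ>\<^sub>c a1 \<circ>\<^sub>c a3, (h \<circ>\<^sub>c b2) \<circ>\<^sub>c b3)"
    unfolding R(3) Q(3) P(3) Dcomp_cl[OF Q(1,2) P(1,2) Y2]
    by (rule Dcomp_cl[OF R(1,2) qi_comp[OF Y2(1) Q(1)] mor_comp[OF Y2(2) P(2)] qi_comp[OF Y3(1) Y1(1)] Y3(2) 2])
  ultimately show ?thesis by (simp add: ccomp_assoc)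
qed

lemma Dloc_DHom: "mor A B f \<Longrightarrow> Dloc X A B f \<in> DHom X A B"
  unfolding Dloc_def by (rule cl_DHom) (auto intro: qi_id mor_Ob)

text \<open>The second factor has the identity as denominator, so the trivial square with apex
  \<open>Z\<close> serves and only the numerator changes.\<close>

lemma Dcomp_Dloc_left:
  assumes "qi Z A s" "mor Z B f" "mor B C g"
  shows "Dcomp X A B C (Dloc X B C g) (cl A B (Z, s, f)) = cl A C (Z, s, g \<circ>\<^sub>c f)"
proof -
  have O: "Z \<in> Ob" "B \<in> Ob" using assms mor_Ob by blast+
  have "hq Z B (f \<circ>\<^sub>c cid) (cid \<circ>\<^sub>c f)" using assms by (simp add: hq_refl)
  from Dcomp_cl[OF assms(1,2) qi_id[OF O(2)] assms(3) qi_id[OF O(1)] assms(2) this]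
  show ?thesis by (simp add: Dloc_def)
qed

text \<open>Here the denominator \<open>t\<close> has to be carried across \<open>f\<close>. The
  square therefore remains a premise, and its leg \<open>a\<close> becomes the new
  denominator.\<close>

lemma Dcomp_Dloc_right:
  assumes "mor A B f" "qi W B t" "mor W C g" "qi Y A a" "mor Y W b" "hq Y B (f \<circ>\<^sub>c a) (t \<circ>\<^sub>c b)"
  shows "Dcomp X A B C (cl B C (W, t, g)) (Dloc X A B f) = cl A C (Y, a, g \<circ>\<^sub>c b)"
  using Dcomp_cl[OF qi_id[OF mor_Ob(1)[OF assms(1)]] assms] by (simp add: Dloc_def)

lemma Dcomp_id_left: "A \<in> Ob \<Longrightarrow> B \<in> Ob \<Longrightarrow> \<phi> \<in> DHom X A B \<Longrightarrow> Dcomp X A B B (Did X B) \<phi> = \<phi>"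
  unfolding Did_def by (elim DHomE) (auto simp: Dcomp_Dloc_left mor_id)

lemma Dcomp_id_right:
  assumes "A \<in> Ob" "B \<in> Ob" "\<phi> \<in> DHom X A B"
  shows "Dcomp X A A B \<phi> (Did X A) = \<phi>"
proof -
  obtain Z s f where R: "qi Z A s" "mor Z B f" "\<phi> = cl A B (Z, s, f)" using assms DHomE by blast
  have O: "A \<in> Ob" "Z \<in> Ob" using R mor_Ob assms by blast+
  have "hq Z A (cid \<circ>\<^sub>c s) (s \<circ>\<^sub>c cid)" using R by (simp add: hq_refl qi_mor)
  from Dcomp_Dloc_right[OF mor_id[OF O(1)] R(1,2) R(1) mor_id[OF O(2)] this]
  show ?thesis by (simp add: Did_def R(3))
qed

section \<open>Zero morphisms\<close>

lemma czero_ccomp [simp]: "czero B \<circ>\<^sub>c f = czero B"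
  by (simp add: czero_def ccomp_def)

lemma hq_ccomp_czero: "A \<in> Ob \<Longrightarrow> mor B C g \<Longrightarrow> hq A C (g \<circ>\<^sub>c czero B) (czero C)"
  by (rule hq_eqI[OF mor_zero]) (auto simp: mor_def czero_def ccomp_def cm_simps(4))

text \<open>A fraction vanishes when its numerator does after a refinement of the denominator. The
  leg into the zero roof disappears because \<open>czero B\<close> absorbs any map composed on its
  right.\<close>

lemma cl_eq_Dzero_iff:
  assumes s: "qi Z A s" and f: "mor Z B f"
  shows "cl A B (Z, s, f) = Dzero X A B \<longleftrightarrow> (\<exists>Y a. qi Y Z a \<and> hq Y B (f \<circ>\<^sub>c a) (czero B))"
proof -
  have A: "A \<in> Ob" and B: "B \<in> Ob" using s f mor_Ob qi_mor by blast+
  have "cl A B (Z, s, f) = Dzero X A B \<longleftrightarrow> (\<exists>Y a b. mor Y Z a \<and> mor Y A b \<and> qi Y A (s \<circ>\<^sub>c a) \<and>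
      hq Y A (s \<circ>\<^sub>c a) (cid \<circ>\<^sub>c b) \<and> hq Y B (f \<circ>\<^sub>c a) (czero B \<circ>\<^sub>c b))"
    unfolding Dzero_def Dloc_def by (rule cl_eq_iff[OF s f qi_id[OF A] mor_zero[OF A B]])
  also have "\<dots> \<longleftrightarrow> (\<exists>Y a. qi Y Z a \<and> hq Y B (f \<circ>\<^sub>c a) (czero B))"
  proof (intro iffI; elim exE conjE)
    fix Y a b
    assume *: "mor Y Z a" "qi Y A (s \<circ>\<^sub>c a)" "hq Y B (f \<circ>\<^sub>c a) (czero B \<circ>\<^sub>c b)"
    then have "qi Y Z a" using qi_cancel s by blast
    with * show "\<exists>Y a. qi Y Z a \<and> hq Y B (f \<circ>\<^sub>c a) (czero B)" by auto
  next
    fix Y a assume *: "qi Y Z a" "hq Y B (f \<circ>\<^sub>c a) (czero B)"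
    then have "qi Y A (s \<circ>\<^sub>c a)" using s qi_comp by blast
    with * show "\<exists>Y a b. mor Y Z a \<and> mor Y A b \<and> qi Y A (s \<circ>\<^sub>c a) \<and>
        hq Y A (s \<circ>\<^sub>c a) (cid \<circ>\<^sub>c b) \<and> hq Y B (f \<circ>\<^sub>c a) (czero B \<circ>\<^sub>c b)"
      by (intro exI[of _ Y] exI[of _ a] exI[of _ "s \<circ>\<^sub>c a"]) (auto intro: qi_mor hq_refl)
  qed
  finally show ?thesis .
qed

lemma Dzero_DHom: "A \<in> Ob \<Longrightarrow> B \<in> Ob \<Longrightarrow> Dzero X A B \<in> DHom X A B"
  unfolding Dzero_def by (intro Dloc_DHom mor_zero)

lemma Dloc_hq: "hq A B f g \<Longrightarrow> Dloc X A B f = Dloc X A B g"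
  unfolding Dloc_def by (rule cl_hqI) (auto intro: qi_id hq_refl mor_id dest: hq_mor mor_Ob)

lemma Dcomp_Dzero_right:
  assumes "A \<in> Ob" "B \<in> Ob" "C \<in> Ob" "\<psi> \<in> DHom X B C"
  shows "Dcomp X A B C \<psi> (Dzero X A B) = Dzero X A C"
proof -
  obtain W t g where Q: "qi W B t" "mor W C g" "\<psi> = cl B C (W, t, g)" using assms DHomE by blast
  have W: "W \<in> Ob" using Q mor_Ob by blast
  have "hq A B (czero B \<circ>\<^sub>c cid) (t \<circ>\<^sub>c czero W)"
    using hq_sym[OF hq_ccomp_czero[OF assms(1) qi_mor[OF Q(1)]]] by simp
  from Dcomp_Dloc_right[OF mor_zero[OF assms(1,2)] Q(1,2) qi_id[OF assms(1)] mor_zero[OF assms(1) W] this]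
  have "Dcomp X A B C \<psi> (Dzero X A B) = Dloc X A C (g \<circ>\<^sub>c czero W)"
    by (simp add: Dzero_def Q(3) Dloc_def)
  also have "\<dots> = Dzero X A C"
    unfolding Dzero_def by (rule Dloc_hq[OF hq_ccomp_czero[OF assms(1) Q(2)]])
  finally show ?thesis .
qed

lemma Dcomp_Dzero_left:
  assumes "A \<in> Ob" "B \<in> Ob" "C \<in> Ob" "\<phi> \<in> DHom X A B"
  shows "Dcomp X A B C (Dzero X B C) \<phi> = Dzero X A C"
proof -
  obtain Z s f where R: "qi Z A s" "mor Z B f" "\<phi> = cl A B (Z, s, f)" using assms DHomE by blast
  have Z: "Z \<in> Ob" using R mor_Ob by blast
  have "Dcomp X A B C (Dzero X B C) \<phi> = cl A C (Z, s, czero C)"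
    using Dcomp_Dloc_left[OF R(1,2) mor_zero[OF assms(2,3)]] by (simp add: Dzero_def R(3))
  also have "\<dots> = Dzero X A C"
    unfolding cl_eq_Dzero_iff[OF R(1) mor_zero[OF Z assms(3)]]
    using qi_id[OF Z] hq_refl[OF mor_zero[OF Z assms(3)]] by auto
  finally show ?thesis .
qed

lemma Dcomp_Dloc_Dloc:
  "mor A B f \<Longrightarrow> mor B C g \<Longrightarrow> Dcomp X A B C (Dloc X B C g) (Dloc X A B f) = Dloc X A C (g \<circ>\<^sub>c f)"
  using Dcomp_Dloc_left[of A A cid B f C g] by (simp add: Dloc_def[of X A] qi_id mor_Ob)

section \<open>The shift functor on roofs\<close>

lemma shift_qi: "qi A B f \<Longrightarrow> qi (shift n A) (shift n B) (shift_map n f)"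
  by (simp add: qi_def shift_qis)

lemma shift_mor: "mor A B f \<Longrightarrow> mor (shift n A) (shift n B) (shift_map n f)"
  by (simp add: mor_def shift_chain)

lemma shift_hq: "hq A B f g \<Longrightarrow> hq (shift n A) (shift n B) (shift_map n f) (shift_map n g)"
  by (auto simp: hq_def shift_mor) (auto simp: mor_def shift_homotopic)

lemma shift_cl_eq:
  assumes "((Z, s, f), (Z', s', f')) \<in> roof_equiv X A B" and A: "A \<in> Ob" and B: "B \<in> Ob"
  shows "cl (shift n A) (shift n B) (shift n Z, shift_map n s, shift_map n f) =
    cl (shift n A) (shift n B) (shift n Z', shift_map n s', shift_map n f')"
proof -
  obtain Y a b where *: "qi Z A s" "mor Z B f" "qi Z' A s'" "mor Z' B f'" "mor Y Z a" "mor Y Z' b"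
    "qi Y A (s \<circ>\<^sub>c a)" "hq Y A (s \<circ>\<^sub>c a) (s' \<circ>\<^sub>c b)" "hq Y B (f \<circ>\<^sub>c a) (f' \<circ>\<^sub>c b)"
    using assms(1) unfolding roof_equiv_iff[OF A B] by blast
  show ?thesis
    using shift_qi[OF *(7), of n] shift_hq[OF *(8), of n] shift_hq[OF *(9), of n]
    by (intro cl_eqI[where Y = "shift n Y" and a = "shift_map n a" and b = "shift_map n b"])
      (simp_all add: shift_qi shift_mor *)
qed

lemma Dshift_cl:
  assumes s: "qi Z A s" and f: "mor Z B f"
  shows "Dshift X n A B (cl A B (Z, s, f)) = cl (shift n A) (shift n B) (shift n Z, shift_map n s, shift_map n f)"
proof -
  have A: "A \<in> Ob" and B: "B \<in> Ob" using s f mor_Ob qi_mor by blast+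
  show ?thesis
  proof (intro equalityI subsetI)
    fix R assume "R \<in> Dshift X n A B (cl A B (Z, s, f))"
    then obtain Z' s' f' where "((Z, s, f), (Z', s', f')) \<in> roof_equiv X A B"
      "R \<in> cl (shift n A) (shift n B) (shift n Z', shift_map n s', shift_map n f')"
      unfolding Dshift_def by auto
    then show "R \<in> cl (shift n A) (shift n B) (shift n Z, shift_map n s, shift_map n f)"
      using shift_cl_eq[OF _ A B] by blast
  next
    fix R assume R: "R \<in> cl (shift n A) (shift n B) (shift n Z, shift_map n s, shift_map n f)"
    then show "R \<in> Dshift X n A B (cl A B (Z, s, f))"
      using cl_self[OF s f] unfolding Dshift_def mem_Collect_eq Image_singleton_iff by blast
  qed
qed

lemma Dshift_DHom:
  assumes "A \<in> Ob" "B \<in> Ob" "\<phi> \<in> DHom X A B"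
  shows "Dshift X n A B \<phi> \<in> DHom X (shift n A) (shift n B)"
proof -
  obtain Z s f where R: "qi Z A s" "mor Z B f" "\<phi> = cl A B (Z, s, f)" using assms DHomE by blast
  show ?thesis unfolding R(3) Dshift_cl[OF R(1,2)] using R by (intro cl_DHom shift_qi shift_mor)
qed

lemma Dshift_Dcomp:
  assumes "A \<in> Ob" "B \<in> Ob" "C \<in> Ob" "\<phi> \<in> DHom X A B" "\<psi> \<in> DHom X B C"
  shows "Dshift X n A C (Dcomp X A B C \<psi> \<phi>) =
    Dcomp X (shift n A) (shift n B) (shift n C) (Dshift X n B C \<psi>) (Dshift X n A B \<phi>)"
proof -
  obtain Z s f where R: "qi Z A s" "mor Z B f" "\<phi> = cl A B (Z, s, f)" using assms DHomE by blast
  obtain W t g where Q: "qi W B t" "mor W C g" "\<psi> = cl B C (W, t, g)" using assms DHomE by blast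
  obtain Y a b where Y: "qi Y Z a" "mor Y W b" "hq Y B (f \<circ>\<^sub>c a) (t \<circ>\<^sub>c b)" by (rule qi_ore[OF R(2) Q(1)])
  have "hq (shift n Y) (shift n B) (shift_map n f \<circ>\<^sub>c shift_map n a) (shift_map n t \<circ>\<^sub>c shift_map n b)"
    using shift_hq[OF Y(3), of n] by simp
  from Dcomp_cl[OF shift_qi[OF R(1)] shift_mor[OF R(2)] shift_qi[OF Q(1)] shift_mor[OF Q(2)] shift_qi[OF Y(1)] shift_mor[OF Y(2)] this]
  show ?thesis
    unfolding R(3) Q(3) Dshift_cl[OF R(1,2)] Dshift_cl[OF Q(1,2)] Dcomp_cl[OF R(1,2) Q(1,2) Y]
      Dshift_cl[OF qi_comp[OF Y(1) R(1)] mor_comp[OF Y(2) Q(2)]] by simp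
qed

lemma Dshift_Dloc: "mor A B f \<Longrightarrow> Dshift X n A B (Dloc X A B f) = Dloc X (shift n A) (shift n B) (shift_map n f)"
  unfolding Dloc_def using Dshift_cl[of A A cid B f n] by (simp add: qi_id mor_Ob)

lemma Dshift_Did: "A \<in> Ob \<Longrightarrow> Dshift X n A A (Did X A) = Did X (shift n A)"
  unfolding Did_def by (simp add: Dshift_Dloc mor_id)

lemma DisoE:
  assumes "Diso X A B \<phi>"
  obtains \<psi> where "\<phi> \<in> DHom X A B" "\<psi> \<in> DHom X B A" "Dcomp X A B A \<psi> \<phi> = Did X A" "Dcomp X B A B \<phi> \<psi> = Did X B"
  using assms by (auto simp: Diso_def)

lemma Diso_shift:
  assumes A: "A \<in> Ob" and B: "B \<in> Ob" and \<phi>: "Diso X A B \<phi>"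
  shows "Diso X (shift n A) (shift n B) (Dshift X n A B \<phi>)"
proof -
  obtain \<psi> where *: "\<phi> \<in> DHom X A B" "\<psi> \<in> DHom X B A" "Dcomp X A B A \<psi> \<phi> = Did X A" "Dcomp X B A B \<phi> \<psi> = Did X B"
    using \<phi> by (rule DisoE)
  show ?thesis
    unfolding Diso_def
    using Dshift_DHom[OF A B *(1)] Dshift_DHom[OF B A *(2)]
      Dshift_Dcomp[OF A B A *(1,2), of n] Dshift_Dcomp[OF B A B *(2,1), of n] A B
    by (intro conjI bexI[of _ "Dshift X n B A \<psi>"]) (simp_all add: * Dshift_Did)
qed

lemma cl_refine:
  assumes "qi Z A s" "mor Z B f" "qi Y Z a"
  shows "cl A B (Z, s, f) = cl A B (Y, s \<circ>\<^sub>c a, f \<circ>\<^sub>c a)"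
proof -
  have "qi Y A (s \<circ>\<^sub>c a)" "mor Y B (f \<circ>\<^sub>c a)" "mor Y Y cid"
    using assms qi_comp mor_comp qi_mor mor_id mor_Ob by blast+
  with assms show ?thesis
    by (intro cl_eqI[where Y = Y and a = a and b = cid]) (auto intro: hq_refl qi_mor)
qed

section \<open>Mapping cones\<close>

text \<open>The sign in the first coordinate of the cone differential is that of
  \<open>A[1]\<close>, so a cone is the extension of \<open>A[1]\<close> by \<open>B\<close> with
  \<open>f\<close> as its twisting.\<close>

lemma cone_eq_tw: "cone A B f = tw (shift 1 A) B (\<lambda>i. f (i + 1))"
  by (simp add: cone_def tw_def shift_def add.assoc)

lemma cone_twisting:
  assumes f: "mor A B f"
  shows "twisting (shift 1 A) B (\<lambda>i. f (i + 1))"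
proof -
  have A: "A \<in> Ob" and B: "B \<in> Ob" and cf: "chain_map X A B f" using f by (simp_all add: mor_def)
  note [simp] = A B cm_simps[OF A B cf]
  show ?thesis
  proof (rule twistingI)
    show "deg 1 (shift 1 A) B (\<lambda>i. f (i + 1))" using chain_shom[OF cf] by (simp add: deg_def)
    fix i U s assume *: "opn U" "s \<in> carrier (sec (shift 1 A) i U)"
    have "f (i + 1 + 1) U (cdiff A (i + 1) U s) = cdiff B (i + 1) U (f (i + 1) U s)"
      by (rule cm_simps(5)[OF A B cf *(1)]) (use * in simp)
    moreover have "cdiff A (i + 1) U s \<in> carrier (sec A (i + 2) U)" using d_closed[OF A *(1), of s "i + 1"] * by simp
    ultimately show "f (i + 1 + 1) U (cdiff (shift 1 A) i U s) = \<ominus>\<^bsub>sec B (i + 2) U\<^esub> cdiff B (i + 1) U (f (i + 1) U s)"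
      using * by simp
  qed simp_all
qed

lemma cone_Ob: "mor A B f \<Longrightarrow> cone A B f \<in> Ob"
  unfolding cone_eq_tw by (rule tw_Ob[OF cone_twisting])

lemma cone_proj_mor: "mor A B f \<Longrightarrow> mor (cone A B f) (shift 1 A) cone_proj"
  using tw_fst_chain[OF cone_twisting, of A B f] cone_Ob[of A B f]
  by (simp add: mor_def cone_eq_tw cone_proj_def)

lemma cone_incl_mor: "mor A B f \<Longrightarrow> mor B (cone A B f) (cone_incl A)"
  using tw_incl_chain[OF cone_twisting, of A B f] cone_Ob[of A B f]
  by (simp add: mor_def cone_eq_tw cone_incl_def)

section \<open>Complexes agreeing on sections\<close>

text \<open>This relation is needed because \<open>A[n][m]\<close> and \<open>A[n+m]\<close> may differ outside the sections, where
  \<open>\<ominus>\<close> is not an involution.\<close>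

definition ceq :: "('x, 's) cplx \<Rightarrow> ('x, 's) cplx \<Rightarrow> bool" where
  "ceq C C' \<longleftrightarrow> cob C = cob C' \<and>
     (\<forall>i U s. opn U \<longrightarrow> s \<in> carrier (sec C i U) \<longrightarrow> cdiff C i U s = cdiff C' i U s)"

lemma ceq_sym: "ceq C C' \<Longrightarrow> ceq C' C"
  by (simp add: ceq_def)

lemma ceq_chain: "ceq C C' \<Longrightarrow> chain_map X A C f \<Longrightarrow> chain_map X A C' f"
proof -
  assume c: "ceq C C'" and f: "chain_map X A C f"
  have cob: "cob C' = cob C" and d: "\<And>i U s. opn U \<Longrightarrow> s \<in> carrier (sec C i U) \<Longrightarrow> cdiff C' i U s = cdiff C i U s"
    using c by (simp_all add: ceq_def)
  have "f i U s \<in> carrier (sec C i U)" if "opn U" "s \<in> carrier (sec A i U)" for i U s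
    using chain_shom[OF f] that by (simp add: sheaf_hom_def)
  then show ?thesis using f by (simp add: chain_map_def cob d)
qed

lemma ceq_homotopy_by:
  assumes c: "ceq C C'" and h: "homotopy_by A C h f g"
  shows "homotopy_by A C' h f g"
proof -
  have cob: "cob C' = cob C" and d: "\<And>i U s. opn U \<Longrightarrow> s \<in> carrier (sec C i U) \<Longrightarrow> cdiff C' i U s = cdiff C i U s"
    using c by (simp_all add: ceq_def)
  have dh: "deg (- 1) A C h" using homotopy_byD(1)[OF h] .
  have cl: "h i U s \<in> carrier (sec C (i - 1) U)" if "opn U" "s \<in> carrier (sec A i U)" for i U s
    using dh that by (simp add: deg_def sheaf_hom_def)
  show ?thesis
    unfolding homotopy_by_def
  proof (intro conjI allI impI)
    show "deg (- 1) A C' h" using dh by (simp add: deg_def cob)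
    fix i U s assume *: "opn U" "s \<in> carrier (sec A i U)"
    show "f i U s = g i U s \<oplus>\<^bsub>sec C' i U\<^esub> (cdiff C' (i - 1) U (h i U s) \<oplus>\<^bsub>sec C' i U\<^esub> h (i + 1) U (cdiff A i U s))"
      unfolding cob d[OF *(1) cl[OF *]] by (rule homotopy_byD(2)[OF h *])
  qed
qed

lemma ceq_cong:
  assumes c: "ceq C C'"
  shows "chain_map X A C = chain_map X A C'" "homotopic X A C = homotopic X A C'"
proof -
  show "chain_map X A C = chain_map X A C'"
    using ceq_chain[OF c] ceq_chain[OF ceq_sym[OF c]] by (intro ext) blast
  have "homotopy_by A C h f g \<longleftrightarrow> homotopy_by A C' h f g" for h f g
    using ceq_homotopy_by[OF c] ceq_homotopy_by[OF ceq_sym[OF c]] by blast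
  then show "homotopic X A C = homotopic X A C'" by (intro ext) (simp add: homotopic_iff)
qed

text \<open>A roof stores neither its source nor its target, and the target enters only through
  conditions on sections. Hence the sets of roofs and of classes are literally equal, and no
  comparison map between \<open>A[n][m]\<close> and \<open>A[n+m]\<close> has to be
  inserted.\<close>

lemma ceq_target:
  assumes c: "ceq C C'"
  shows "DHom X A C = DHom X A C'" "Dcomp X A B C = Dcomp X A B C'" "Dzero X A C = Dzero X A C'"
proof -
  have r: "roofs X A C = roofs X A C'" for A by (simp add: roofs_def ceq_cong[OF c])
  have re: "roof_equiv X A C = roof_equiv X A C'" for A
    unfolding roof_equiv_def r ceq_cong[OF c] ..
  have z: "czero C = czero C'" using c by (simp add: czero_def ceq_def)
  show "DHom X A C = DHom X A C'" by (simp add: DHom_def r re)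
  show "Dcomp X A B C = Dcomp X A B C'"
    by (intro ext) (simp only: Dcomp_def re)
  show "Dzero X A C = Dzero X A C'" by (simp add: Dzero_def Dloc_def re z)
qed

lemma ceq_mor: "ceq C C' \<Longrightarrow> C' \<in> Ob \<Longrightarrow> mor A C f \<Longrightarrow> mor A C' f"
  by (simp add: mor_def ceq_cong)

lemma ceq_hq: "ceq C C' \<Longrightarrow> C' \<in> Ob \<Longrightarrow> hq A C f g \<Longrightarrow> hq A C' f g"
  by (simp add: hq_def ceq_mor) (simp add: ceq_cong)

text \<open>If both shifts are odd, the differential is negated twice, and the two signs cancel on
  sections.\<close>

lemma ceq_shift_shift: "A \<in> Ob \<Longrightarrow> ceq (shift n (shift m A)) (shift (n + m) A)"
proof -
  assume A: "A \<in> Ob"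
  have e: "i + n + m = i + (n + m)" for i by simp
  show ?thesis
    unfolding ceq_def
  proof (intro conjI allI impI)
    show "cob (shift n (shift m A)) = cob (shift (n + m) A)" by (simp add: fun_eq_iff e)
    fix i U s assume *: "opn U" "s \<in> carrier (sec (shift n (shift m A)) i U)"
    have e': "i + n + 1 + m = i + (n + m) + 1" by simp
    show "cdiff (shift n (shift m A)) i U s = cdiff (shift (n + m) A) i U s"
      using * A by (auto simp: cdiff_shift e e')
  qed
qed

section \<open>The long exact sequences of a mapping cone\<close>

text \<open>Write \<open>k = (k1, k2)\<close> with \<open>k1 = d h + h d\<close>. The map
  \<open>(h, 0)\<close> is a homotopy between \<open>k\<close> and a map whose first coordinate is
  zero; since the differential of \<open>(h, 0)\<close> has second coordinate \<open>e h\<close>,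
  what is left in the second one is \<open>k2 - e h\<close>.\<close>

lemma tw_lift:
  assumes e: "twisting A B e" and k: "mor Y (tw A B e) k" and null: "hq Y A ((\<lambda>i U s. sfst s) \<circ>\<^sub>c k) (czero A)"
  obtains g where "mor Y B g" "hq Y (tw A B e) ((\<lambda>i U b. spair \<zero>\<^bsub>sec A i U\<^esub> b) \<circ>\<^sub>c g) k"
proof -
  note A = twistingD(1)[OF e] and B = twistingD(2)[OF e] and de = twistingD(3)[OF e]
  define T where "T = tw A B e"
  have T: "T \<in> Ob" unfolding T_def by (rule tw_Ob[OF e])
  have Y: "Y \<in> Ob" and ck: "chain_map X Y T k" using k by (simp_all add: mor_def T_def)
  obtain h where nh: "homotopy_by Y A h ((\<lambda>i U s. sfst s) \<circ>\<^sub>c k) (czero A)"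
    using null by (auto simp: hq_def elim: homotopicE)
  note h = homotopy_byD(1)[OF nh] and eq = homotopy_byD(2)[OF nh]
  have cT [simp]: "cob T i = dsum (cob A i) (cob B i)" for i by (simp add: T_def)
  have dT [simp]: "cdiff T i U s = spair (cdiff A i U (sfst s)) (e i U (sfst s) \<oplus>\<^bsub>sec B (i + 1) U\<^esub> cdiff B i U (ssnd s))" for i U s
    by (simp add: T_def)
  note [simp] = A B Y T deg_simps[OF A B de] deg_simps[OF Y A h] twistingD(4)[OF e]
  have kc: "sfst (k i U y) \<in> carrier (sec A i U)" "ssnd (k i U y) \<in> carrier (sec B i U)"
      "spair (sfst (k i U y)) (ssnd (k i U y)) = k i U y"
    if "opn U" "y \<in> carrier (sec Y i U)" for i U y
    using cm_simps(1)[OF Y T ck that] by (simp_all add: dsum_carrier)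
  note [simp] = kc(1,2)
  have k1: "sfst (k i U y) = cdiff A (i - 1) U (h i U y) \<oplus>\<^bsub>sec A i U\<^esub> h (i + 1) U (cdiff Y i U y)"
    if "opn U" "y \<in> carrier (sec Y i U)" for i U y
    using eq[OF that] that by (simp add: ccomp_def czero_def)
  have kd: "k (i + 1) U (cdiff Y i U y) = cdiff T i U (k i U y)" if "opn U" "y \<in> carrier (sec Y i U)" for i U y
    using cm_simps(5)[OF Y T ck that] .
  have ed: "e i U (cdiff A (i - 1) U s) = \<ominus>\<^bsub>sec B (i + 1) U\<^esub> cdiff B i U (e (i - 1) U s)"
    if "opn U" "s \<in> carrier (sec A (i - 1) U)" for i U s
    using twistingD(4)[OF e that] by simp
  define g where "g i U y = ssnd (k i U y) \<oplus>\<^bsub>sec B i U\<^esub> (\<ominus>\<^bsub>sec B i U\<^esub> e (i - 1) U (h i U y))" for i U y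
  have g: "mor Y B g"
    unfolding mor_def
  proof (intro conjI chain_mapI)
    fix i
    have "sheaf_hom X (cob Y i) (cob B i) (\<lambda>U y. ssnd (k i U y))"
      using chain_shom[OF ck, of i] by (auto intro: shom_comp[OF _ shom_snd])
    moreover have "sheaf_hom X (cob Y i) (cob B i) (\<lambda>U y. e (i - 1) U (h i U y))"
      using shom_comp[OF deg_shom[OF h, of i] deg_shom[OF de, of "i + - 1"]] by simp
    ultimately show "sheaf_hom X (cob Y i) (cob B i) (g i)"
      unfolding g_def[abs_def] by (intro shom_add shom_neg) simp_all
  next
    fix i U y assume *: "opn U" "y \<in> carrier (sec Y i U)"
    have "e i U (sfst (k i U y)) = (\<ominus>\<^bsub>sec B (i + 1) U\<^esub> cdiff B i U (e (i - 1) U (h i U y))) \<oplus>\<^bsub>sec B (i + 1) U\<^esub> e i U (h (i + 1) U (cdiff Y i U y))"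
      unfolding k1[OF *] using * by (simp add: ed)
    then show "cdiff B i U (g i U y) = g (i + 1) U (cdiff Y i U y)"
      using * by (simp add: g_def kd sec_normalize[OF B])
  qed simp_all
  define inc where "inc = (\<lambda>i U b. spair \<zero>\<^bsub>sec A i U\<^esub> b)"
  have inc: "mor B T inc" using tw_incl_chain[OF e] by (simp add: mor_def T_def inc_def tw_Ob[OF e])
  have "homotopic X Y T k (inc \<circ>\<^sub>c g)"
  proof (rule homotopicI)
    show "deg (- 1) Y T (\<lambda>i U y. spair (h i U y) \<zero>\<^bsub>sec B (i - 1) U\<^esub>)"
      using h by (auto simp: deg_def intro!: shom_pair shom_zero)
    fix i U y assume *: "opn U" "y \<in> carrier (sec Y i U)"
    have "k i U y = spair (sfst (k i U y)) (ssnd (k i U y))" using kc[OF *] by simp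
    also have "\<dots> = (inc \<circ>\<^sub>c g) i U y \<oplus>\<^bsub>sec T i U\<^esub>
       (cdiff T (i - 1) U (spair (h i U y) \<zero>\<^bsub>sec B (i - 1) U\<^esub>) \<oplus>\<^bsub>sec T i U\<^esub> spair (h (i + 1) U (cdiff Y i U y)) \<zero>\<^bsub>sec B (i + 1 - 1) U\<^esub>)"
      using * by (simp add: ccomp_def inc_def g_def k1[OF *] sec_normalize[OF B])
    finally show "k i U y = (inc \<circ>\<^sub>c g) i U y \<oplus>\<^bsub>sec T i U\<^esub>
       (cdiff T (i - 1) U (spair (h i U y) \<zero>\<^bsub>sec B (i - 1) U\<^esub>) \<oplus>\<^bsub>sec T i U\<^esub> spair (h (i + 1) U (cdiff Y i U y)) \<zero>\<^bsub>sec B (i + 1 - 1) U\<^esub>)" .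
  qed
  then have "hq Y T k (inc \<circ>\<^sub>c g)" using k mor_comp[OF g inc] by (simp add: hq_def T_def)
  then show ?thesis using that[OF g] hq_sym by (simp add: inc_def T_def)
qed

text \<open>Shifting the cone by \<open>p\<close> multiplies its whole differential, and with it the
  twisting, by the sign of the shift. The result agrees on sections with a twisted sum of
  \<open>A[1][p]\<close> and \<open>B[p]\<close>, so \<open>tw_lift\<close> applies after passage
  along \<open>ceq\<close>.\<close>

lemma shift_cone_lift:
  assumes f: "mor A B f" and k: "mor Y (shift p (cone A B f)) k"
    and null: "hq Y (shift p (shift 1 A)) (shift_map p cone_proj \<circ>\<^sub>c k) (czero (shift p (shift 1 A)))"
  obtains g where "mor Y (shift p B) g" "hq Y (shift p (cone A B f)) (shift_map p (cone_incl A) \<circ>\<^sub>c g) k"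
proof -
  have A: "A \<in> Ob" and B: "B \<in> Ob" and cf: "chain_map X A B f" using f by (simp_all add: mor_def)
  note [simp] = A B cm_simps[OF A B cf]
  define e where "e = (\<lambda>i U s. if even p then f (i + p + 1) U s else \<ominus>\<^bsub>sec B (i + p + 1) U\<^esub> f (i + p + 1) U s)"
  have x: "i + 1 + p = i + p + 1" "i + 2 + p = i + p + 2" for i by simp_all
  note t = twistingD(4)[OF cone_twisting[OF f]]
  have te: "twisting (shift p (shift 1 A)) (shift p B) e"
  proof (rule twistingI)
    have "sheaf_hom X (cob A (i + p + 1)) (cob B (i + p + 1)) (e i)" for i
      using chain_shom[OF cf, of "i + p + 1"] shom_neg[OF Ob_psh[OF A] Ob_psh[OF B] chain_shom[OF cf, of "i + p + 1"]]
      by (cases "even p") (simp_all add: e_def)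
    then show "deg 1 (shift p (shift 1 A)) (shift p B) e" by (simp add: deg_def x)
    fix i U s assume U: "opn U" and "s \<in> carrier (sec (shift p (shift 1 A)) i U)"
    then have s: "s \<in> carrier (sec (shift 1 A) (i + p) U)" by simp
    have 1: "f (i + p + 1 + 1) U (cdiff (shift 1 A) (i + p) U s) =
       \<ominus>\<^bsub>sec B (i + p + 2) U\<^esub> cdiff B (i + p + 1) U (f (i + p + 1) U s)" by (rule t[OF U s])
    have 2: "cdiff (shift 1 A) (i + p) U s \<in> carrier (sec A (i + p + 1 + 1) U)"
      using d_closed[OF shift_Ob[OF A] U s] by (simp only: cob_shift)
    have 3: "f (i + p + 1) U s \<in> carrier (sec B (i + p + 1) U)" using U s by simp
    have 4: "cdiff B (i + p + 1) U (f (i + p + 1) U s) \<in> carrier (sec B (i + p + 2) U)"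
      using d_closed[OF B U 3] by simp
    have 5: "f (i + p + 1 + 1) U (\<ominus>\<^bsub>sec A (i + p + 1 + 1) U\<^esub> cdiff (shift 1 A) (i + p) U s) =
       \<ominus>\<^bsub>sec B (i + p + 1 + 1) U\<^esub> f (i + p + 1 + 1) U (cdiff (shift 1 A) (i + p) U s)"
      by (rule cm_simps(3)[OF A B cf U 2])
    show "e (i + 1) U (cdiff (shift p (shift 1 A)) i U s) =
       \<ominus>\<^bsub>sec (shift p B) (i + 2) U\<^esub> cdiff (shift p B) (i + 1) U (e i U s)"
    proof (cases "even p")
      case True
      then show ?thesis using 1 by (simp add: e_def cdiff_shift[of p] x)
    next
      case False
      have "e (i + 1) U (cdiff (shift p (shift 1 A)) i U s) =
        \<ominus>\<^bsub>sec B (i + p + 2) U\<^esub> f (i + p + 1 + 1) U (\<ominus>\<^bsub>sec A (i + p + 1 + 1) U\<^esub> cdiff (shift 1 A) (i + p) U s)"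
        using False by (simp add: e_def cdiff_shift[of p] x)
      also have "\<dots> = \<ominus>\<^bsub>sec B (i + p + 2) U\<^esub> (\<ominus>\<^bsub>sec B (i + p + 2) U\<^esub> (\<ominus>\<^bsub>sec B (i + p + 2) U\<^esub> cdiff B (i + p + 1) U (f (i + p + 1) U s)))"
        unfolding 5 1 by simp
      also have "\<dots> = \<ominus>\<^bsub>sec (shift p B) (i + 2) U\<^esub> cdiff (shift p B) (i + 1) U (e i U s)"
        using False U 3 4 by (simp add: e_def cdiff_shift[of p] x)
      finally show ?thesis .
    qed
  qed simp_all
  define T where "T = tw (shift p (shift 1 A)) (shift p B) e"
  have T: "T \<in> Ob" unfolding T_def by (rule tw_Ob[OF te])
  have c: "ceq (shift p (cone A B f)) T"
    unfolding ceq_def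
  proof (intro conjI allI impI)
    show "cob (shift p (cone A B f)) = cob T"
      by (simp add: fun_eq_iff T_def cone_eq_tw)
    fix i U s assume U: "opn U" and "s \<in> carrier (sec (shift p (cone A B f)) i U)"
    then obtain a b where ab: "s = spair a b" "a \<in> carrier (sec A (i + p + 1) U)" "b \<in> carrier (sec B (i + p) U)"
      by (auto simp: cone_eq_tw elim!: dsumE)
    have 1: "cdiff A (i + p + 1) U a \<in> carrier (sec A (i + p + 2) U)"
      using d_closed[OF A U ab(2)] by simp
    show "cdiff (shift p (cone A B f)) i U s = cdiff T i U s"
      using ab U 1 by (simp add: cdiff_shift[of p] T_def e_def cone_eq_tw x sec_normalize[OF B])
  qed
  have O: "shift p (cone A B f) \<in> Ob" using cone_Ob[OF f] by simp
  have "mor Y T k" by (rule ceq_mor[OF c T k])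
  moreover have "hq Y (shift p (shift 1 A)) ((\<lambda>i U s. sfst s) \<circ>\<^sub>c k) (czero (shift p (shift 1 A)))"
    using null by (simp add: shift_map_def cone_proj_def)
  ultimately obtain g where g: "mor Y (shift p B) g"
     "hq Y T ((\<lambda>i U b. spair \<zero>\<^bsub>sec (shift p (shift 1 A)) i U\<^esub> b) \<circ>\<^sub>c g) k"
    using tw_lift[OF te] unfolding T_def by blast
  have "hq Y T (shift_map p (cone_incl A) \<circ>\<^sub>c g) k"
    using g(2) by (simp add: shift_map_def cone_incl_def)
  then show ?thesis using that[OF g(1)] ceq_hq[OF ceq_sym[OF c] O] by blast
qed

text \<open>Exactness of the covariant sequence at the cone. Projection after inclusion is zero on
  sections, which settles one direction; in the other, vanishing of the projected roof supplies the
  refinement on which \<open>shift_cone_lift\<close> works.\<close>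

lemma push_exact:
  assumes f: "mor A B f" and F: "F \<in> Ob" and \<tau>: "\<tau> \<in> DHom X F (shift p (cone A B f))"
  shows "Dcomp X F (shift p (cone A B f)) (shift p (shift 1 A))
      (Dshift X p (cone A B f) (shift 1 A) (Dloc X (cone A B f) (shift 1 A) cone_proj)) \<tau> = Dzero X F (shift p (shift 1 A)) \<longleftrightarrow>
    (\<exists>\<sigma>\<in>DHom X F (shift p B). Dcomp X F (shift p B) (shift p (cone A B f))
      (Dshift X p B (cone A B f) (Dloc X B (cone A B f) (cone_incl A))) \<sigma> = \<tau>)"
proof -
  define T where "T = shift p (cone A B f)"
  define A1 where "A1 = shift p (shift 1 A)"
  define B1 where "B1 = shift p B"
  define pr where "pr = shift_map p (cone_proj :: ('x, 's) cmap)"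
  define inc where "inc = shift_map p (cone_incl A)"
  have A: "A \<in> Ob" and B: "B \<in> Ob" using f by (simp_all add: mor_def)
  have O: "T \<in> Ob" "A1 \<in> Ob" "B1 \<in> Ob" using A B cone_Ob[OF f] by (simp_all add: T_def A1_def B1_def)
  have pr: "mor T A1 pr" unfolding T_def A1_def pr_def by (rule shift_mor[OF cone_proj_mor[OF f]])
  have inc: "mor B1 T inc" unfolding T_def B1_def inc_def by (rule shift_mor[OF cone_incl_mor[OF f]])
  have null: "hq B1 A1 (pr \<circ>\<^sub>c inc) (czero A1)"
    by (rule hq_eqI[OF mor_zero[OF O(3,2)]])
      (simp add: pr_def inc_def ccomp_def cone_proj_def cone_incl_def czero_def A1_def shift_map_def)
  have e: "Dshift X p (cone A B f) (shift 1 A) (Dloc X (cone A B f) (shift 1 A) cone_proj) = Dloc X T A1 pr"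
    "Dshift X p B (cone A B f) (Dloc X B (cone A B f) (cone_incl A)) = Dloc X B1 T inc"
    using Dshift_Dloc[OF cone_proj_mor[OF f]] Dshift_Dloc[OF cone_incl_mor[OF f]]
    by (simp_all add: T_def A1_def B1_def pr_def inc_def)
  have "Dcomp X F T A1 (Dloc X T A1 pr) \<tau> = Dzero X F A1 \<longleftrightarrow> (\<exists>\<sigma>\<in>DHom X F B1. Dcomp X F B1 T (Dloc X B1 T inc) \<sigma> = \<tau>)"
  proof
    assume z: "Dcomp X F T A1 (Dloc X T A1 pr) \<tau> = Dzero X F A1"
    obtain Z s g where R: "qi Z F s" "mor Z T g" "\<tau> = cl F T (Z, s, g)"
      using \<tau> F O DHomE unfolding T_def by blast
    have "cl F A1 (Z, s, pr \<circ>\<^sub>c g) = Dzero X F A1" using z Dcomp_Dloc_left[OF R(1,2) pr] by (simp add: R(3))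
    then obtain Y a where Y: "qi Y Z a" "hq Y A1 ((pr \<circ>\<^sub>c g) \<circ>\<^sub>c a) (czero A1)"
      unfolding cl_eq_Dzero_iff[OF R(1) mor_comp[OF R(2) pr]] by blast
    have ga: "mor Y T (g \<circ>\<^sub>c a)" by (rule mor_comp[OF qi_mor[OF Y(1)] R(2)])
    obtain k where k: "mor Y B1 k" "hq Y T (inc \<circ>\<^sub>c k) (g \<circ>\<^sub>c a)"
      using shift_cone_lift[OF f, of Y p "g \<circ>\<^sub>c a"] ga Y(2)
      unfolding T_def A1_def B1_def pr_def inc_def ccomp_assoc by blast
    have sa: "qi Y F (s \<circ>\<^sub>c a)" by (rule qi_comp[OF Y(1) R(1)])
    have "\<tau> = cl F T (Y, s \<circ>\<^sub>c a, g \<circ>\<^sub>c a)" unfolding R(3) by (rule cl_refine[OF R(1,2) Y(1)])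
    also have "\<dots> = cl F T (Y, s \<circ>\<^sub>c a, inc \<circ>\<^sub>c k)"
      by (rule cl_hqI[OF sa hq_sym[OF k(2)] hq_refl[OF qi_mor[OF sa]]])
    also have "\<dots> = Dcomp X F B1 T (Dloc X B1 T inc) (cl F B1 (Y, s \<circ>\<^sub>c a, k))"
      by (rule Dcomp_Dloc_left[OF sa k(1) inc, symmetric])
    finally show "\<exists>\<sigma>\<in>DHom X F B1. Dcomp X F B1 T (Dloc X B1 T inc) \<sigma> = \<tau>"
      using cl_DHom[OF sa k(1)] by metis
  next
    assume "\<exists>\<sigma>\<in>DHom X F B1. Dcomp X F B1 T (Dloc X B1 T inc) \<sigma> = \<tau>"
    then obtain \<sigma> where s: "\<sigma> \<in> DHom X F B1" "Dcomp X F B1 T (Dloc X B1 T inc) \<sigma> = \<tau>" by blast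
    have "Dcomp X F T A1 (Dloc X T A1 pr) \<tau> = Dcomp X F B1 A1 (Dloc X B1 A1 (pr \<circ>\<^sub>c inc)) \<sigma>"
      unfolding s(2)[symmetric] Dcomp_Dloc_Dloc[OF inc pr, symmetric]
      by (rule Dcomp_assoc[symmetric]) (use F O s pr inc Dloc_DHom in auto)
    also have "\<dots> = Dzero X F A1"
      unfolding Dloc_hq[OF null] Dzero_def[symmetric] by (rule Dcomp_Dzero_left[OF F O(3,2) s(1)])
    finally show "Dcomp X F T A1 (Dloc X T A1 pr) \<tau> = Dzero X F A1" .
  qed
  then show ?thesis unfolding e unfolding T_def A1_def B1_def .
qed

text \<open>Plays the role of the five lemma for cones. Exactness for \<open>s\<close> is used in
  degree \<open>i + 1\<close> on the pair \<open>(x, - u)\<close> of first coordinates; the sign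
  comes from the differential of \<open>A[1]\<close>.\<close>

lemma cone_map_qi:
  assumes f: "mor A B f" and s: "qi Z A s"
  shows "qi (cone Z B (f \<circ>\<^sub>c s)) (cone A B f) (\<lambda>i U x. spair (s (i + 1) U (sfst x)) (ssnd x))"
proof -
  have A: "A \<in> Ob" and B: "B \<in> Ob" and cf: "chain_map X A B f" using f by (simp_all add: mor_def)
  have Z: "Z \<in> Ob" and qs: "quasi_iso X Z A s" using s by (simp_all add: qi_def)
  have cs: "chain_map X Z A s" and ce: "cone_exact Z A s" using qs by (simp_all add: quasi_iso_iff A Z)
  have fs: "mor Z B (f \<circ>\<^sub>c s)" by (rule mor_comp[OF qi_mor[OF s] f])
  note [simp] = A B Z cm_simps[OF A B cf] cm_simps[OF Z A cs]
  define E where "E = cone Z B (f \<circ>\<^sub>c s)"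
  define T where "T = cone A B f"
  define M where "M = (\<lambda>i U x. spair (s (i + 1) U (sfst x)) (ssnd x))"
  have E: "E \<in> Ob" and T: "T \<in> Ob" using cone_Ob f fs by (simp_all add: E_def T_def)
  have [simp]: "cob E i = dsum (cob Z (i + 1)) (cob B i)" "cob T i = dsum (cob A (i + 1)) (cob B i)" for i
    by (simp_all add: E_def T_def cone_def)
  have [simp]: "cdiff E i U x = spair (\<ominus>\<^bsub>sec Z (i + 2) U\<^esub> cdiff Z (i + 1) U (sfst x))
      (f (i + 1) U (s (i + 1) U (sfst x)) \<oplus>\<^bsub>sec B (i + 1) U\<^esub> cdiff B i U (ssnd x))"
    "cdiff T i U x = spair (\<ominus>\<^bsub>sec A (i + 2) U\<^esub> cdiff A (i + 1) U (sfst x))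
      (f (i + 1) U (sfst x) \<oplus>\<^bsub>sec B (i + 1) U\<^esub> cdiff B i U (ssnd x))" for i U x
    by (simp_all add: E_def T_def cone_def ccomp_def)
  have d2: "cdiff Z (i + 1) U x \<in> carrier (sec Z (i + 2) U)" "s (i + 2) U (cdiff Z (i + 1) U x) = cdiff A (i + 1) U (s (i + 1) U x)"
    if "opn U" "x \<in> carrier (sec Z (i + 1) U)" for i U x
    using d_closed[OF Z that] cm_simps(5)[OF Z A cs that] by simp_all
  have d2A: "cdiff A (i + 1) U x \<in> carrier (sec A (i + 2) U)"
    if "opn U" "x \<in> carrier (sec A (i + 1) U)" for i U x
    using d_closed[OF A that] by simp
  have M: "chain_map X E T M"
  proof (rule chain_mapI)
    fix i
    show "sheaf_hom X (cob E i) (cob T i) (M i)"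
      using shom_comp[OF shom_fst chain_shom[OF cs, of "i + 1"]] by (simp add: M_def shom_pair shom_snd)
    fix U x assume "opn U" "x \<in> carrier (sec E i U)"
    then show "cdiff T i U (M i U x) = M (i + 1) U (cdiff E i U x)"
      by (auto elim!: dsumE simp: M_def d2)
  qed
  have "cone_exact E T M"
  proof (rule cone_exactI)
    fix i U y a b
    assume U: "opn U" "y \<in> U" and a: "a \<in> carrier (sec E (i + 1) U)" and b: "b \<in> carrier (sec T i U)"
      and da: "cdiff E (i + 1) U a = \<zero>\<^bsub>sec E (i + 2) U\<^esub>" and Ma: "M (i + 1) U a = cdiff T i U b"
    obtain x c where x: "a = spair x c" "x \<in> carrier (sec Z (i + 2) U)" "c \<in> carrier (sec B (i + 1) U)"
      using a by (auto elim!: dsumE)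
    obtain u v where u: "b = spair u v" "u \<in> carrier (sec A (i + 1) U)" "v \<in> carrier (sec B i U)"
      using b by (auto elim!: dsumE)
    have sx: "s (i + 2) U x = \<ominus>\<^bsub>sec A (i + 2) U\<^esub> cdiff A (i + 1) U u" "c = f (i + 1) U u \<oplus>\<^bsub>sec B (i + 1) U\<^esub> cdiff B i U v"
      using Ma by (simp_all add: M_def x(1) u(1))
    have i3: "i + 1 + 2 = i + 2 + 1" "i + 2 + 1 = i + 3" by simp_all
    have x1: "x \<in> carrier (sec Z (i + 1 + 1) U)" "\<ominus>\<^bsub>sec A (i + 1) U\<^esub> u \<in> carrier (sec A (i + 1) U)" using x u U by simp_all
    have dx: "cdiff Z (i + 1 + 1) U x = \<zero>\<^bsub>sec Z (i + 1 + 2) U\<^esub>"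
    proof -
      have "\<ominus>\<^bsub>sec Z (i + 1 + 2) U\<^esub> cdiff Z (i + 1 + 1) U x = \<zero>\<^bsub>sec Z (i + 1 + 2) U\<^esub>"
        using da by (simp add: x(1) i3)
      moreover have "cdiff Z (i + 1 + 1) U x \<in> carrier (sec Z (i + 1 + 2) U)" using d_closed[OF Z U(1) x1(1)] by (simp add: i3)
      ultimately show ?thesis using sec_simps(3,4)[OF Z U(1)] by metis
    qed
    have sx': "s (i + 1 + 1) U x = cdiff A (i + 1) U (\<ominus>\<^bsub>sec A (i + 1) U\<^esub> u)" using sx u U by simp
    obtain W z u' where W: "opn W" "y \<in> W" "W \<subseteq> U" and z: "z \<in> carrier (sec Z (i + 1) W)" and u': "u' \<in> carrier (sec A (i + 1 - 1) W)"
      and e1: "rmap (cob Z (i + 1 + 1)) U W x = cdiff Z (i + 1) W z"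
      and e2: "rmap (cob A (i + 1)) U W (\<ominus>\<^bsub>sec A (i + 1) U\<^esub> u) = s (i + 1) W z \<oplus>\<^bsub>sec A (i + 1) W\<^esub> cdiff A (i + 1 - 1) W u'"
      by (rule cone_exactE[OF ce U x1 dx sx'])
    have u'c: "u' \<in> carrier (sec A i W)" using u' by simp
    have ru: "rmap (cob A (i + 1)) U W u = (\<ominus>\<^bsub>sec A (i + 1) W\<^esub> s (i + 1) W z) \<oplus>\<^bsub>sec A (i + 1) W\<^esub> (\<ominus>\<^bsub>sec A (i + 1) W\<^esub> cdiff A i W u')"
    proof -
      have "rmap (cob A (i + 1)) U W u = \<ominus>\<^bsub>sec A (i + 1) W\<^esub> rmap (cob A (i + 1)) U W (\<ominus>\<^bsub>sec A (i + 1) U\<^esub> u)"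
        using U W u by simp
      also have "\<dots> = (\<ominus>\<^bsub>sec A (i + 1) W\<^esub> s (i + 1) W z) \<oplus>\<^bsub>sec A (i + 1) W\<^esub> (\<ominus>\<^bsub>sec A (i + 1) W\<^esub> cdiff A i W u')"
        unfolding e2 using W z u'c by (simp add: sec_normalize[OF A])
      finally show ?thesis .
    qed
    \<comment> \<open>Near the point \<open>x = d z\<close> and \<open>- u = s z + d u'\<close>.
      This dictates the first coordinates, and the summand \<open>- f u'\<close> compensates the
      twisting term \<open>f u'\<close> in the differential of \<open>?b\<close>.\<close>
    let ?a = "spair (\<ominus>\<^bsub>sec Z (i + 1) W\<^esub> z) (rmap (cob B i) U W v \<oplus>\<^bsub>sec B i W\<^esub> (\<ominus>\<^bsub>sec B i W\<^esub> f i W u'))"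
    let ?b = "spair u' \<zero>\<^bsub>sec B (i - 1) W\<^esub>"
    have rc: "rmap (cob B (i + 1)) U W c = f (i + 1) W (rmap (cob A (i + 1)) U W u) \<oplus>\<^bsub>sec B (i + 1) W\<^esub> cdiff B i W (rmap (cob B i) U W v)"
      unfolding sx(2) using U W u by simp
    have 1: "rmap (cob E (i + 1)) U W a = cdiff E i W ?a"
      using U W z u u'c x d2[OF W(1) z] e1 unfolding x(1) by (simp add: rc ru sec_normalize[OF B])
    have 2: "rmap (cob T i) U W b = M i W ?a \<oplus>\<^bsub>sec T i W\<^esub> cdiff T (i - 1) W ?b"
      using U W z u u'c by (simp add: ru M_def u(1) sec_normalize[OF B])
    show "\<exists>W a' b'. opn W \<and> y \<in> W \<and> W \<subseteq> U \<and> a' \<in> carrier (sec E i W) \<and> b' \<in> carrier (sec T (i - 1) W) \<and>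
        rmap (cob E (i + 1)) U W a = cdiff E i W a' \<and>
        rmap (cob T i) U W b = M i W a' \<oplus>\<^bsub>sec T i W\<^esub> cdiff T (i - 1) W b'"
      using U W z u u'c 1 2 by (intro exI[of _ W] exI[of _ ?a] exI[of _ ?b] conjI) simp_all
  qed
  with M E T show ?thesis by (simp add: qi_def quasi_iso_iff E_def T_def M_def)
qed

text \<open>Exactness of the contravariant sequence at \<open>A\<close>; here \<open>B\<close> is
  the target of \<open>f\<close> and \<open>H\<close> an arbitrary coefficient object. If \<rho>
  extends along \<open>f\<close>, then its shift after the projection factors through
  \<open>f[1]\<close> after the projection, which is null-homotopic. The converse builds the new
  denominator \<open>\<phi>\<close> from \<open>W\<close> to \<open>B\<close>.\<close>

lemma pull_exact:
  assumes f: "mor A B f" and H: "H \<in> Ob" and \<rho>: "\<rho> \<in> DHom X A H"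
  shows "Dcomp X (cone A B f) (shift 1 A) (shift 1 H) (Dshift X 1 A H \<rho>)
      (Dloc X (cone A B f) (shift 1 A) cone_proj) = Dzero X (cone A B f) (shift 1 H) \<longleftrightarrow>
    (\<exists>\<sigma>\<in>DHom X B H. Dcomp X A B H \<sigma> (Dloc X A B f) = \<rho>)"
proof
  have A: "A \<in> Ob" and B: "B \<in> Ob" and cf: "chain_map X A B f" using f by (simp_all add: mor_def)
  note [simp] = A B H cm_simps[OF A B cf]
  define T where "T = cone A B f"
  have T: "T \<in> Ob" using cone_Ob[OF f] by (simp add: T_def)
  have [simp]: "cob T i = dsum (cob A (i + 1)) (cob B i)" for i by (simp add: T_def cone_def)
  have [simp]: "cdiff T i U x = spair (\<ominus>\<^bsub>sec A (i + 2) U\<^esub> cdiff A (i + 1) U (sfst x))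
      (f (i + 1) U (sfst x) \<oplus>\<^bsub>sec B (i + 1) U\<^esub> cdiff B i U (ssnd x))" for i U x
    by (simp add: T_def cone_def)
  have pr: "mor T (shift 1 A) cone_proj" unfolding T_def by (rule cone_proj_mor[OF f])
  {
    assume "\<exists>\<sigma>\<in>DHom X B H. Dcomp X A B H \<sigma> (Dloc X A B f) = \<rho>"
    then obtain \<sigma> where s: "\<sigma> \<in> DHom X B H" "Dcomp X A B H \<sigma> (Dloc X A B f) = \<rho>" by blast
    have fpm: "mor T (shift 1 B) (shift_map 1 f \<circ>\<^sub>c cone_proj)" by (rule mor_comp[OF pr shift_mor[OF f]])
    have "homotopic X T (shift 1 B) (shift_map 1 f \<circ>\<^sub>c cone_proj) (czero (shift 1 B))"
    \<comment> \<open>The second coordinate of the cone is the homotopy: the sign of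
      \<open>B[1]\<close> cancels the two occurrences of \<open>d b\<close> and leaves
      \<open>f a\<close>.\<close>
    proof (rule homotopicI[where h = "\<lambda>i U x. ssnd x"])
      show "deg (- 1) T (shift 1 B) (\<lambda>i U x. ssnd x)" by (simp add: deg_def shom_snd)
      fix i U x assume "opn U" "x \<in> carrier (sec T i U)"
      then show "(shift_map 1 f \<circ>\<^sub>c cone_proj) i U x = czero (shift 1 B) i U x \<oplus>\<^bsub>sec (shift 1 B) i U\<^esub>
          (cdiff (shift 1 B) (i - 1) U (ssnd x) \<oplus>\<^bsub>sec (shift 1 B) i U\<^esub> ssnd (cdiff T i U x))"
        by (auto elim!: dsumE simp: ccomp_def cone_proj_def czero_def sec_normalize[OF B])
    qed
    then have null: "hq T (shift 1 B) (shift_map 1 f \<circ>\<^sub>c cone_proj) (czero (shift 1 B))"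
      using fpm mor_zero[OF T shift_Ob[OF B]] by (simp add: hq_def)
    have "Dcomp X T (shift 1 A) (shift 1 H) (Dshift X 1 A H \<rho>) (Dloc X T (shift 1 A) cone_proj) =
      Dcomp X T (shift 1 A) (shift 1 H) (Dcomp X (shift 1 A) (shift 1 B) (shift 1 H) (Dshift X 1 B H \<sigma>)
        (Dloc X (shift 1 A) (shift 1 B) (shift_map 1 f))) (Dloc X T (shift 1 A) cone_proj)"
      unfolding s(2)[symmetric] Dshift_Dcomp[OF A B H Dloc_DHom[OF f] s(1)] Dshift_Dloc[OF f] ..
    also have "\<dots> = Dcomp X T (shift 1 B) (shift 1 H) (Dshift X 1 B H \<sigma>)
       (Dcomp X T (shift 1 A) (shift 1 B) (Dloc X (shift 1 A) (shift 1 B) (shift_map 1 f)) (Dloc X T (shift 1 A) cone_proj))"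
      by (rule Dcomp_assoc) (use T pr f s in \<open>auto intro: Dloc_DHom shift_mor Dshift_DHom\<close>)
    also have "\<dots> = Dcomp X T (shift 1 B) (shift 1 H) (Dshift X 1 B H \<sigma>) (Dzero X T (shift 1 B))"
      unfolding Dcomp_Dloc_Dloc[OF pr shift_mor[OF f]] Dloc_hq[OF null] Dzero_def ..
    also have "\<dots> = Dzero X T (shift 1 H)"
      by (rule Dcomp_Dzero_right) (use T s in \<open>auto intro: Dshift_DHom\<close>)
    finally show "Dcomp X (cone A B f) (shift 1 A) (shift 1 H) (Dshift X 1 A H \<rho>)
      (Dloc X (cone A B f) (shift 1 A) cone_proj) = Dzero X (cone A B f) (shift 1 H)" unfolding T_def .
  next
    assume z: "Dcomp X (cone A B f) (shift 1 A) (shift 1 H) (Dshift X 1 A H \<rho>)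
      (Dloc X (cone A B f) (shift 1 A) cone_proj) = Dzero X (cone A B f) (shift 1 H)"
    obtain Z s g where R: "qi Z A s" "mor Z H g" "\<rho> = cl A H (Z, s, g)" using DHomE[OF \<rho> A H] by blast
    have Z: "Z \<in> Ob" and cs: "chain_map X Z A s" and cg: "chain_map X Z H g"
      using R by (simp_all add: qi_def mor_def qis_chain)
    note [simp] = Z cm_simps[OF Z A cs] cm_simps[OF Z H cg]
    have fs: "mor Z B (f \<circ>\<^sub>c s)" by (rule mor_comp[OF qi_mor[OF R(1)] f])
    define E where "E = cone Z B (f \<circ>\<^sub>c s)"
    define M where "M = (\<lambda>i U x. spair (s (i + 1) U (sfst x)) (ssnd x))"
    have E: "E \<in> Ob" using cone_Ob[OF fs] by (simp add: E_def)
    have [simp]: "cob E i = dsum (cob Z (i + 1)) (cob B i)" for i by (simp add: E_def cone_def)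
    have dE [simp]: "cdiff E i U x = spair (\<ominus>\<^bsub>sec Z (i + 2) U\<^esub> cdiff Z (i + 1) U (sfst x))
      (f (i + 1) U (s (i + 1) U (sfst x)) \<oplus>\<^bsub>sec B (i + 1) U\<^esub> cdiff B i U (ssnd x))" for i U x
      by (simp add: E_def cone_def ccomp_def)
    have prE: "mor E (shift 1 Z) cone_proj" unfolding E_def by (rule cone_proj_mor[OF fs])
    have M: "qi E T M" unfolding E_def T_def M_def by (rule cone_map_qi[OF f R(1)])
    \<comment> \<open>\<open>M\<close> and the projections commute on sections; this is the square
      that presents \<open>\<rho>[1]\<close> after the projection as a roof with denominator
      \<open>M\<close>.\<close>
    have sq: "hq E (shift 1 A) (cone_proj \<circ>\<^sub>c M) (shift_map 1 s \<circ>\<^sub>c cone_proj)"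
      by (rule hq_eqI[OF mor_comp[OF prE shift_mor[OF qi_mor[OF R(1)]]]])
        (simp add: ccomp_def cone_proj_def M_def)
    have gp: "mor E (shift 1 H) (shift_map 1 g \<circ>\<^sub>c cone_proj)" by (rule mor_comp[OF prE shift_mor[OF R(2)]])
    have "cl T (shift 1 H) (E, M, shift_map 1 g \<circ>\<^sub>c cone_proj) = Dzero X T (shift 1 H)"
      using z Dcomp_Dloc_right[OF pr shift_qi[OF R(1)] shift_mor[OF R(2)] M prE sq]
      unfolding R(3) Dshift_cl[OF R(1,2)] T_def by simp
    then obtain Y a where Y: "qi Y E a" and null: "hq Y (shift 1 H) ((shift_map 1 g \<circ>\<^sub>c cone_proj) \<circ>\<^sub>c a) (czero (shift 1 H))"
      unfolding cl_eq_Dzero_iff[OF M gp] by blast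
    have YO: "Y \<in> Ob" and ca: "chain_map X Y E a" and qa: "quasi_iso X Y E a" using Y by (simp_all add: qi_def qis_chain)
    have ae: "cone_exact Y E a" using qa by (simp add: quasi_iso_iff YO E)
    obtain h where nh: "homotopy_by Y (shift 1 H) h ((shift_map 1 g \<circ>\<^sub>c cone_proj) \<circ>\<^sub>c a) (czero (shift 1 H))"
      using null by (auto simp: hq_def elim: homotopicE)
    \<comment> \<open>A homotopy with target \<open>H[1]\<close> has degree 0 when read as a map
      into \<open>H\<close>.\<close>
    have dh: "deg 0 Y H h" using homotopy_byD(1)[OF nh] by (simp add: deg_def)
    note [simp] = YO deg_simps[OF YO H dh]
    have ac: "sfst (a i U y) \<in> carrier (sec Z (i + 1) U)" "ssnd (a i U y) \<in> carrier (sec B i U)"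
      "spair (sfst (a i U y)) (ssnd (a i U y)) = a i U y"
      if "opn U" "y \<in> carrier (sec Y i U)" for i U y
      using cm_simps(1)[OF YO E ca that] by (simp_all add: dsum_carrier)
    note [simp] = ac(1,2)
    have ad: "a (i + 1) U (cdiff Y i U y) = spair (\<ominus>\<^bsub>sec Z (i + 2) U\<^esub> cdiff Z (i + 1) U (sfst (a i U y)))
      (f (i + 1) U (s (i + 1) U (sfst (a i U y))) \<oplus>\<^bsub>sec B (i + 1) U\<^esub> cdiff B i U (ssnd (a i U y)))"
      if "opn U" "y \<in> carrier (sec Y i U)" for i U y
      using cm_simps(5)[OF YO E ca that] by simp
    \<comment> \<open>The minus sign is that of the differential of \<open>H[1]\<close>; it is what
      makes \<open>k\<close> below a chain map.\<close>
    have gh: "g (i + 1) U (sfst (a i U y)) = (\<ominus>\<^bsub>sec H (i + 1) U\<^esub> cdiff H i U (h i U y)) \<oplus>\<^bsub>sec H (i + 1) U\<^esub> h (i + 1) U (cdiff Y i U y)"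
      if "opn U" "y \<in> carrier (sec Y i U)" for i U y
      using homotopy_byD(2)[OF nh that] that by (simp add: ccomp_def cone_proj_def czero_def)
    have d2: "cdiff Z (i + 1) U x \<in> carrier (sec Z (i + 2) U)"
      if "opn U" "x \<in> carrier (sec Z (i + 1) U)" for i U x
      using d_closed[OF Z that] by simp
    define e where "e = (\<lambda>i U y. sfst (a i U y))"
    have te: "twisting Y Z e"
    proof (rule twistingI)
      show "deg 1 Y Z e"
        using chain_shom[OF ca] by (auto simp: deg_def e_def intro: shom_comp[OF _ shom_fst])
    qed (simp_all add: e_def ad)
    define W where "W = tw Y Z e"
    have W: "W \<in> Ob" unfolding W_def by (rule tw_Ob[OF te])
    have [simp]: "cob W i = dsum (cob Y i) (cob Z i)" for i by (simp add: W_def)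
    have [simp]: "cdiff W i U x = spair (cdiff Y i U (sfst x)) (sfst (a i U (sfst x)) \<oplus>\<^bsub>sec Z (i + 1) U\<^esub> cdiff Z i U (ssnd x))" for i U x
      by (simp add: W_def e_def)
    define \<phi> where "\<phi> = (\<lambda>i U x. ssnd (a i U (sfst x)) \<oplus>\<^bsub>sec B i U\<^esub> (\<ominus>\<^bsub>sec B i U\<^esub> f i U (s i U (ssnd x))))"
    define k where "k = (\<lambda>i U x. h i U (sfst x) \<oplus>\<^bsub>sec H i U\<^esub> (\<ominus>\<^bsub>sec H i U\<^esub> g i U (ssnd x)))"
    \<comment> \<open>The sign is chosen so that \<open>\<phi>\<close> after \<open>b\<close> is
      \<open>f\<close> after \<open>s\<close>, while \<open>k\<close> after \<open>b\<close> is
      \<open>g\<close>. These two identities identify the composite roof with \<rho>.\<close>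
    define b where "b = (\<lambda>i U z. spair \<zero>\<^bsub>sec Y i U\<^esub> (\<ominus>\<^bsub>sec Z i U\<^esub> z))"
    have \<phi>: "chain_map X W B \<phi>"
    proof (rule chain_mapI)
      fix i
      have "sheaf_hom X (cob Y i) (cob B i) (\<lambda>U y. ssnd (a i U y))"
        using chain_shom[OF ca, of i] by (auto intro: shom_comp[OF _ shom_snd])
      then show "sheaf_hom X (cob W i) (cob B i) (\<phi> i)"
        unfolding \<phi>_def using shom_comp[OF chain_shom[OF cs] chain_shom[OF cf], of i]
        by (auto intro!: shom_add shom_neg shom_comp[OF shom_fst, of _ _ "\<lambda>U y. ssnd (a i U y)"]
          shom_comp[OF shom_snd, of _ _ "\<lambda>U y. f i U (s i U y)"] dsum_psh)
      fix U x assume "opn U" "x \<in> carrier (sec W i U)"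
      then show "cdiff B i U (\<phi> i U x) = \<phi> (i + 1) U (cdiff W i U x)"
        by (auto elim!: dsumE simp: \<phi>_def ad sec_normalize[OF B])
    qed
    have k: "mor W H k"
      unfolding mor_def
    proof (intro conjI chain_mapI W H)
      fix i
      show "sheaf_hom X (cob W i) (cob H i) (k i)"
        unfolding k_def using deg_shom[OF dh, of i] chain_shom[OF cg, of i]
        by (auto intro!: shom_add shom_neg shom_comp[OF shom_fst, of _ _ "h i"]
          shom_comp[OF shom_snd, of _ _ "g i"] dsum_psh)
      fix U x assume "opn U" "x \<in> carrier (sec W i U)"
      then show "cdiff H i U (k i U x) = k (i + 1) U (cdiff W i U x)"
        by (auto elim!: dsumE simp: k_def gh sec_normalize[OF H])
    qed
    have b: "mor Z W b"
      unfolding mor_def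
    proof (intro conjI chain_mapI W Z)
      fix i
      show "sheaf_hom X (cob Z i) (cob W i) (b i)"
        by (auto simp: b_def intro!: shom_pair shom_zero shom_neg shom_id)
      fix U z assume "opn U" "z \<in> carrier (sec Z i U)"
      then show "cdiff W i U (b i U z) = b (i + 1) U (cdiff Z i U z)"
        using cm_simps(4)[OF YO E ca, of U i] by (simp add: b_def)
    qed
    have "cone_exact W B \<phi>"
    proof (rule cone_exactI)
      fix i U x w c
      assume U: "opn U" "x \<in> U" and w: "w \<in> carrier (sec W (i + 1) U)" and c: "c \<in> carrier (sec B i U)"
        and dw: "cdiff W (i + 1) U w = \<zero>\<^bsub>sec W (i + 2) U\<^esub>" and eq: "\<phi> (i + 1) U w = cdiff B i U c"
      obtain y z where yz: "w = spair y z" "y \<in> carrier (sec Y (i + 1) U)" "z \<in> carrier (sec Z (i + 1) U)"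
        using w by (auto elim!: dsumE)
      have dy: "cdiff Y (i + 1) U y = \<zero>\<^bsub>sec Y (i + 2) U\<^esub>" using dw by (simp add: yz(1))
      have a1c: "sfst (a (i + 1) U y) \<in> carrier (sec Z (i + 2) U)" using ac(1)[OF U(1) yz(2)] by simp
      have a1: "sfst (a (i + 1) U y) = \<ominus>\<^bsub>sec Z (i + 2) U\<^esub> cdiff Z (i + 1) U z"
        using dw a1c d2[OF U(1) yz(3)] U
        by (simp add: yz(1)) (metis Z abelian_group.minus_equality sec_group)
      have a2: "ssnd (a (i + 1) U y) = f (i + 1) U (s (i + 1) U z) \<oplus>\<^bsub>sec B (i + 1) U\<^esub> cdiff B i U c"
        using eq U yz c by (simp add: \<phi>_def abelian_group.minus_eq_iff_eq_add[OF sec_group])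
      \<comment> \<open>Closedness of \<open>w\<close> and the equation for \<open>c\<close>
        together say that \<open>a y\<close> is the differential of \<open>(z, c)\<close> in
        \<open>E\<close>, so exactness for \<open>a\<close> applies to \<open>y\<close> and this
        section.\<close>
      let ?e = "spair z c"
      have ec: "?e \<in> carrier (sec E i U)" using yz c by simp
      have ay: "a (i + 1) U y = cdiff E i U ?e"
        using ac(3)[OF U(1) yz(2)] a1 a2 by simp
      obtain V y' d where V: "opn V" "x \<in> V" "V \<subseteq> U" and y': "y' \<in> carrier (sec Y i V)" and d: "d \<in> carrier (sec E (i - 1) V)"
        and e1: "rmap (cob Y (i + 1)) U V y = cdiff Y i V y'"
        and e2: "rmap (cob E i) U V ?e = a i V y' \<oplus>\<^bsub>sec E i V\<^esub> cdiff E (i - 1) V d"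
        by (rule cone_exactE[OF ae U yz(2) ec dy ay])
      obtain z' c' where zc: "d = spair z' c'" "z' \<in> carrier (sec Z i V)" "c' \<in> carrier (sec B (i - 1) V)"
        using d by (auto elim!: dsumE)
      have rz: "rmap (cob Z (i + 1)) U V z = sfst (a i V y') \<oplus>\<^bsub>sec Z (i + 1) V\<^esub> (\<ominus>\<^bsub>sec Z (i + 1) V\<^esub> cdiff Z i V z')"
        and rc: "rmap (cob B i) U V c = ssnd (a i V y') \<oplus>\<^bsub>sec B i V\<^esub> (f i V (s i V z') \<oplus>\<^bsub>sec B i V\<^esub> cdiff B (i - 1) V c')"
        using e2 by (simp_all add: zc(1))
      \<comment> \<open>The differential of \<open>z'\<close> enters with a minus sign in
        \<open>E\<close> and with a plus sign in \<open>W\<close>; hence the negation.\<close>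
      let ?w = "spair y' (\<ominus>\<^bsub>sec Z i V\<^esub> z')"
      have 1: "rmap (cob W (i + 1)) U V w = cdiff W i V ?w"
        using V y' zc by (simp add: yz(1) e1 rz)
      have 2: "rmap (cob B i) U V c = \<phi> i V ?w \<oplus>\<^bsub>sec B i V\<^esub> cdiff B (i - 1) V c'"
        using V y' zc by (simp add: rc \<phi>_def sec_normalize[OF B])
      show "\<exists>V a' b'. opn V \<and> x \<in> V \<and> V \<subseteq> U \<and> a' \<in> carrier (sec W i V) \<and> b' \<in> carrier (sec B (i - 1) V) \<and>
        rmap (cob W (i + 1)) U V w = cdiff W i V a' \<and>
        rmap (cob B i) U V c = \<phi> i V a' \<oplus>\<^bsub>sec B i V\<^esub> cdiff B (i - 1) V b'"
        using V y' zc 1 2 by (intro exI[of _ V] exI[of _ ?w] exI[of _ c'] conjI) simp_all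
    qed
    with \<phi> W have q\<phi>: "qi W B \<phi>" by (simp add: qi_def quasi_iso_iff)
    have sqf: "hq Z B (f \<circ>\<^sub>c s) (\<phi> \<circ>\<^sub>c b)"
      by (rule hq_sym[OF hq_eqI[OF fs]]) (simp add: ccomp_def \<phi>_def b_def cm_simps(4)[OF YO E ca])
    have gb: "hq Z H (k \<circ>\<^sub>c b) g"
      by (rule hq_eqI[OF R(2)]) (simp add: ccomp_def k_def b_def)
    have "Dcomp X A B H (cl B H (W, \<phi>, k)) (Dloc X A B f) = cl A H (Z, s, k \<circ>\<^sub>c b)"
      by (rule Dcomp_Dloc_right[OF f q\<phi> k R(1) b sqf])
    also have "\<dots> = \<rho>"
      unfolding R(3) by (rule cl_hqI[OF R(1) gb hq_refl[OF qi_mor[OF R(1)]]])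
    finally show "\<exists>\<sigma>\<in>DHom X B H. Dcomp X A B H \<sigma> (Dloc X A B f) = \<rho>"
      using cl_DHom[OF q\<phi> k] by blast
  }
qed

section \<open>Isomorphisms in the derived category\<close>

lemma Diso_cancel_left:
  assumes "A \<in> Ob" "B \<in> Ob" "C \<in> Ob" "Diso X B C \<phi>" "\<sigma> \<in> DHom X A B" "\<tau> \<in> DHom X A B"
    "Dcomp X A B C \<phi> \<sigma> = Dcomp X A B C \<phi> \<tau>"
  shows "\<sigma> = \<tau>"
proof -
  obtain \<psi> where p: "\<phi> \<in> DHom X B C" "\<psi> \<in> DHom X C B" "Dcomp X B C B \<psi> \<phi> = Did X B"
    using assms(4) by (rule DisoE)
  have "Dcomp X A C B \<psi> (Dcomp X A B C \<phi> \<kappa>) = \<kappa>" if "\<kappa> \<in> DHom X A B" for \<kappa>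
    using Dcomp_assoc[OF assms(1,2,3,2) that p(1,2)] Dcomp_id_left[OF assms(1,2) that] by (simp add: p(3))
  then show ?thesis using assms(5-7) by metis
qed

lemma Diso_cancel_right:
  assumes "A \<in> Ob" "B \<in> Ob" "C \<in> Ob" "Diso X A B \<phi>" "\<sigma> \<in> DHom X B C" "\<tau> \<in> DHom X B C"
    "Dcomp X A B C \<sigma> \<phi> = Dcomp X A B C \<tau> \<phi>"
  shows "\<sigma> = \<tau>"
proof -
  obtain \<psi> where p: "\<phi> \<in> DHom X A B" "\<psi> \<in> DHom X B A" "Dcomp X B A B \<phi> \<psi> = Did X B"
    using assms(4) by (rule DisoE)
  have "Dcomp X B A C (Dcomp X A B C \<kappa> \<phi>) \<psi> = \<kappa>" if "\<kappa> \<in> DHom X B C" for \<kappa>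
    using Dcomp_assoc[OF assms(2,1,2,3) p(2,1) that] Dcomp_id_right[OF assms(2,3) that] by (simp add: p(3))
  then show ?thesis using assms(5-7) by metis
qed

lemma Diso_lift:
  assumes "A \<in> Ob" "B \<in> Ob" "C \<in> Ob" "Diso X B C \<phi>" "\<sigma> \<in> DHom X A C"
  obtains \<tau> where "\<tau> \<in> DHom X A B" "Dcomp X A B C \<phi> \<tau> = \<sigma>"
proof -
  obtain \<psi> where p: "\<phi> \<in> DHom X B C" "\<psi> \<in> DHom X C B" "Dcomp X C B C \<phi> \<psi> = Did X C"
    using assms(4) by (rule DisoE)
  have "Dcomp X A B C \<phi> (Dcomp X A C B \<psi> \<sigma>) = \<sigma>"
    using Dcomp_assoc[OF assms(1,3,2,3,5) p(2,1)] Dcomp_id_left[OF assms(1,3,5)] by (simp add: p(3))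
  then show ?thesis using that[OF Dcomp_closed[OF assms(1,3,2,5) p(2)]] by blast
qed

lemma Diso_extend:
  assumes "A \<in> Ob" "B \<in> Ob" "C \<in> Ob" "Diso X A B \<phi>" "\<sigma> \<in> DHom X A C"
  obtains \<tau> where "\<tau> \<in> DHom X B C" "Dcomp X A B C \<tau> \<phi> = \<sigma>"
proof -
  obtain \<psi> where p: "\<phi> \<in> DHom X A B" "\<psi> \<in> DHom X B A" "Dcomp X A B A \<psi> \<phi> = Did X A"
    using assms(4) by (rule DisoE)
  have "Dcomp X A B C (Dcomp X B A C \<sigma> \<psi>) \<phi> = \<sigma>"
    using Dcomp_assoc[OF assms(1,2,1,3) p(1,2) assms(5)] Dcomp_id_right[OF assms(1,3,5)] by (simp add: p(3))
  then show ?thesis using that[OF Dcomp_closed[OF assms(2,1,3) p(2) assms(5)]] by blast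
qed

section \<open>The obstructions for a distinguished triangle\<close>

context
  fixes B C D u v w A A' f \<alpha> \<beta> \<gamma>
  assumes B: "B \<in> Ob" and C: "C \<in> Ob" and D: "D \<in> Ob"
    and u: "u \<in> DHom X B C" and v: "v \<in> DHom X C D" and w: "w \<in> DHom X D (shift 1 B)"
    and f: "mor A A' f"
    and \<alpha>: "Diso X B A \<alpha>" and \<beta>: "Diso X C A' \<beta>" and \<gamma>: "Diso X D (cone A A' f) \<gamma>"
    and uf: "Dcomp X B C A' \<beta> u = Dcomp X B A A' (Dloc X A A' f) \<alpha>"
    and vi: "Dcomp X C D (cone A A' f) \<gamma> v =
          Dcomp X C A' (cone A A' f) (Dloc X A' (cone A A' f) (cone_incl A)) \<beta>"
    and wp: "Dcomp X D (shift 1 B) (shift 1 A) (Dshift X 1 B A \<alpha>) w =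
          Dcomp X D (cone A A' f) (shift 1 A) (Dloc X (cone A A' f) (shift 1 A) cone_proj) \<gamma>"
begin

lemma triangle_Ob: "A \<in> Ob" "A' \<in> Ob" "cone A A' f \<in> Ob"
  using f cone_Ob by (auto simp: mor_def)

text \<open>Vanishing can be tested after the isomorphism \<open>a\<close>, and the shifted square
  for \<open>w\<close> turns \<open>a w' \<tau>\<close> into the projection of
  \<open>c \<tau>\<close>. Exactness for the cone then gives a lift to \<open>A'[p]\<close>, which
  is carried back along \<open>b\<close>; the square for \<open>v\<close> and cancellation of
  \<open>c\<close> show that it lifts \<tau>.\<close>

lemma lifting_obstruction:
  assumes F: "F \<in> Ob" and \<tau>: "\<tau> \<in> DHom X F (shift p D)"
  shows "(\<exists>\<tau>'\<in>DHom X F (shift p C). Dcomp X F (shift p C) (shift p D) (Dshift X p C D v) \<tau>' = \<tau>) \<longleftrightarrow>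
    Dcomp X F (shift p D) (shift p (shift 1 B)) (Dshift X p D (shift 1 B) w) \<tau> = Dzero X F (shift p (shift 1 B))"
proof -
  note A = triangle_Ob(1) and A' = triangle_Ob(2) and T = triangle_Ob(3)
  note [simp] = A A' T B C D F
  define a where "a = Dshift X p (shift 1 B) (shift 1 A) (Dshift X 1 B A \<alpha>)"
  define b where "b = Dshift X p C A' \<beta>"
  define c where "c = Dshift X p D (cone A A' f) \<gamma>"
  define i where "i = Dshift X p A' (cone A A' f) (Dloc X A' (cone A A' f) (cone_incl A))"
  define q where "q = Dshift X p (cone A A' f) (shift 1 A) (Dloc X (cone A A' f) (shift 1 A) cone_proj)"
  define v' where "v' = Dshift X p C D v"
  define w' where "w' = Dshift X p D (shift 1 B) w"
  have ia: "Diso X (shift p (shift 1 B)) (shift p (shift 1 A)) a" unfolding a_def by (intro Diso_shift \<alpha>) simp_all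
  have ib: "Diso X (shift p C) (shift p A') b" unfolding b_def by (intro Diso_shift \<beta>) simp_all
  have ic: "Diso X (shift p D) (shift p (cone A A' f)) c" unfolding c_def by (intro Diso_shift \<gamma>) simp_all
  have dH: "\<alpha> \<in> DHom X B A" "\<beta> \<in> DHom X C A'" "\<gamma> \<in> DHom X D (cone A A' f)" using \<alpha> \<beta> \<gamma> by (simp_all add: Diso_def)
  have inH: "Dloc X A' (cone A A' f) (cone_incl A) \<in> DHom X A' (cone A A' f)"
    and prH: "Dloc X (cone A A' f) (shift 1 A) cone_proj \<in> DHom X (cone A A' f) (shift 1 A)"
    using Dloc_DHom[OF cone_incl_mor[OF f]] Dloc_DHom[OF cone_proj_mor[OF f]] .
  have a1: "Dshift X 1 B A \<alpha> \<in> DHom X (shift 1 B) (shift 1 A)" using dH by (intro Dshift_DHom) simp_all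
  have H: "a \<in> DHom X (shift p (shift 1 B)) (shift p (shift 1 A))" "b \<in> DHom X (shift p C) (shift p A')"
    "c \<in> DHom X (shift p D) (shift p (cone A A' f))" "i \<in> DHom X (shift p A') (shift p (cone A A' f))"
    "q \<in> DHom X (shift p (cone A A' f)) (shift p (shift 1 A))" "v' \<in> DHom X (shift p C) (shift p D)"
    "w' \<in> DHom X (shift p D) (shift p (shift 1 B))"
    unfolding a_def b_def c_def i_def q_def v'_def w'_def using dH a1 inH prH v w by (auto intro: Dshift_DHom)
  have aw: "Dcomp X (shift p D) (shift p (shift 1 B)) (shift p (shift 1 A)) a w' =
    Dcomp X (shift p D) (shift p (cone A A' f)) (shift p (shift 1 A)) q c"
    using Dshift_Dcomp[OF D shift_Ob[OF B] shift_Ob[OF A] w a1, of p] Dshift_Dcomp[OF D T shift_Ob[OF A] dH(3) prH, of p] wp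
    by (simp add: a_def w'_def q_def c_def)
  have cv: "Dcomp X (shift p C) (shift p D) (shift p (cone A A' f)) c v' =
    Dcomp X (shift p C) (shift p A') (shift p (cone A A' f)) i b"
    using Dshift_Dcomp[OF C D T v dH(3), of p] Dshift_Dcomp[OF C A' T dH(2) inH, of p] vi
    by (simp add: c_def v'_def i_def b_def)
  let ?D = "shift p D" and ?B1 = "shift p (shift 1 B)" and ?A1 = "shift p (shift 1 A)" and ?T = "shift p (cone A A' f)"
    and ?A' = "shift p A'" and ?C = "shift p C"
  have O: "?D \<in> Ob" "?B1 \<in> Ob" "?A1 \<in> Ob" "?T \<in> Ob" "?A' \<in> Ob" "?C \<in> Ob" by simp_all
  have wt: "Dcomp X F ?D ?B1 w' \<tau> \<in> DHom X F ?B1" by (rule Dcomp_closed[OF F O(1,2) \<tau> H(7)])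
  have ct: "Dcomp X F ?D ?T c \<tau> \<in> DHom X F ?T" by (rule Dcomp_closed[OF F O(1,4) \<tau> H(3)])
  have "Dcomp X F ?D ?B1 w' \<tau> = Dzero X F ?B1 \<longleftrightarrow>
      Dcomp X F ?B1 ?A1 a (Dcomp X F ?D ?B1 w' \<tau>) = Dcomp X F ?B1 ?A1 a (Dzero X F ?B1)"
    using Diso_cancel_left[OF F O(2,3) ia wt Dzero_DHom[OF F O(2)]] by metis
  also have "Dcomp X F ?B1 ?A1 a (Dzero X F ?B1) = Dzero X F ?A1" by (rule Dcomp_Dzero_right[OF F O(2,3) H(1)])
  also have "Dcomp X F ?B1 ?A1 a (Dcomp X F ?D ?B1 w' \<tau>) = Dcomp X F ?T ?A1 q (Dcomp X F ?D ?T c \<tau>)"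
    unfolding Dcomp_assoc[OF F O(1,2,3) \<tau> H(7,1), symmetric] aw by (rule Dcomp_assoc[OF F O(1,4,3) \<tau> H(3,5)])
  also have "Dcomp X F ?T ?A1 q (Dcomp X F ?D ?T c \<tau>) = Dzero X F ?A1 \<longleftrightarrow>
      (\<exists>\<sigma>\<in>DHom X F ?A'. Dcomp X F ?A' ?T i \<sigma> = Dcomp X F ?D ?T c \<tau>)"
    unfolding q_def i_def by (rule push_exact[OF f F ct])
  also have "\<dots> \<longleftrightarrow> (\<exists>\<tau>'\<in>DHom X F ?C. Dcomp X F ?C ?D v' \<tau>' = \<tau>)"
  proof
    have cvt: "Dcomp X F ?D ?T c (Dcomp X F ?C ?D v' \<tau>') = Dcomp X F ?A' ?T i (Dcomp X F ?C ?A' b \<tau>')"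
      if "\<tau>' \<in> DHom X F ?C" for \<tau>'
      unfolding Dcomp_assoc[OF F O(6,1,4) that H(6,3), symmetric] cv by (rule Dcomp_assoc[OF F O(6,5,4) that H(2,4)])
    {
      assume "\<exists>\<sigma>\<in>DHom X F ?A'. Dcomp X F ?A' ?T i \<sigma> = Dcomp X F ?D ?T c \<tau>"
      then obtain \<sigma> where s: "\<sigma> \<in> DHom X F ?A'" "Dcomp X F ?A' ?T i \<sigma> = Dcomp X F ?D ?T c \<tau>" by blast
      obtain \<tau>' where t: "\<tau>' \<in> DHom X F ?C" "Dcomp X F ?C ?A' b \<tau>' = \<sigma>" by (rule Diso_lift[OF F O(6,5) ib s(1)])
      have "Dcomp X F ?C ?D v' \<tau>' = \<tau>"
        using cvt[OF t(1)] s(2) t(2) by (intro Diso_cancel_left[OF F O(1,4) ic Dcomp_closed[OF F O(6,1) t(1) H(6)] \<tau>]) simp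
      with t(1) show "\<exists>\<tau>'\<in>DHom X F ?C. Dcomp X F ?C ?D v' \<tau>' = \<tau>" by blast
    next
      assume "\<exists>\<tau>'\<in>DHom X F ?C. Dcomp X F ?C ?D v' \<tau>' = \<tau>"
      then show "\<exists>\<sigma>\<in>DHom X F ?A'. Dcomp X F ?A' ?T i \<sigma> = Dcomp X F ?D ?T c \<tau>"
        using cvt Dcomp_closed[OF F O(6,5) _ H(2)] by metis
    }
  qed
  finally show ?thesis unfolding v'_def w'_def by simp
qed

text \<open>With \<open>H\<close> arbitrary, later \<open>G[p]\<close>, the degree \<open>p\<close>
  disappears from the argument. Writing \<rho> as \<open>\<rho>0\<close> after \<alpha> moves the
  obstruction along the square for \<open>w\<close> to the cone, and cancelling \<gamma> on the
  right leaves the vanishing condition of \<open>pull_exact\<close>.\<close>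

lemma extension_obstruction:
  assumes H: "H \<in> Ob" and \<rho>: "\<rho> \<in> DHom X B H"
  shows "(\<exists>\<rho>'\<in>DHom X C H. Dcomp X B C H \<rho>' u = \<rho>) \<longleftrightarrow>
    Dcomp X D (shift 1 B) (shift 1 H) (Dshift X 1 B H \<rho>) w = Dzero X D (shift 1 H)"
proof -
  note A = triangle_Ob(1) and A' = triangle_Ob(2) and T = triangle_Ob(3)
  define pr where "pr = Dloc X (cone A A' f) (shift 1 A) cone_proj"
  let ?A1 = "shift 1 A" and ?B1 = "shift 1 B" and ?H1 = "shift 1 H" and ?T = "cone A A' f"
  have O: "?A1 \<in> Ob" "?B1 \<in> Ob" "?H1 \<in> Ob" using A B H by simp_all
  have dH: "\<alpha> \<in> DHom X B A" "\<beta> \<in> DHom X C A'" "\<gamma> \<in> DHom X D ?T" using \<alpha> \<beta> \<gamma> by (simp_all add: Diso_def)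
  have prH: "pr \<in> DHom X ?T ?A1" unfolding pr_def by (rule Dloc_DHom[OF cone_proj_mor[OF f]])
  note fH = Dloc_DHom[OF f]
  obtain \<rho>0 where r: "\<rho>0 \<in> DHom X A H" "Dcomp X B A H \<rho>0 \<alpha> = \<rho>" by (rule Diso_extend[OF B A H \<alpha> \<rho>])
  have r1: "Dshift X 1 A H \<rho>0 \<in> DHom X ?A1 ?H1" by (rule Dshift_DHom[OF A H r(1)])
  have a1: "Dshift X 1 B A \<alpha> \<in> DHom X ?B1 ?A1" by (rule Dshift_DHom[OF B A dH(1)])
  have rp: "Dcomp X ?T ?A1 ?H1 (Dshift X 1 A H \<rho>0) pr \<in> DHom X ?T ?H1" by (rule Dcomp_closed[OF T O(1,3) prH r1])
  have "Dcomp X D ?B1 ?H1 (Dshift X 1 B H \<rho>) w = Dcomp X D ?B1 ?H1 (Dcomp X ?B1 ?A1 ?H1 (Dshift X 1 A H \<rho>0) (Dshift X 1 B A \<alpha>)) w"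
    unfolding r(2)[symmetric] Dshift_Dcomp[OF B A H dH(1) r(1)] ..
  also have "\<dots> = Dcomp X D ?A1 ?H1 (Dshift X 1 A H \<rho>0) (Dcomp X D ?T ?A1 pr \<gamma>)"
    unfolding Dcomp_assoc[OF D O(2,1,3) w a1 r1] wp pr_def ..
  also have "\<dots> = Dcomp X D ?T ?H1 (Dcomp X ?T ?A1 ?H1 (Dshift X 1 A H \<rho>0) pr) \<gamma>"
    by (rule Dcomp_assoc[OF D T O(1,3) dH(3) prH r1, symmetric])
  finally have "Dcomp X D ?B1 ?H1 (Dshift X 1 B H \<rho>) w = Dzero X D ?H1 \<longleftrightarrow>
    Dcomp X D ?T ?H1 (Dcomp X ?T ?A1 ?H1 (Dshift X 1 A H \<rho>0) pr) \<gamma> = Dcomp X D ?T ?H1 (Dzero X ?T ?H1) \<gamma>"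
    by (simp add: Dcomp_Dzero_left[OF D T O(3) dH(3)])
  also have "\<dots> \<longleftrightarrow> Dcomp X ?T ?A1 ?H1 (Dshift X 1 A H \<rho>0) pr = Dzero X ?T ?H1"
    using Diso_cancel_right[OF D T O(3) \<gamma> rp Dzero_DHom[OF T O(3)]] by metis
  also have "\<dots> \<longleftrightarrow> (\<exists>\<sigma>\<in>DHom X A' H. Dcomp X A A' H \<sigma> (Dloc X A A' f) = \<rho>0)"
    unfolding pr_def by (rule pull_exact[OF f H r(1)])
  also have "\<dots> \<longleftrightarrow> (\<exists>\<rho>'\<in>DHom X C H. Dcomp X B C H \<rho>' u = \<rho>)"
  proof
    have sq: "Dcomp X B C H (Dcomp X C A' H \<sigma> \<beta>) u = Dcomp X B A H (Dcomp X A A' H \<sigma> (Dloc X A A' f)) \<alpha>"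
      if "\<sigma> \<in> DHom X A' H" for \<sigma>
      unfolding Dcomp_assoc[OF B C A' H u dH(2) that] uf by (rule Dcomp_assoc[OF B A A' H dH(1) fH that, symmetric])
    {
      assume "\<exists>\<sigma>\<in>DHom X A' H. Dcomp X A A' H \<sigma> (Dloc X A A' f) = \<rho>0"
      then show "\<exists>\<rho>'\<in>DHom X C H. Dcomp X B C H \<rho>' u = \<rho>"
        using sq r(2) Dcomp_closed[OF C A' H dH(2)] by metis
    next
      assume "\<exists>\<rho>'\<in>DHom X C H. Dcomp X B C H \<rho>' u = \<rho>"
      then obtain \<rho>' where r': "\<rho>' \<in> DHom X C H" "Dcomp X B C H \<rho>' u = \<rho>" by blast
      obtain \<sigma> where s: "\<sigma> \<in> DHom X A' H" "Dcomp X C A' H \<sigma> \<beta> = \<rho>'" by (rule Diso_extend[OF C A' H \<beta> r'(1)])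
      have "Dcomp X A A' H \<sigma> (Dloc X A A' f) = \<rho>0"
        using sq[OF s(1)] s(2) r'(2) r(2)
        by (intro Diso_cancel_right[OF B A H \<alpha> Dcomp_closed[OF A A' H fH s(1)] r(1)]) simp
      with s(1) show "\<exists>\<sigma>\<in>DHom X A' H. Dcomp X A A' H \<sigma> (Dloc X A A' f) = \<rho>0" by blast
    }
  qed
  finally show ?thesis by simp
qed

end

end

section \<open>The obstructions in the Ext groups\<close>

theorem proposition1:
  fixes X :: "'x cmanifold" and n :: nat and p :: int
    and B C D F G :: "('x, 's) cplx"
    and u v w :: "('x, 's) roof set"
  assumes "compact_kaehler_manifold X" and "cdim X = n"
    and large_section_type: "\<exists>e :: ('x \<Rightarrow> complex) \<Rightarrow> 's. inj e"
    and "distinguished X B C D u v w"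
    and "F \<in> Dob X" and "G \<in> Dob X"
  shows "(\<forall>\<tau> \<in> Ext X p F D.
            Ext_connecting_covariant X p F D B w \<tau> \<in> Ext X (p + 1) F B \<and>
            ((\<exists>\<tau>' \<in> Ext X p F C. Ext_push X p F C D v \<tau>' = \<tau>) \<longleftrightarrow>
              Ext_connecting_covariant X p F D B w \<tau> = Ext_zero X (p + 1) F B)) \<and>
         (\<forall>\<rho> \<in> Ext X p B G.
            Ext_connecting_contravariant X p D B G w \<rho> \<in> Ext X (p + 1) D G \<and>
            ((\<exists>\<rho>' \<in> Ext X p C G. Ext_pull X p B C G u \<rho>' = \<rho>) \<longleftrightarrow>
              Ext_connecting_contravariant X p D B G w \<rho> = Ext_zero X (p + 1) D G))"
proof -
  have "infinite (UNIV :: 's set)"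
  proof
    assume fin: "finite (UNIV :: 's set)"
    obtain e :: "('x \<Rightarrow> complex) \<Rightarrow> 's" where e: "inj e" using large_section_type by blast
    have "finite (UNIV :: ('x \<Rightarrow> complex) set)" using finite_imageD[OF finite_subset[OF subset_UNIV fin] e] .
    \<comment> \<open>Types are inhabited, so the constant functions embed the complex numbers into
      the function type.\<close>
    moreover have "inj (\<lambda>(c::complex) (x::'x). c)" by (auto simp: inj_def fun_eq_iff)
    ultimately have "finite (UNIV :: complex set)" by (metis finite_imageD finite_subset subset_UNIV)
    then show False by (simp add: infinite_UNIV_char_0)
  qed
  then interpret coherent_sheaves X "pair_code :: 's \<times> 's \<Rightarrow> 's"
    using assms(1) infinite_imp_inj_pair_code
    by unfold_locales (simp_all add: compact_kaehler_manifold_def)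
  obtain A A' f \<alpha> \<beta> \<gamma> where
    t: "B \<in> Ob" "C \<in> Ob" "D \<in> Ob" "u \<in> DHom X B C" "v \<in> DHom X C D" "w \<in> DHom X D (shift 1 B)"
      "A \<in> Ob" "A' \<in> Ob" "chain_map X A A' f"
      "Diso X B A \<alpha>" "Diso X C A' \<beta>" "Diso X D (cone A A' f) \<gamma>"
      "Dcomp X B C A' \<beta> u = Dcomp X B A A' (Dloc X A A' f) \<alpha>"
      "Dcomp X C D (cone A A' f) \<gamma> v = Dcomp X C A' (cone A A' f) (Dloc X A' (cone A A' f) (cone_incl A)) \<beta>"
      "Dcomp X D (shift 1 B) (shift 1 A) (Dshift X 1 B A \<alpha>) w =
        Dcomp X D (cone A A' f) (shift 1 A) (Dloc X (cone A A' f) (shift 1 A) cone_proj) \<gamma>"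
    using assms(4) unfolding distinguished_def by (elim conjE exE)
  have f: "mor A A' f" using t by (simp add: mor_def)
  have F: "F \<in> Ob" and G: "G \<in> Ob" using assms by simp_all
  have H: "shift p G \<in> Ob" using G by simp
  \<comment> \<open>The connecting maps are stated with targets \<open>B[p+1]\<close> and
    \<open>G[p+1]\<close>, whereas the shifted morphisms end in \<open>B[1][p]\<close> and
    \<open>G[p][1]\<close>. The equations of \<open>ceq_target\<close> replace the former by the
    latter in morphism sets, composites and zeros.\<close>
  note cB = ceq_target[OF ceq_shift_shift[OF t(1), of p 1], symmetric]
  have cG: "ceq (shift 1 (shift p G)) (shift (p + 1) G)" using ceq_shift_shift[OF G, of 1 p] by (simp add: add.commute)
  note cG = ceq_target[OF cG, symmetric]
  show ?thesis
    unfolding Ext_def Ext_zero_def Ext_push_def Ext_pull_def Ext_connecting_covariant_def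
      Ext_connecting_contravariant_def cB cG
    using lifting_obstruction[OF t(1-6) f t(10-15) F] extension_obstruction[OF t(1-6) f t(10-15) H] t F H
    by (auto intro!: Dcomp_closed Dshift_DHom)
qed

end
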